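(* Let $H$ be a complex Hilbert space with inner product $(\cdot,\cdot)_H$, let $J$ be a signature operator in $H$ (i.e. $J=J^*=J^{-1}$), let $H_\pm:=\ker(J\mp I)$ and let $P_\pm$ be the orthogonal projections of $H$ onto $H_\pm$. Let $L$ be a self-adjoint operator in $H$ which is positive, i.e. $L\ge 0$ and $\ker L=0$. Assume that the operator $B:=JL$ (with $\operatorname{dom}(B)=\operatorname{dom}(L)$) is similar to a self-adjoint operator in $H$, and let $0<\tau<\infty$. Then for each pair $\{\varphi_+,\varphi_-\}$ with $\varphi_\pm\in H_\pm$ there is a unique strong solution $\psi$ of the problem $$\frac{d\psi}{dx}=-JL\psi(x)\quad(0<x<\tau),\qquad P_+\psi(0)=\varphi_+,\qquad P_-\psi(\tau)=\varphi_-.$$ This solution is given by $$\psi(x)=e^{-xB^+}(I-G_-G_+)^{-1}\big(R_+\varphi_+-G_-R_-\varphi_-\big)+e^{(\tau-x)B^-}(I-G_+G_-)^{-1}\big(R_-\varphi_--G_+R_+\varphi_+\big),$$ where $B^\pm$, $R_\pm$, $G_\pm$ are as described in the context.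
   Context: Two closed operators $T_1,T_2$ in $H$ are similar if there is a bounded, boundedly invertible $S$ in $H$ with $S\operatorname{dom}(T_1)=\operatorname{dom}(T_2)$ and $T_2=ST_1S^{-1}$. Put $[f,g]:=(Jf,g)_H$. A strong solution is a function $\psi\in C([0,\tau];H)$ which is strongly continuously differentiable on $(0,\tau)$, with $\psi(x)\in\operatorname{dom}(L)$ and $\psi'(x)=-JL\psi(x)$ for $x\in(0,\tau)$, and satisfying the boundary conditions. Under the hypotheses, $B$ is $J$-self-adjoint and $J$-positive with real spectrum, and there is a decomposition $H=H^B_+\dotplus H^B_-$ into closed $B$-invariant subspaces which are $J$-orthogonal ($[h_+,h_-]=0$), such that $[\cdot,\cdot]$ is nonnegative on $H^B_+$ and nonpositive on $H^B_-$, $B=B^+\dotplus B^-$ with $B^\pm:=B\upharpoonright(\operatorname{dom}(B)\cap H^B_\pm)$, and $\sigma(B^\pm)=\overline{\sigma(B)\cap\mathbb R_\pm}$; the corresponding projections are the spectral projections $E^B(\mathbb R_\pm)$ of $B$. $H^B_\pm$ are Hilbert spaces with inner products $\pm[\cdot,\cdot]$, in which $B^+$ is positive self-adjoint and $B^-$ is negative self-adjoint, so $e^{-xB^+}$ ($x\ge0$) and $e^{yB^-}$ ($y\ge0$) are defined by functional calculus. $R_\pm:=(P_\pm\upharpoonright H^B_\pm)^{-1}:H_\pm\to H^B_\pm$ (these inverses exist and are homeomorphisms). $G_+:H^B_+\to H^B_-$, $G_+h_+:=R_-P_-e^{-\tau B^+}h_+$, and $G_-:H^B_-\to H^B_+$,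 $G_-h_-:=R_+P_+e^{\tau B^-}h_-$. *)

theory Defs
  imports "HOL-Analysis.Analysis"
begin

class chilbert = banach +
  fixes scaleC :: "complex \<Rightarrow> 'a \<Rightarrow> 'a"
    and cinner :: "'a \<Rightarrow> 'a \<Rightarrow> complex"
  assumes scaleC_add_right: "scaleC c (x + y) = scaleC c x + scaleC c y"
    and scaleC_add_left: "scaleC (c + d) x = scaleC c x + scaleC d x"
    and scaleC_scaleC: "scaleC c (scaleC d x) = scaleC (c * d) x"
    and scaleC_one: "scaleC 1 x = x"
    and scaleR_scaleC: "scaleR r x = scaleC (complex_of_real r) x"
    and cinner_add_left: "cinner (x + y) z = cinner x z + cinner y z"
    and cinner_scaleC_left: "cinner (scaleC c x) y = c * cinner x y"
    and cinner_commute: "cinner y x = cnj (cinner x y)"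
    and norm_cinner: "norm x = sqrt (Re (cinner x x))"

section \<open>Linear operators (possibly unbounded, given by domain and action)\<close>

definition csubspace :: "'a::chilbert set \<Rightarrow> bool" where
  "csubspace S \<longleftrightarrow> 0 \<in> S \<and> (\<forall>x\<in>S. \<forall>y\<in>S. x + y \<in> S) \<and> (\<forall>c. \<forall>x\<in>S. scaleC c x \<in> S)"

definition clinear_on :: "'a::chilbert set \<Rightarrow> ('a \<Rightarrow> 'a) \<Rightarrow> bool" where
  "clinear_on D T \<longleftrightarrow> csubspace D \<and> (\<forall>x\<in>D. \<forall>y\<in>D. T (x + y) = T x + T y)
     \<and> (\<forall>c. \<forall>x\<in>D. T (scaleC c x) = scaleC c (T x))"

definition bounded_clinear_op :: "('a::chilbert \<Rightarrow> 'a) \<Rightarrow> bool" where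
  "bounded_clinear_op S \<longleftrightarrow> clinear_on UNIV S \<and> (\<exists>K. \<forall>x. norm (S x) \<le> K * norm x)"

text \<open>Self-adjoint operator (D,T) in H: densely defined, and its adjoint
(domain = all g for which f \<mapsto> (Tf,g) is represented by some h) equals T.\<close>
definition self_adjoint :: "'a::chilbert set \<Rightarrow> ('a \<Rightarrow> 'a) \<Rightarrow> bool" where
  "self_adjoint D T \<longleftrightarrow> clinear_on D T \<and> closure D = UNIV
     \<and> (\<forall>g. (\<exists>h. \<forall>f\<in>D. cinner (T f) g = cinner f h) \<longleftrightarrow> g \<in> D)
     \<and> (\<forall>f\<in>D. \<forall>g\<in>D. cinner (T f) g = cinner f (T g))"

definition signature_op :: "('a::chilbert \<Rightarrow> 'a) \<Rightarrow> bool" where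
  "signature_op J \<longleftrightarrow> bounded_clinear_op J \<and> (\<forall>x. J (J x) = x)
     \<and> (\<forall>x y. cinner (J x) y = cinner x (J y))"

definition Hplus :: "('a::chilbert \<Rightarrow> 'a) \<Rightarrow> 'a set" where
  "Hplus J = {x. J x = x}"

definition Hminus :: "('a::chilbert \<Rightarrow> 'a) \<Rightarrow> 'a set" where
  "Hminus J = {x. J x = - x}"

definition orth_proj :: "'a::chilbert set \<Rightarrow> 'a \<Rightarrow> 'a" where
  "orth_proj S x = (THE y. y \<in> S \<and> (\<forall>z\<in>S. cinner (x - y) z = 0))"

definition positive_op :: "'a::chilbert set \<Rightarrow> ('a \<Rightarrow> 'a) \<Rightarrow> bool" where
  "positive_op D L \<longleftrightarrow> (\<forall>f\<in>D. 0 \<le> Re (cinner (L f) f)) \<and> (\<forall>f\<in>D. L f = 0 \<longrightarrow> f = 0)"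

definition similar_ops :: "'a::chilbert set \<Rightarrow> ('a \<Rightarrow> 'a) \<Rightarrow> 'a set \<Rightarrow> ('a \<Rightarrow> 'a) \<Rightarrow> bool" where
  "similar_ops D1 T1 D2 T2 \<longleftrightarrow> (\<exists>S Si. bounded_clinear_op S \<and> bounded_clinear_op Si
     \<and> (\<forall>x. Si (S x) = x) \<and> (\<forall>x. S (Si x) = x) \<and> S ` D1 = D2
     \<and> (\<forall>y\<in>D2. T2 y = S (T1 (Si y))))"

definition similar_to_selfadjoint :: "'a::chilbert set \<Rightarrow> ('a \<Rightarrow> 'a) \<Rightarrow> bool" where
  "similar_to_selfadjoint D T \<longleftrightarrow> (\<exists>D' A. self_adjoint D' A \<and> similar_ops D T D' A)"

definition spectrum_on :: "'a::chilbert set \<Rightarrow> 'a set \<Rightarrow> ('a \<Rightarrow> 'a) \<Rightarrow> complex set" where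
  "spectrum_on V D T = {lam. \<not> ((\<forall>y\<in>V. \<exists>!x. x \<in> D \<and> T x - scaleC lam x = y)
       \<and> (\<exists>K. \<forall>x\<in>D. norm x \<le> K * norm (T x - scaleC lam x)))}"

definition strong_solution ::
  "('a::chilbert \<Rightarrow> 'a) \<Rightarrow> 'a set \<Rightarrow> ('a \<Rightarrow> 'a) \<Rightarrow> real \<Rightarrow> 'a \<Rightarrow> 'a \<Rightarrow> (real \<Rightarrow> 'a) \<Rightarrow> bool" where
  "strong_solution J DL L tau phip phim psi \<longleftrightarrow>
     continuous_on {0..tau} psi
     \<and> (\<exists>psi'. continuous_on {0<..<tau} psi'
          \<and> (\<forall>x\<in>{0<..<tau}. (psi has_vector_derivative psi' x) (at x)
                 \<and> psi x \<in> DL \<and> psi' x = - J (L (psi x))))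
     \<and> orth_proj (Hplus J) (psi 0) = phip
     \<and> orth_proj (Hminus J) (psi tau) = phim"

definition spectral_decomp ::
  "('a::chilbert \<Rightarrow> 'a) \<Rightarrow> 'a set \<Rightarrow> ('a \<Rightarrow> 'a) \<Rightarrow> 'a set \<Rightarrow> 'a set \<Rightarrow> bool" where
  "spectral_decomp J DL L Hp Hm \<longleftrightarrow>
     csubspace Hp \<and> csubspace Hm \<and> closed Hp \<and> closed Hm
     \<and> (\<forall>h. \<exists>!p. fst p \<in> Hp \<and> snd p \<in> Hm \<and> h = fst p + snd p)
     \<and> (\<forall>f\<in>DL \<inter> Hp. J (L f) \<in> Hp) \<and> (\<forall>f\<in>DL \<inter> Hm. J (L f) \<in> Hm)
     \<and> (\<forall>a\<in>Hp. \<forall>b\<in>Hm. a + b \<in> DL \<longrightarrow> a \<in> DL \<and> b \<in> DL)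
     \<and> (\<forall>a\<in>Hp. \<forall>b\<in>Hm. cinner (J a) b = 0)
     \<and> (\<forall>a\<in>Hp. 0 \<le> Re (cinner (J a) a)) \<and> (\<forall>b\<in>Hm. Re (cinner (J b) b) \<le> 0)
     \<and> (\<exists>c>0. \<forall>a\<in>Hp. c * (norm a)\<^sup>2 \<le> Re (cinner (J a) a))
     \<and> (\<exists>c>0. \<forall>b\<in>Hm. c * (norm b)\<^sup>2 \<le> - Re (cinner (J b) b))
     \<and> spectrum_on Hp (DL \<inter> Hp) (\<lambda>f. J (L f))
         = closure (spectrum_on UNIV DL (\<lambda>f. J (L f)) \<inter> {z. Im z = 0 \<and> Re z > 0})
     \<and> spectrum_on Hm (DL \<inter> Hm) (\<lambda>f. J (L f))
         = closure (spectrum_on UNIV DL (\<lambda>f. J (L f)) \<inter> {z. Im z = 0 \<and> Re z < 0})"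

text \<open>T is the C0-semigroup on the closed subspace V whose generator is (D,A);
T is normalised to 0 outside t \<ge> 0, f \<in> V so that it is unique.\<close>
definition semigroup_gen :: "'a::chilbert set \<Rightarrow> 'a set \<Rightarrow> ('a \<Rightarrow> 'a) \<Rightarrow> (real \<Rightarrow> 'a \<Rightarrow> 'a) \<Rightarrow> bool" where
  "semigroup_gen V D A T \<longleftrightarrow>
     (\<forall>t f. (t < 0 \<or> f \<notin> V) \<longrightarrow> T t f = 0)
     \<and> (\<forall>t\<ge>0. \<forall>f\<in>V. T t f \<in> V)
     \<and> (\<forall>t\<ge>0. clinear_on V (T t) \<and> (\<exists>K. \<forall>f\<in>V. norm (T t f) \<le> K * norm f))
     \<and> (\<forall>f\<in>V. T 0 f = f)
     \<and> (\<forall>s\<ge>0. \<forall>t\<ge>0. \<forall>f\<in>V. T (s + t) f = T s (T t f))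
     \<and> (\<forall>f\<in>V. ((\<lambda>t. T t f) \<longlongrightarrow> f) (at_right 0))
     \<and> (\<forall>f\<in>V. \<forall>g. (((\<lambda>h. scaleR (1 / h) (T h f - f)) \<longlongrightarrow> g) (at_right 0))
                     \<longleftrightarrow> (f \<in> D \<and> g = A f))"

definition op_exp :: "'a::chilbert set \<Rightarrow> 'a set \<Rightarrow> ('a \<Rightarrow> 'a) \<Rightarrow> real \<Rightarrow> 'a \<Rightarrow> 'a" where
  "op_exp V D A = (THE T. semigroup_gen V D A T)"

definition exp_Bplus :: "('a::chilbert \<Rightarrow> 'a) \<Rightarrow> 'a set \<Rightarrow> ('a \<Rightarrow> 'a) \<Rightarrow> 'a set \<Rightarrow> real \<Rightarrow> 'a \<Rightarrow> 'a" where
  "exp_Bplus J DL L Hp = op_exp Hp (DL \<inter> Hp) (\<lambda>f. - J (L f))"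

definition exp_Bminus :: "('a::chilbert \<Rightarrow> 'a) \<Rightarrow> 'a set \<Rightarrow> ('a \<Rightarrow> 'a) \<Rightarrow> 'a set \<Rightarrow> real \<Rightarrow> 'a \<Rightarrow> 'a" where
  "exp_Bminus J DL L Hm = op_exp Hm (DL \<inter> Hm) (\<lambda>f. J (L f))"

definition Rop :: "'a::chilbert set \<Rightarrow> 'a set \<Rightarrow> 'a \<Rightarrow> 'a" where
  "Rop HB Hpm phi = (THE h. h \<in> HB \<and> orth_proj Hpm h = phi)"

definition Gplus :: "('a::chilbert \<Rightarrow> 'a) \<Rightarrow> 'a set \<Rightarrow> ('a \<Rightarrow> 'a) \<Rightarrow> 'a set \<Rightarrow> 'a set \<Rightarrow> real \<Rightarrow> 'a \<Rightarrow> 'a" where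
  "Gplus J DL L Hp Hm tau h =
     Rop Hm (Hminus J) (orth_proj (Hminus J) (exp_Bplus J DL L Hp tau h))"

definition Gminus :: "('a::chilbert \<Rightarrow> 'a) \<Rightarrow> 'a set \<Rightarrow> ('a \<Rightarrow> 'a) \<Rightarrow> 'a set \<Rightarrow> 'a set \<Rightarrow> real \<Rightarrow> 'a \<Rightarrow> 'a" where
  "Gminus J DL L Hp Hm tau h =
     Rop Hp (Hplus J) (orth_proj (Hplus J) (exp_Bminus J DL L Hm tau h))"

definition inv_I_minus :: "'a::chilbert set \<Rightarrow> ('a \<Rightarrow> 'a) \<Rightarrow> 'a \<Rightarrow> 'a" where
  "inv_I_minus V K x = (THE y. y \<in> V \<and> y - K y = x)"

definition solution_formula ::
  "('a::chilbert \<Rightarrow> 'a) \<Rightarrow> 'a set \<Rightarrow> ('a \<Rightarrow> 'a) \<Rightarrow> 'a set \<Rightarrow> 'a set \<Rightarrow> real \<Rightarrow> 'a \<Rightarrow> 'a \<Rightarrow> real \<Rightarrow> 'a" where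
  "solution_formula J DL L Hp Hm tau phip phim x =
     (let Gp = Gplus J DL L Hp Hm tau; Gm = Gminus J DL L Hp Hm tau;
          Rp = Rop Hp (Hplus J); Rm = Rop Hm (Hminus J)
      in exp_Bplus J DL L Hp x
           (inv_I_minus Hp (\<lambda>h. Gm (Gp h)) (Rp phip - Gm (Rm phim)))
         + exp_Bminus J DL L Hm (tau - x)
           (inv_I_minus Hm (\<lambda>h. Gp (Gm h)) (Rm phim - Gp (Rp phip))))"

end

theory Submission
  imports Defs
begin

text \<open>Let \<open>S\<close> make \<open>A = S B S\<^sup>-\<^sup>1\<close> self-adjoint. The Gram operator \<open>W\<close> of \<open>[S\<^sup>-\<^sup>1 u, S\<^sup>-\<^sup>1 v]\<close> is boundedly
invertible and, because \<open>L\<close> is symmetric, commutes with \<open>A\<close>; transporting its sign back by \<open>S\<close>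
gives a bounded \<open>U\<close> with \<open>U\<^sup>2 = 1\<close> which commutes with \<open>B\<close> and makes \<open>G = J U\<close> coercive. So
\<open>\<langle>x, y\<rangle> = (G x, y)\<close> is an equivalent inner product, in which \<open>T = U B = G\<^sup>-\<^sup>1 L\<close> is positive and
self-adjoint; the two spaces of the decomposition are the eigenspaces of \<open>U\<close>, on which \<open>B = \<plusminus>T\<close>, and
both exponentials are restrictions of one analytic contraction semigroup \<open>e\<^bsup>-tT\<^esup>\<close>.
Conversely, every decomposition as in the theorem arises from such a \<open>U\<close>.

A strong solution is \<open>\<psi> x = e\<^bsup>-xT\<^esup> h1 + e\<^bsup>-(\<tau>-x)T\<^esup> h2\<close> with \<open>U h1 = h1\<close> and \<open>U h2 = - h2\<close>, and with
\<open>h = h1 + h2\<close>, \<open>W = e\<^bsup>-\<tau>T\<^esup>\<close> the two boundary conditions combine to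
\<open>(h + W h) + G (h - W h) = 2 (\<phi>\<^sub>+ + \<phi>\<^sub>-)\<close>. Since \<open>W\<close> is a symmetric contraction for \<open>\<langle>\<cdot>, \<cdot>\<rangle>\<close>, the left-hand side is
bounded below and has dense range, so there is exactly one \<open>h\<close>. The operator formula is the same
\<open>2 \<times> 2\<close> system, \<open>h1 + G\<^sub>- h2 = R\<^sub>+ \<phi>\<^sub>+\<close> and \<open>G\<^sub>+ h1 + h2 = R\<^sub>- \<phi>\<^sub>-\<close>, solved by elimination.\<close>

text \<open>Zero may lie in the spectrum of \<open>B\<close>, and this shapes three steps. The
  spectral clause of the decomposition contains a closure, so 0 must be shown never to be an
  isolated point of the spectrum of either half: otherwise \<open>T\<close> would be bounded below
  at 0, by an estimate on its range, which is dense because \<open>ker L = 0\<close>. Next,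
  \<open>e^(-\<tau>T)\<close> need not be a strict contraction, so solvability of the boundary
  equation cannot rest on smallness of \<open>W\<close>; it rests on positivity of the pairing of
  \<open>h + W h\<close> with \<open>h - W h\<close>. Finally, an exponential is specified only by
  its generator, through a definite description. Any strongly continuous semigroup with the same
  generator must therefore be compared with the constructed one, and local boundedness of such a
  competitor has to be derived. No spectral measure is used. The sign of the Gram operator comes
  from two contraction mappings on closed sets of operators commuting with \<open>A\<close>, the
  semigroup from Yosida approximation, and statements about the spectrum from lower bounds for
  \<open>T - z\<close>, which imply surjectivity because \<open>L\<close> is self-adjoint.\<close>

lemma quadratic_nonneg_discriminant:
  fixes p q r :: real
  assumes "\<And>t. 0 \<le> p + 2 * t * q + t\<^sup>2 * r" and "0 \<le> r"
  shows "q\<^sup>2 \<le> p * r"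
proof (cases "r = 0")
  case True
  show ?thesis
  proof (cases "q = 0")
    case False
    have "0 \<le> p + 2 * (- (p + 1) / (2 * q)) * q" using assms(1)[of "- (p + 1) / (2 * q)"] True by simp
    then have "0 \<le> - (1::real)" using False by (simp add: field_simps)
    then show ?thesis by simp
  qed (use True in simp)
next
  case False
  then have r: "r > 0" using assms(2) by simp
  \<comment> \<open>The value \<open>t = - q / r\<close> is the minimiser of the quadratic.\<close>
  have "0 \<le> p + 2 * (- q / r) * q + (- q / r)\<^sup>2 * r" by (rule assms(1))
  also have "\<dots> = p - q\<^sup>2 / r" using r by (simp add: field_simps power2_eq_square)
  finally show ?thesis using r by (simp add: field_simps)
qed

lemma Cauchy_of_norm_estimate:
  fixes x :: "nat \<Rightarrow> 'a::real_normed_vector" and y :: "nat \<Rightarrow> 'b::real_normed_vector"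
  assumes y: "Cauchy y" and le: "\<And>m n. norm (x m - x n) \<le> K * norm (y m - y n)"
  shows "Cauchy x"
proof (rule metric_CauchyI)
  fix e :: real assume e: "e > 0"
  then obtain N where N: "\<And>m n. m \<ge> N \<Longrightarrow> n \<ge> N \<Longrightarrow> norm (y m - y n) < e / (\<bar>K\<bar> + 1)"
    using metric_CauchyD[OF y, of "e / (\<bar>K\<bar> + 1)"] by (auto simp: dist_norm)
  have "dist (x m) (x n) < e" if "m \<ge> N" "n \<ge> N" for m n
  proof -
    have "norm (x m - x n) \<le> (\<bar>K\<bar> + 1) * norm (y m - y n)"
      by (rule order_trans[OF le]) (intro mult_right_mono, auto)
    also have "\<dots> < e" using N[OF that] by (simp add: field_simps)
    finally show ?thesis by (simp add: dist_norm)
  qed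
  then show "\<exists>N. \<forall>m\<ge>N. \<forall>n\<ge>N. dist (x m) (x n) < e" by blast
qed

section \<open>Complex Hilbert spaces\<close>

lemma scaleC_zero_right [simp]: "scaleC c 0 = (0::'a::chilbert)"
  using scaleC_add_right[of c 0 0] by simp

lemma scaleC_zero_left [simp]: "scaleC 0 x = (0::'a::chilbert)"
  using scaleC_add_left[of 0 0 x] by simp

lemma scaleC_minus_right [simp]: "scaleC c (- x) = - scaleC c (x::'a::chilbert)"
  using scaleC_add_right[of c x "- x"] by (simp add: eq_neg_iff_add_eq_0 add.commute)

lemma scaleC_minus_left [simp]: "scaleC (- c) x = - scaleC c (x::'a::chilbert)"
  using scaleC_add_left[of c "- c" x] by (simp add: eq_neg_iff_add_eq_0 add.commute)

lemma scaleC_diff_right: "scaleC c (x - y) = scaleC c x - scaleC c (y::'a::chilbert)"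
  using scaleC_add_right[of c x "- y"] by simp

lemma scaleC_scaleR: "scaleC c (r *\<^sub>R x) = r *\<^sub>R scaleC c (x::'a::chilbert)"
  by (simp add: scaleR_scaleC scaleC_scaleC mult.commute)

lemma cinner_add_right: "cinner x (y + z) = cinner x y + cinner x (z::'a::chilbert)"
  by (metis cinner_add_left cinner_commute complex_cnj_add)

lemma cinner_scaleC_right: "cinner x (scaleC c y) = cnj c * cinner x (y::'a::chilbert)"
  by (metis cinner_scaleC_left cinner_commute complex_cnj_mult)

lemma cinner_zero [simp]: "cinner 0 x = 0" "cinner x (0::'a::chilbert) = 0"
  using cinner_add_left[of 0 0 x] cinner_add_right[of x 0 0] by auto

lemma cinner_minus [simp]: "cinner (- x) y = - cinner x y" "cinner x (- y) = - cinner x (y::'a::chilbert)"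
  using cinner_add_left[of x "- x" y] cinner_add_right[of x y "- y"]
  by (auto simp: add_eq_0_iff)

lemma cinner_diff: "cinner (x - y) z = cinner x z - cinner y z"
    "cinner x (y - z) = cinner x y - cinner x (z::'a::chilbert)"
  using cinner_add_left[of x "- y" z] cinner_add_right[of x y "- z"] by auto

lemma cinner_scaleR: "cinner (r *\<^sub>R x) y = of_real r * cinner x y"
    "cinner x (r *\<^sub>R y) = of_real r * cinner x (y::'a::chilbert)"
  by (simp_all add: scaleR_scaleC cinner_scaleC_left cinner_scaleC_right)

lemma Re_cinner_self: "Re (cinner x x) = (norm (x::'a::chilbert))\<^sup>2"
proof -
  have "0 \<le> sqrt (Re (cinner x x))"
    using norm_cinner[of x] norm_ge_zero[of x] by simp
  then have "0 \<le> Re (cinner x x)" by (simp add: real_sqrt_ge_0_iff)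
  then show ?thesis by (simp add: norm_cinner)
qed

lemma cinner_self: "cinner x x = of_real ((norm (x::'a::chilbert))\<^sup>2)"
proof -
  have "Im (cinner x x) = 0" using cinner_commute[of x x] by (metis Im_complex_of_real Reals_cnj_iff complex_is_Real_iff)
  then show ?thesis using Re_cinner_self[of x] by (simp add: complex_eq_iff)
qed

lemma Re_cinner_commute: "Re (cinner x y) = Re (cinner y (x::'a::chilbert))"
  by (subst cinner_commute) simp

lemma norm_add_sq: "(norm (x + y))\<^sup>2 = (norm x)\<^sup>2 + 2 * Re (cinner x y) + (norm (y::'a::chilbert))\<^sup>2"
  unfolding Re_cinner_self[symmetric] by (simp add: cinner_add_left cinner_add_right Re_cinner_commute[of y x])

lemma norm_diff_sq: "(norm (x - y))\<^sup>2 = (norm x)\<^sup>2 - 2 * Re (cinner x y) + (norm (y::'a::chilbert))\<^sup>2"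
  unfolding Re_cinner_self[symmetric] by (simp add: cinner_diff Re_cinner_commute[of y x])

lemma norm_scaleC: "norm (scaleC c x) = cmod c * norm (x::'a::chilbert)"
proof -
  have "(norm (scaleC c x))\<^sup>2 = Re ((c * cnj c) * cinner x x)"
    unfolding Re_cinner_self[symmetric] by (simp add: cinner_scaleC_left cinner_scaleC_right ac_simps)
  also have "\<dots> = (cmod c)\<^sup>2 * (norm x)\<^sup>2"
    by (simp add: complex_norm_square[symmetric] cinner_self del: of_real_power)
  finally have "(norm (scaleC c x))\<^sup>2 = (cmod c * norm x)\<^sup>2" by (simp add: power_mult_distrib)
  then show ?thesis by (rule power2_eq_imp_eq) auto
qed

lemma Re_cinner_le: "\<bar>Re (cinner x y)\<bar> \<le> norm x * norm (y::'a::chilbert)"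
proof -
  have "0 \<le> (norm x)\<^sup>2 + 2 * t * Re (cinner x y) + t\<^sup>2 * (norm y)\<^sup>2" for t
    using norm_add_sq[of x "t *\<^sub>R y"] zero_le_power2[of "norm (x + t *\<^sub>R y)"]
    by (simp add: cinner_scaleR power_mult_distrib mult.assoc)
  from quadratic_nonneg_discriminant[OF this]
  have "\<bar>Re (cinner x y)\<bar>\<^sup>2 \<le> (norm x * norm y)\<^sup>2" by (simp add: power_mult_distrib)
  then show ?thesis by (rule power2_le_imp_le) auto
qed

lemma cmod_cinner_le: "cmod (cinner x y) \<le> norm x * norm (y::'a::chilbert)"
proof -
  define z where "z = cinner x y"
  \<comment> \<open>The unimodular factor \<open>c\<close> rotates \<open>cinner x y\<close> onto
    the nonnegative axis, so the bound for the real part applies.\<close>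
  define c where "c = (if z = 0 then 1 else cnj z / of_real (cmod z))"
  have c: "cmod c = 1" "c * z = of_real (cmod z)"
    unfolding c_def using complex_norm_square[of z]
    by (auto simp: norm_divide power2_eq_square field_simps)
  have "cmod z = Re (cinner (scaleC c x) y)" using c by (simp add: cinner_scaleC_left z_def)
  also have "\<dots> \<le> norm (scaleC c x) * norm y" using Re_cinner_le[of "scaleC c x" y] by simp
  finally show ?thesis using c by (simp add: norm_scaleC z_def)
qed

lemma cinner_eqI: "(\<And>f. cinner f x = cinner f y) \<Longrightarrow> x = (y::'a::chilbert)"
  using cinner_self[of "x - y"] by (auto simp: cinner_diff)

lemma bounded_bilinear_cinner: "bounded_bilinear (cinner :: 'a::chilbert \<Rightarrow> 'a \<Rightarrow> complex)"
  by unfold_locales (auto simp: cinner_add_left cinner_add_right cinner_scaleR scaleR_conv_of_real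
      intro!: exI[of _ 1] cmod_cinner_le)

lemma bounded_linear_scaleC: "bounded_linear (scaleC c :: 'a::chilbert \<Rightarrow> 'a)"
  by unfold_locales (auto simp: scaleC_add_right scaleR_scaleC scaleC_scaleC mult.commute norm_scaleC
      intro!: exI[of _ "cmod c"])

lemmas tendsto_cinner = bounded_bilinear.tendsto[OF bounded_bilinear_cinner]
lemmas continuous_on_cinner = bounded_bilinear.continuous_on[OF bounded_bilinear_cinner]

lemma cinner_right_zero_closure:
  assumes "closure D = UNIV" "\<And>f. f \<in> D \<Longrightarrow> cinner f h = 0"
  shows "h = (0::'a::chilbert)"
proof -
  have "closed {f. cinner f h = 0}"
    by (intro closed_Collect_eq continuous_on_cinner continuous_on_id continuous_on_const)
  then have "closure D \<subseteq> {f. cinner f h = 0}" by (intro closure_minimal) (use assms(2) in auto)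
  then have "cinner h h = 0" using assms(1) by auto
  then show ?thesis by (simp add: cinner_self)
qed

lemma csubspace_imp_subspace: "csubspace S \<Longrightarrow> subspace (S :: 'a::chilbert set)"
  unfolding csubspace_def subspace_def by (auto simp: scaleR_scaleC)

lemma csubspace_diff: "csubspace S \<Longrightarrow> x \<in> S \<Longrightarrow> y \<in> S \<Longrightarrow> x - y \<in> (S :: 'a::chilbert set)"
  using subspace_diff csubspace_imp_subspace by blast

text \<open>A minimising sequence for the distance to \<open>S\<close> is Cauchy by the
  parallelogram law, since midpoints stay in \<open>S\<close>. The limit gives an orthogonal
  difference because the first variation of the squared distance vanishes.\<close>

lemma projection_exists:
  fixes S :: "'a::chilbert set"
  assumes S: "csubspace S" "closed S"
  shows "\<exists>y\<in>S. \<forall>z\<in>S. cinner z (x - y) = 0"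
proof -
  have sS: "subspace S" using S(1) by (rule csubspace_imp_subspace)
  have ne: "S \<noteq> {}" using S(1) unfolding csubspace_def by auto
  define d where "d = (INF s\<in>S. (norm (x - s))\<^sup>2)"
  have dle: "d \<le> (norm (x - s))\<^sup>2" if "s \<in> S" for s
    unfolding d_def by (rule cINF_lower) (auto intro!: bdd_belowI[of _ 0] that)
  have ex: "\<exists>s\<in>S. (norm (x - s))\<^sup>2 < d + e" if "e > 0" for e
  proof -
    have "bdd_below ((\<lambda>s. (norm (x - s))\<^sup>2) ` S)" by (rule bdd_belowI[of _ 0]) auto
    from cINF_less_iff[OF ne this, of "d + e"] that show ?thesis by (auto simp: d_def)
  qed
  have "\<exists>s. \<forall>n. s n \<in> S \<and> (norm (x - s n))\<^sup>2 < d + 1 / Suc n"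
    by (rule choice) (use ex in \<open>simp add: Bex_def\<close>)
  then obtain s where s: "\<And>n. s n \<in> S" "\<And>n. (norm (x - s n))\<^sup>2 < d + 1 / Suc n" by auto
  have par: "(norm (s m - s n))\<^sup>2 \<le> 2 * (1 / Suc m + 1 / Suc n)" for m n
  proof -
    let ?p = "x - s m" and ?q = "x - s n"
    have d: "?p - ?q = - (s m - s n)" by simp
    have "(norm (?p - ?q))\<^sup>2 + (norm (?p + ?q))\<^sup>2 = 2 * ((norm ?p)\<^sup>2 + (norm ?q)\<^sup>2)"
      by (simp only: norm_add_sq norm_diff_sq) simp
    moreover have "?p + ?q = 2 *\<^sub>R (x - (1/2) *\<^sub>R (s m + s n))"
      by (simp add: algebra_simps scaleR_2)
    then have "(norm (?p + ?q))\<^sup>2 = 4 * (norm (x - (1/2) *\<^sub>R (s m + s n)))\<^sup>2"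
      by (simp add: power_mult_distrib)
    moreover have "d \<le> (norm (x - (1/2) *\<^sub>R (s m + s n)))\<^sup>2"
      by (intro dle subspace_mul subspace_add sS s)
    moreover have "u \<le> 2 * (a + b)"
      if "u + v = 2 * (p + q)" "v = 4 * k" "d \<le> k" "p < d + a" "q < d + b" for u v p q k a b :: real
      using that by argo
    ultimately show ?thesis using s(2)[of m] s(2)[of n] unfolding d norm_minus_cancel by blast
  qed
  have "Cauchy s"
  proof (rule metric_CauchyI)
    fix e :: real assume e: "e > 0"
    obtain N where N: "1 / Suc N < e\<^sup>2 / 4"
      using reals_Archimedean[of "e\<^sup>2 / 4"] e by (auto simp: inverse_eq_divide)
    have "dist (s m) (s n) < e" if "m \<ge> N" "n \<ge> N" for m n
    proof -
      have "1 / Suc m \<le> 1 / Suc N" "1 / Suc n \<le> 1 / Suc N" using that by (auto simp: frac_le)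
      then have "(norm (s m - s n))\<^sup>2 < e\<^sup>2" using par[of m n] N by argo
      then show ?thesis using e by (simp add: dist_norm power2_less_imp_less)
    qed
    then show "\<exists>M. \<forall>m\<ge>M. \<forall>n\<ge>M. dist (s m) (s n) < e" by blast
  qed
  then obtain y where y: "s \<longlonglongrightarrow> y" using Cauchy_convergent_iff convergent_def by blast
  have yS: "y \<in> S" using closed_sequentially[OF S(2) _ y] s(1) by blast
  have "(\<lambda>n. (norm (x - s n))\<^sup>2) \<longlonglongrightarrow> (norm (x - y))\<^sup>2" by (intro tendsto_intros y)
  moreover have "(\<lambda>n. d + 1 / Suc n) \<longlonglongrightarrow> d + 0"
    by (intro tendsto_intros LIMSEQ_Suc[OF lim_1_over_n[where 'a=real], unfolded of_nat_id])
  ultimately have yd: "(norm (x - y))\<^sup>2 \<le> d + 0"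
    by (rule LIMSEQ_le) (use s(2) less_imp_le in blast)
  have re0: "Re (cinner z (x - y)) = 0" if z: "z \<in> S" for z
  proof -
    have "0 \<le> 0 + 2 * t * Re (cinner z (x - y)) + t\<^sup>2 * (norm z)\<^sup>2" for t
    proof -
      have "d \<le> (norm (x - (y - t *\<^sub>R z)))\<^sup>2" by (intro dle subspace_diff subspace_mul sS yS z)
      also have "x - (y - t *\<^sub>R z) = (x - y) + t *\<^sub>R z" by simp
      finally show ?thesis using yd
        by (simp add: norm_add_sq cinner_scaleR power_mult_distrib Re_cinner_commute[of z])
    qed
    from quadratic_nonneg_discriminant[OF this] show ?thesis by simp
  qed
  have "cinner z (x - y) = 0" if z: "z \<in> S" for z
  proof -
    \<comment> \<open>The real part of the pairing with \<open>\<i> z\<close> is minus the imaginary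
      part of the pairing with \<open>z\<close>, so vanishing real parts suffice.\<close>
    have "scaleC \<i> z \<in> S" using S(1) z unfolding csubspace_def by auto
    from re0[OF this] re0[OF z] show ?thesis by (simp add: cinner_scaleC_left complex_eq_iff)
  qed
  then show ?thesis using yS by blast
qed

text \<open>The error of the orthogonal projection of any \<open>x\<close> is orthogonal to
  \<open>S\<close>, hence zero. This is how surjectivity is obtained later: closed range plus
  trivial orthogonal complement.\<close>

lemma closed_csubspace_eq_UNIV:
  fixes S :: "'a::chilbert set"
  assumes "csubspace S" "closed S" "\<And>v. (\<And>z. z \<in> S \<Longrightarrow> cinner z v = 0) \<Longrightarrow> v = 0"
  shows "S = UNIV"
proof -
  have "x \<in> S" for x
    using projection_exists[OF assms(1,2), of x] assms(3) by (metis eq_iff_diff_eq_0)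
  then show ?thesis by auto
qed

section \<open>Bounded operators, the Riesz representation and adjoints\<close>

lemma bounded_clinear_op_iff:
  "bounded_clinear_op (A :: 'a::chilbert \<Rightarrow> 'a) \<longleftrightarrow> bounded_linear A \<and> (\<forall>c x. A (scaleC c x) = scaleC c (A x))"
proof
  assume A: "bounded_clinear_op A"
  then obtain K where K: "\<And>x. norm (A x) \<le> K * norm x" unfolding bounded_clinear_op_def by auto
  have lin: "\<And>x y. A (x + y) = A x + A y" "\<And>c x. A (scaleC c x) = scaleC c (A x)"
    using A unfolding bounded_clinear_op_def clinear_on_def by auto
  have "bounded_linear A"
    by unfold_locales (auto simp: lin scaleR_scaleC intro!: exI[of _ K] K[unfolded mult.commute[of K]])
  then show "bounded_linear A \<and> (\<forall>c x. A (scaleC c x) = scaleC c (A x))" using lin by auto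
next
  assume A: "bounded_linear A \<and> (\<forall>c x. A (scaleC c x) = scaleC c (A x))"
  then interpret bounded_linear A by simp
  show "bounded_clinear_op A"
    unfolding bounded_clinear_op_def clinear_on_def csubspace_def
    using A bounded by (auto simp: add mult.commute)
qed

lemma riesz_representation:
  fixes \<phi> :: "'a::chilbert \<Rightarrow> complex"
  assumes "bounded_linear \<phi>" and C: "\<And>c x. \<phi> (scaleC c x) = c * \<phi> x"
  shows "\<exists>h. \<forall>x. \<phi> x = cinner x h"
proof (cases "\<forall>x. \<phi> x = 0")
  case True
  then show ?thesis by (intro exI[of _ 0]) simp
next
  case False
  interpret bounded_linear \<phi> by fact
  let ?S = "{x. \<phi> x = 0}"
  have "csubspace ?S" unfolding csubspace_def by (auto simp: add C zero)
  moreover have "closed ?S"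
    by (intro closed_Collect_eq continuous_on continuous_on_id continuous_on_const)
  ultimately obtain v where v: "\<And>z. \<phi> z = 0 \<Longrightarrow> cinner z v = 0" "v \<noteq> 0"
    using closed_csubspace_eq_UNIV[of ?S] False by blast
  have pv: "\<phi> v \<noteq> 0" using v by (metis cinner_self norm_eq_zero of_real_eq_0_iff power_eq_0_iff)
  \<comment> \<open>The scalar is forced by \<open>\<phi> v = cinner v h\<close>; the conjugate
    appears because \<open>cinner\<close> is antilinear in its second argument.\<close>
  define h where "h = scaleC (cnj (\<phi> v) / of_real ((norm v)\<^sup>2)) v"
  have "\<phi> x = cinner x h" for x
  proof -
    have "\<phi> (x - scaleC (\<phi> x / \<phi> v) v) = 0" using pv by (simp add: diff C)
    then have "cinner (x - scaleC (\<phi> x / \<phi> v) v) v = 0" by (rule v)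
    then have "cinner x v = \<phi> x / \<phi> v * of_real ((norm v)\<^sup>2)"
      by (simp add: cinner_diff cinner_scaleC_left cinner_self del: of_real_power)
    then show ?thesis using pv v(2)
      by (simp add: h_def cinner_scaleC_right)
  qed
  then show ?thesis by blast
qed

lemma adjoint_exists:
  fixes A :: "'a::chilbert \<Rightarrow> 'a"
  assumes "bounded_clinear_op A"
  shows "\<exists>As. bounded_clinear_op As \<and> (\<forall>x y. cinner (A x) y = cinner x (As y))"
proof -
  have A: "bounded_linear A" "\<And>c x. A (scaleC c x) = scaleC c (A x)"
    using assms bounded_clinear_op_iff by auto
  interpret bounded_linear A by fact
  have "\<exists>h. \<forall>x. cinner (A x) y = cinner x h" for y
    by (rule riesz_representation)
      (auto simp: A cinner_scaleC_left intro!: bounded_linear_compose[OF bounded_bilinear.bounded_linear_left[OF bounded_bilinear_cinner] A(1)])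
  then obtain As where As: "\<And>x y. cinner (A x) y = cinner x (As y)" by metis
  obtain K where K: "\<And>x. norm (A x) \<le> norm x * K" "K > 0" using pos_bounded by auto
  have "As (x + y) = As x + As y" for x y
    by (rule cinner_eqI) (simp add: As[symmetric] cinner_add_right)
  moreover have sc: "As (scaleC c x) = scaleC c (As x)" for c x
    by (rule cinner_eqI) (simp add: As[symmetric] cinner_scaleC_right)
  moreover have "norm (As x) \<le> norm x * K" for x
  proof (cases "As x = 0")
    case True
    then show ?thesis using K(2) by simp
  next
    case False
    have "(norm (As x))\<^sup>2 = Re (cinner (A (As x)) x)" by (simp add: As Re_cinner_self)
    also have "\<dots> \<le> norm (A (As x)) * norm x" using Re_cinner_le[of "A (As x)" x] by simp
    also have "\<dots> \<le> (norm (As x) * K) * norm x" by (intro mult_right_mono K) auto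
    finally show ?thesis using False by (simp add: power2_eq_square mult.assoc mult.commute[of K])
  qed
  ultimately have "bounded_clinear_op As"
    unfolding bounded_clinear_op_iff
    by (auto intro!: bounded_linear_intro[where K=K] simp: scaleR_scaleC)
  then show ?thesis using As by auto
qed

section \<open>The sign of an operator commuting with a self-adjoint operator\<close>

lemma self_adjoint_symmetric:
  "self_adjoint D A \<Longrightarrow> f \<in> D \<Longrightarrow> g \<in> D \<Longrightarrow> cinner (A f) g = cinner f (A g)"
  unfolding self_adjoint_def by blast

text \<open>The domain clause of self-adjointness gives membership, and density of \<open>D\<close>
  fixes the value. A weak identity tested on \<open>D\<close> is thus enough to place a vector in
  the domain.\<close>

lemma self_adjoint_adjointD:
  assumes "self_adjoint D A" "\<And>f. f \<in> D \<Longrightarrow> cinner (A f) g = cinner f h"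
  shows "g \<in> D" "A g = h"
proof -
  show g: "g \<in> D" using assms unfolding self_adjoint_def by blast
  have "cinner f (A g - h) = 0" if "f \<in> D" for f
    using assms(2)[OF that] self_adjoint_symmetric[OF assms(1) that g] by (simp add: cinner_diff)
  then have "A g - h = 0"
    using assms(1) cinner_right_zero_closure unfolding self_adjoint_def by blast
  then show "A g = h" by simp
qed

lemma self_adjoint_closed:
  assumes A: "self_adjoint D A" and s: "\<And>n. s n \<in> D" "s \<longlonglongrightarrow> x" "(\<lambda>n. A (s n)) \<longlonglongrightarrow> y"
  shows "x \<in> D" "A x = y"
proof -
  have "cinner (A f) x = cinner f y" if "f \<in> D" for f
  proof (rule LIMSEQ_unique)
    show "(\<lambda>n. cinner (A f) (s n)) \<longlonglongrightarrow> cinner (A f) x" by (intro tendsto_cinner tendsto_const s)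
    show "(\<lambda>n. cinner (A f) (s n)) \<longlonglongrightarrow> cinner f y"
      unfolding self_adjoint_symmetric[OF A that s(1)] by (intro tendsto_cinner tendsto_const s)
  qed
  then show "x \<in> D" "A x = y" using self_adjoint_adjointD[OF A] by blast+
qed

text \<open>Elements have the type of bounded operators, so the operator norm is available for
  Banach's fixed point theorem. Commuting with the unbounded \<open>A\<close> includes invariance of
  its domain, a condition that survives norm limits because \<open>A\<close> is closed.\<close>

definition commutant :: "('a::chilbert \<Rightarrow> 'a) \<Rightarrow> 'a set \<Rightarrow> ('a \<Rightarrow> 'a) \<Rightarrow> ('a \<Rightarrow>\<^sub>L 'a) set" where
  "commutant W D A = {Y :: 'a \<Rightarrow>\<^sub>L 'a. (\<forall>c x. Y (scaleC c x) = scaleC c (Y x)) \<and> (\<forall>x. Y (W x) = W (Y x))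
     \<and> (\<forall>x\<in>D. Y x \<in> D \<and> A (Y x) = Y (A x))}"

lemma closed_commutant:
  fixes A :: "'a::chilbert \<Rightarrow> 'a"
  assumes A: "self_adjoint D A" and W: "bounded_linear W"
  shows "closed (commutant W D A)"
  unfolding closed_sequential_limits
proof (intro allI impI, elim conjE)
  fix Y l assume Y: "\<forall>n. Y n \<in> commutant W D A" and l: "Y \<longlonglongrightarrow> l"
  have lim: "(\<lambda>n. Y n x) \<longlonglongrightarrow> l x" for x using l by (intro blinfun.tendsto tendsto_const)
  interpret W: bounded_linear W by fact
  have "l (scaleC c x) = scaleC c (l x)" for c x
    using LIMSEQ_unique[OF lim[of "scaleC c x"], of "scaleC c (l x)"]
      bounded_linear.tendsto[OF bounded_linear_scaleC lim[of x], of c] Y by (simp add: commutant_def)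
  moreover have "l (W x) = W (l x)" for x
    using LIMSEQ_unique[OF lim[of "W x"], of "W (l x)"] W.tendsto[OF lim[of x]] Y
    by (simp add: commutant_def)
  moreover have "l x \<in> D \<and> A (l x) = l (A x)" if "x \<in> D" for x
    using self_adjoint_closed[OF A, of "\<lambda>n. Y n x" "l x" "l (A x)"] lim that Y
    by (simp add: commutant_def)
  ultimately show "l \<in> commutant W D A" by (simp add: commutant_def)
qed

text \<open>\<open>U\<close> is the sign of \<open>W\<close>, that is \<open>W\<close> times the
  inverse of its modulus. The modulus is written as \<open>V = I - Y\<close>; the equation
  \<open>V V = W W\<close> becomes \<open>Y = (E + Y Y) / 2\<close> with \<open>E = I - W W\<close>,
  a fixed point problem whose iteration stays among the operators commuting with \<open>W\<close>
  and \<open>A\<close>. The coercivity claim is that of \<open>W U = V\<close>.\<close>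

lemma sign_exists:
  fixes A W :: "'a::chilbert \<Rightarrow> 'a"
  assumes A: "self_adjoint D A" and W: "bounded_clinear_op W"
    and Wsym: "\<And>x y. cinner (W x) y = cinner x (W y)"
    and W1: "\<And>x. norm (W x) \<le> norm x" and d: "d > 0" "\<And>x. d * norm x \<le> norm (W x)"
    and WA: "\<And>x. x \<in> D \<Longrightarrow> W x \<in> D \<and> A (W x) = W (A x)"
  shows "\<exists>U c. bounded_clinear_op U \<and> (\<forall>x. U (U x) = x) \<and> c > 0
     \<and> (\<forall>x. c * (norm x)\<^sup>2 \<le> Re (cinner (W (U x)) x))
     \<and> (\<forall>x y. cinner (W (U x)) y = cinner (W x) (U y))
     \<and> (\<forall>x\<in>D. U x \<in> D \<and> A (U x) = U (A x))"
proof -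
  have linW: "bounded_linear W" and WC: "\<And>c x. W (scaleC c x) = scaleC c (W x)"
    using W bounded_clinear_op_iff by auto
  interpret W: bounded_linear W by fact
  have sD: "subspace D" and Aadd: "\<And>x y. x \<in> D \<Longrightarrow> y \<in> D \<Longrightarrow> A (x + y) = A x + A y"
    and AC: "\<And>c x. x \<in> D \<Longrightarrow> A (scaleC c x) = scaleC c (A x)"
    using A csubspace_imp_subspace unfolding self_adjoint_def clinear_on_def by auto
  have AR: "A (r *\<^sub>R x) = r *\<^sub>R A x" if "x \<in> D" for r x using AC[OF that] by (simp add: scaleR_scaleC)
  have A0: "A 0 = 0" using AR[of 0 0] sD by (simp add: subspace_0)
  have Adiff: "A (x - y) = A x - A y" if "x \<in> D" "y \<in> D" for x y
    using Aadd[of x "(-1) *\<^sub>R y"] AR[of y "-1"] that sD subspace_neg[OF sD, of y] by simp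
  note DS = subspace_add[OF sD] subspace_mul[OF sD] subspace_diff[OF sD] subspace_0[OF sD]
  define M where "M = commutant W D A"
  have Mcomp: "complete M" unfolding M_def complete_eq_closed by (rule closed_commutant[OF A linW])
  define wl where "wl = Blinfun W"
  have wl [simp]: "blinfun_apply wl x = W x" for x unfolding wl_def by (simp add: bounded_linear_Blinfun_apply linW)
  define E where "E = id_blinfun - (wl o\<^sub>L wl)"
  have E [simp]: "E x = x - W (W x)" for x by (simp add: E_def blinfun.bilinear_simps)
  \<comment> \<open>Capping \<open>d\<close> at 1 keeps the radicand in \<open>q\<close>
    nonnegative. The norm of \<open>E\<close> is at most \<open>q < 1\<close> since the square of
    \<open>norm (E x)\<close> is at most that of \<open>norm x\<close> minus that of
    \<open>norm (W x)\<close>.\<close>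
  define d' where "d' = min d 1"
  have d': "0 < d'" "d' \<le> 1" "d' * norm x \<le> norm (W x)" for x
    using d(1) order_trans[OF mult_right_mono d(2), of d' x] by (auto simp: d'_def)
  define q where "q = sqrt (1 - d'\<^sup>2)"
  have d'2: "0 < d'\<^sup>2" "d'\<^sup>2 \<le> 1" using d' by (auto simp: power_le_one)
  have q: "0 \<le> q" "q < 1" using d'2 unfolding q_def by auto
  have nE: "norm E \<le> q"
  proof (rule norm_blinfun_bound[OF q(1)])
    fix x
    have "(norm (W (W x)))\<^sup>2 \<le> (norm (W x))\<^sup>2" by (rule power_mono[OF W1]) simp
    moreover have "Re (cinner x (W (W x))) = (norm (W x))\<^sup>2"
      by (metis Re_cinner_self Wsym)
    moreover have "(d' * norm x)\<^sup>2 \<le> (norm (W x))\<^sup>2" using d' by (intro power_mono) auto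
    ultimately have "(norm (E x))\<^sup>2 \<le> (norm x)\<^sup>2 - (d' * norm x)\<^sup>2"
      unfolding E norm_diff_sq by linarith
    also have "\<dots> = (q * norm x)\<^sup>2" using d'2 by (simp add: q_def power_mult_distrib algebra_simps)
    finally show "norm (E x) \<le> q * norm x" by (rule power2_le_imp_le) (simp add: q)
  qed
  \<comment> \<open>The smaller root of \<open>y * y - 2 * y + q = 0\<close>: with this radius
    \<open>F\<close> maps the ball into itself, and as \<open>y < 1\<close> it contracts there with
    factor \<open>y\<close>.\<close>
  define y where "y = 1 - sqrt (1 - q)"
  have y: "0 \<le> y" "y < 1" using q by (auto simp: y_def)
  have yq: "(1 / 2) * (q + y * y) = y"
    using q by (simp add: y_def field_simps real_sqrt_mult_self)
  define M1 where "M1 = M \<inter> {Y. norm Y \<le> y} \<inter> {Y :: 'a \<Rightarrow>\<^sub>L 'a. \<forall>x z. cinner (Y x) z = cinner x (Y z)}"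
  define F :: "('a \<Rightarrow>\<^sub>L 'a) \<Rightarrow> 'a \<Rightarrow>\<^sub>L 'a" where "F Y = (1/2) *\<^sub>R (E + (Y o\<^sub>L Y))" for Y
  have F [simp]: "F Y x = (1/2) *\<^sub>R (x - W (W x) + Y (Y x))" for Y x
    by (simp add: F_def blinfun.bilinear_simps)
  have "closed M1"
  proof -
    have "closed {Y::'a \<Rightarrow>\<^sub>L 'a. norm Y \<le> y}" by (intro closed_Collect_le continuous_intros)
    moreover have "closed {Y::'a \<Rightarrow>\<^sub>L 'a. \<forall>x z. cinner (Y x) z = cinner x (Y z)}"
      by (intro closed_Collect_all closed_Collect_eq continuous_on_cinner continuous_intros)
    ultimately show ?thesis unfolding M1_def using Mcomp complete_eq_closed by blast
  qed
  then have "complete M1" by (simp add: complete_eq_closed)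
  moreover have "M1 \<noteq> {}"
  proof -
    have "0 \<in> M1" using y DS A0 by (simp add: M1_def M_def commutant_def W.zero)
    then show ?thesis by blast
  qed
  moreover have "F ` M1 \<subseteq> M1"
  proof safe
    fix Y assume Y: "Y \<in> M1"
    have YM: "\<And>c x. Y (scaleC c x) = scaleC c (Y x)" "\<And>x. Y (W x) = W (Y x)"
      "\<And>x. x \<in> D \<Longrightarrow> Y x \<in> D" "\<And>x. x \<in> D \<Longrightarrow> A (Y x) = Y (A x)" "norm Y \<le> y"
      "\<And>x z. cinner (Y x) z = cinner x (Y z)"
      using Y by (auto simp: M1_def M_def commutant_def)
    have "norm (F Y) \<le> (1/2) * (norm E + norm Y * norm Y)"
      unfolding F_def norm_scaleR
      by (intro mult_mono order_trans[OF norm_triangle_ineq] add_mono norm_blinfun_compose) auto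
    also have "\<dots> \<le> (1/2) * (q + y * y)" by (intro mult_left_mono add_mono mult_mono nE YM y) auto
    finally have "norm (F Y) \<le> y" using yq by simp
    moreover have "F Y \<in> M" unfolding M_def commutant_def
      by (auto simp: YM WC W.add W.diff W.scaleR scaleC_add_right scaleC_diff_right
          blinfun.bilinear_simps scaleC_scaleR
          WA Aadd Adiff AR DS)
    moreover have "cinner (F Y x) z = cinner x (F Y z)" for x z
      by (simp add: cinner_scaleR cinner_add_left cinner_add_right cinner_diff YM Wsym)
    ultimately show "F Y \<in> M1" by (simp add: M1_def)
  qed
  moreover have "dist (F Y) (F Z) \<le> y * dist Y Z" if "Y \<in> M1" "Z \<in> M1" for Y Z
  proof -
    have nY: "norm Y \<le> y" "norm Z \<le> y" using that by (auto simp: M1_def)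
    have "F Y - F Z = (1/2) *\<^sub>R ((Y o\<^sub>L (Y - Z)) + ((Y - Z) o\<^sub>L Z))"
      by (rule blinfun_eqI) (simp add: blinfun.bilinear_simps scaleR_diff_right[symmetric])
    also have "norm \<dots> \<le> (1/2) * (norm Y * norm (Y - Z) + norm (Y - Z) * norm Z)"
      unfolding norm_scaleR
      by (intro mult_mono order_trans[OF norm_triangle_ineq] add_mono norm_blinfun_compose) auto
    also have "\<dots> \<le> (1/2) * (y * norm (Y - Z) + norm (Y - Z) * y)"
      by (intro mult_left_mono add_mono mult_mono nY y) auto
    finally show ?thesis by (simp add: dist_norm)
  qed
  ultimately obtain Y where Y: "Y \<in> M1" "F Y = Y"
    using Banach_fix[OF _ _ y, of M1 F] by blast
  have YM: "\<And>c x. Y (scaleC c x) = scaleC c (Y x)" "\<And>x. Y (W x) = W (Y x)"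
      "\<And>x. x \<in> D \<Longrightarrow> Y x \<in> D" "\<And>x. x \<in> D \<Longrightarrow> A (Y x) = Y (A x)" "norm Y \<le> y"
      "\<And>x z. cinner (Y x) z = cinner x (Y z)"
      using Y(1) by (auto simp: M1_def M_def commutant_def)
  define V where "V x = x - Y x" for x
  have VV: "V (V x) = W (W x)" for x
  proof -
    have "Y x = (1/2) *\<^sub>R (x - W (W x) + Y (Y x))" using arg_cong[OF Y(2), of "\<lambda>Z. blinfun_apply Z x"] by simp
    then have "2 *\<^sub>R Y x = x - W (W x) + Y (Y x)" by (metis scaleR_half_double scaleR_2 scaleR_add_right)
    then show ?thesis by (simp add: V_def blinfun.bilinear_simps scaleR_2 algebra_simps)
  qed
  have Vco: "(1 - y) * (norm x)\<^sup>2 \<le> Re (cinner (V x) x)" for x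
  proof -
    have "Re (cinner (Y x) x) \<le> norm (Y x) * norm x" using Re_cinner_le[of "Y x" x] by simp
    also have "\<dots> \<le> (y * norm x) * norm x"
      by (intro mult_right_mono order_trans[OF norm_blinfun] YM) auto
    finally show ?thesis by (simp add: V_def cinner_diff Re_cinner_self algebra_simps power2_eq_square)
  qed
  have Vinj: "x = z" if "V x = V z" for x z
  proof -
    have "V (x - z) = 0" using that by (simp add: V_def blinfun.bilinear_simps algebra_simps)
    then have "(norm (x - z))\<^sup>2 \<le> 0" using Vco[of "x - z"] y by (simp add: mult_le_0_iff)
    then show ?thesis by simp
  qed
  \<comment> \<open>The fixed point \<open>Z = I + Y Z\<close> is the Neumann series for the inverse
    of \<open>V = I - Y\<close>. Solving it inside \<open>M\<close> makes the inverse commute with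
    \<open>W\<close> and \<open>A\<close> as well.\<close>
  define G :: "('a \<Rightarrow>\<^sub>L 'a) \<Rightarrow> 'a \<Rightarrow>\<^sub>L 'a" where "G Z = id_blinfun + (Y o\<^sub>L Z)" for Z
  have G [simp]: "G Z x = x + Y (Z x)" for Z x by (simp add: G_def blinfun.bilinear_simps)
  have "M \<noteq> {}"
    using Y(1) by (auto simp: M1_def)
  moreover have "G ` M \<subseteq> M"
    by (auto simp: M_def commutant_def YM W.add scaleC_add_right Aadd DS)
  moreover have "dist (G Z) (G Z') \<le> y * dist Z Z'" for Z Z'
  proof -
    have "G Z - G Z' = Y o\<^sub>L (Z - Z')" by (rule blinfun_eqI) (simp add: blinfun.bilinear_simps)
    also have "norm \<dots> \<le> y * norm (Z - Z')"
      by (rule order_trans[OF norm_blinfun_compose]) (intro mult_right_mono YM norm_ge_zero)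
    finally show ?thesis by (simp add: dist_norm)
  qed
  ultimately obtain Z where Z: "Z \<in> M" "G Z = Z"
    using Banach_fix[OF Mcomp _ y, of G] by blast
  have ZM: "\<And>c x. Z (scaleC c x) = scaleC c (Z x)" "\<And>x. Z (W x) = W (Z x)"
      "\<And>x. x \<in> D \<Longrightarrow> Z x \<in> D" "\<And>x. x \<in> D \<Longrightarrow> A (Z x) = Z (A x)"
    using Z(1) by (auto simp: M_def commutant_def)
  have VZ: "V (Z x) = x" for x
    using arg_cong[OF Z(2), of "\<lambda>Z. blinfun_apply Z x"] by (simp add: V_def algebra_simps)
  have ZV: "Z (V x) = x" for x using Vinj VZ by blast
  define U where "U x = Z (W x)" for x
  have WU: "W (U x) = V x" for x using ZV[of "V x"] by (simp add: U_def VV ZM)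
  have UU: "U (U x) = x" for x
    using WU[of x] ZV by (simp add: U_def)
  have "bounded_linear U"
    unfolding U_def by (intro bounded_linear_compose[OF _ linW] blinfun.bounded_linear_right)
  then have "bounded_clinear_op U"
    unfolding bounded_clinear_op_iff by (simp add: U_def ZM(1) WC)
  moreover have "cinner (W (U x)) z = cinner (W x) (U z)" for x z
    unfolding Wsym[of x] WU by (simp add: V_def cinner_diff YM)
  moreover have "U x \<in> D \<and> A (U x) = U (A x)" if "x \<in> D" for x
    using that WA by (simp add: U_def ZM)
  ultimately show ?thesis using UU Vco y WU by (intro exI[of _ U] exI[of _ "1 - y"]) simp
qed

lemma fundamental_symmetry_exists:
  fixes J L :: "'a::chilbert \<Rightarrow> 'a"
  assumes J: "signature_op J" and L: "self_adjoint DL L"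
    and sim: "similar_to_selfadjoint DL (\<lambda>f. J (L f))"
  shows "\<exists>U c. bounded_clinear_op U \<and> (\<forall>x. U (U x) = x) \<and> c > 0
     \<and> (\<forall>x. c * (norm x)\<^sup>2 \<le> Re (cinner (J (U x)) x))
     \<and> (\<forall>x y. cinner (J (U x)) y = cinner (J x) (U y))
     \<and> (\<forall>x\<in>DL. U x \<in> DL \<and> J (L (U x)) = U (J (L x)))"
proof -
  obtain D A where A: "self_adjoint D A" and sim': "similar_ops DL (\<lambda>f. J (L f)) D A"
    using sim unfolding similar_to_selfadjoint_def by blast
  obtain S Si where *: "bounded_clinear_op S \<and> bounded_clinear_op Si
     \<and> (\<forall>x. Si (S x) = x) \<and> (\<forall>x. S (Si x) = x) \<and> S ` DL = D
     \<and> (\<forall>y\<in>D. A y = S (J (L (Si y))))"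
    using sim' unfolding similar_ops_def by (elim exE)
  then have S: "bounded_clinear_op S" "bounded_clinear_op Si" "Si (S x) = x" "S (Si x) = x"
    and SD: "S ` DL = D" and AS: "y \<in> D \<Longrightarrow> A y = S (J (L (Si y)))" for x y by auto
  have SiD: "Si y \<in> DL" if "y \<in> D" for y using that SD S by auto
  have J: "bounded_clinear_op J" "\<And>x. J (J x) = x" "\<And>x y. cinner (J x) y = cinner x (J y)"
    using J unfolding signature_op_def by auto
  obtain Ss where Ss: "bounded_clinear_op Ss" "\<And>x y. cinner (S x) y = cinner x (Ss y)"
    using adjoint_exists[OF S(1)] by blast
  obtain Sis where Sis: "bounded_clinear_op Sis" "\<And>x y. cinner (Si x) y = cinner x (Sis y)"
    using adjoint_exists[OF S(2)] by blast
  have lin: "bounded_linear S" "bounded_linear Si" "bounded_linear J" "bounded_linear Ss" "bounded_linear Sis"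
    and linC: "\<And>c x. S (scaleC c x) = scaleC c (S x)" "\<And>c x. Si (scaleC c x) = scaleC c (Si x)"
      "\<And>c x. J (scaleC c x) = scaleC c (J x)" "\<And>c x. Sis (scaleC c x) = scaleC c (Sis x)"
    using S(1,2) J(1) Ss(1) Sis(1) by (simp_all add: bounded_clinear_op_iff)
  have SsSis: "Ss (Sis x) = x" for x
    by (rule cinner_eqI) (simp add: Ss(2)[symmetric] Sis(2)[symmetric] S)
  \<comment> \<open>With \<open>Sis\<close> the adjoint of \<open>Si\<close>, this represents the
    indefinite product of \<open>Si u\<close> and \<open>Si v\<close>. Its left inverse
    \<open>S J Ss\<close>, with \<open>Ss\<close> the adjoint of \<open>S\<close>, is bounded, which
    gives the lower bound \<open>W0b\<close>.\<close>
  define W0 where "W0 x = Sis (J (Si x))" for x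
  have W0lin: "bounded_linear W0"
    unfolding W0_def by (rule bounded_linear_compose[OF lin(5) bounded_linear_compose[OF lin(3,2)]])
  have W0C: "W0 (scaleC c x) = scaleC c (W0 x)" for c x by (simp add: W0_def linC)
  have W0i: "cinner (W0 x) y = cinner (J (Si x)) (Si y)" for x y
    by (metis W0_def Sis(2) cinner_commute)
  have W0sym: "cinner (W0 x) y = cinner x (W0 y)" for x y
    by (metis W0i J(3) cinner_commute)
  obtain K where K: "K > 0" "\<And>x. norm (W0 x) \<le> norm x * K"
    using bounded_linear.pos_bounded[OF W0lin] by blast
  have "bounded_linear (\<lambda>x. S (J (Ss x)))"
    by (rule bounded_linear_compose[OF lin(1) bounded_linear_compose[OF lin(3,4)]])
  then obtain K2 where K2: "K2 > 0" "\<And>x. norm (S (J (Ss x))) \<le> norm x * K2"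
    using bounded_linear.pos_bounded by blast
  have W0b: "norm x \<le> norm (W0 x) * K2" for x
    using K2(2)[of "W0 x"] by (simp add: W0_def SsSis J S)
  have W0A: "W0 u \<in> D \<and> A (W0 u) = W0 (A u)" if u: "u \<in> D" for u
  proof -
    \<comment> \<open>The \<open>J\<close> from \<open>W0\<close> cancels the \<open>J\<close> in
      \<open>A\<close>, leaving a pairing of \<open>Si u\<close> and \<open>Si g\<close> through the
      symmetric \<open>L\<close>. Holding for all \<open>g\<close> in \<open>D\<close>, the identity
      also proves \<open>W0 u \<in> D\<close>.\<close>
    have "cinner (A g) (W0 u) = cinner g (W0 (A u))" if g: "g \<in> D" for g
    proof -
      have "cinner (W0 u) (A g) = cinner (Si u) (L (Si g))"
        by (simp add: W0i AS[OF g] S J(3)[symmetric] J(2))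
      also have "\<dots> = cinner (L (Si u)) (Si g)"
        using self_adjoint_symmetric[OF L SiD[OF u] SiD[OF g]] by simp
      also have "\<dots> = cinner (W0 (A u)) g" by (simp add: W0i AS[OF u] S J(2))
      finally show ?thesis by (metis cinner_commute)
    qed
    then show ?thesis using self_adjoint_adjointD[OF A] by blast
  qed
  \<comment> \<open>Division by the bound \<open>K\<close> makes the operator a contraction; a
    positive factor does not change the sign operator.\<close>
  define W where "W x = (1 / K) *\<^sub>R W0 x" for x
  have AR: "A (r *\<^sub>R x) = r *\<^sub>R A x" "r *\<^sub>R x \<in> D" if "x \<in> D" for r x
    using A that unfolding self_adjoint_def clinear_on_def csubspace_def by (auto simp: scaleR_scaleC)
  have "\<exists>U c. bounded_clinear_op U \<and> (\<forall>x. U (U x) = x) \<and> c > 0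
     \<and> (\<forall>x. c * (norm x)\<^sup>2 \<le> Re (cinner (W (U x)) x))
     \<and> (\<forall>x y. cinner (W (U x)) y = cinner (W x) (U y))
     \<and> (\<forall>x\<in>D. U x \<in> D \<and> A (U x) = U (A x))"
  proof (rule sign_exists[OF A])
    show "bounded_clinear_op W"
      unfolding bounded_clinear_op_iff W_def using W0lin W0C
      by (auto intro: bounded_linear_compose[OF bounded_linear_scaleR_right]
          simp: scaleC_scaleR)
    show "cinner (W x) y = cinner x (W y)" for x y by (simp add: W_def cinner_scaleR W0sym)
    show "norm (W x) \<le> norm x" for x using K by (simp add: W_def field_simps)
    show "1 / (K * K2) > 0" using K K2 by simp
    show "1 / (K * K2) * norm x \<le> norm (W x)" for x
      using K K2 W0b[of x] by (simp add: W_def field_simps)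
    show "W x \<in> D \<and> A (W x) = W (A x)" if "x \<in> D" for x
      using W0A[OF that] AR by (simp add: W_def)
  qed
  then obtain U c where U: "bounded_clinear_op U" "\<And>x. U (U x) = x" "c > 0"
     "\<And>x. c * (norm x)\<^sup>2 \<le> Re (cinner (W (U x)) x)"
     "\<And>x y. cinner (W (U x)) y = cinner (W x) (U y)"
     "\<And>x. x \<in> D \<Longrightarrow> U x \<in> D \<and> A (U x) = U (A x)" by blast
  define U' where "U' x = Si (U (S x))" for x
  obtain Ki where Ki: "Ki > 0" "\<And>x. norm (Si x) \<le> norm x * Ki"
    using bounded_linear.pos_bounded[OF lin(2)] by blast
  have JU': "cinner (J (U' x)) y = K * cinner (W (U (S x))) (S y)"
    "cinner (J x) (U' y) = K * cinner (W (S x)) (U (S y))" for x y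
    using K(1) by (simp_all add: U'_def W_def W0i S cinner_scaleR)
  have linU: "bounded_linear U" and UC: "\<And>c x. U (scaleC c x) = scaleC c (U x)"
    using U(1) by (simp_all add: bounded_clinear_op_iff)
  have "bounded_linear U'"
    unfolding U'_def by (rule bounded_linear_compose[OF lin(2) bounded_linear_compose[OF linU lin(1)]])
  then have "bounded_clinear_op U'" by (simp add: bounded_clinear_op_iff U'_def linC UC)
  moreover have "U' (U' x) = x" for x by (simp add: U'_def S U)
  \<comment> \<open>\<open>K\<close> undoes the normalisation of \<open>W\<close>; the bound
    \<open>Ki\<close> of \<open>Si\<close> turns coercivity in \<open>S x\<close> into coercivity in
    \<open>x\<close>.\<close>
  moreover have "K * c / Ki\<^sup>2 > 0" using K U Ki by simp
  moreover have "K * c / Ki\<^sup>2 * (norm x)\<^sup>2 \<le> Re (cinner (J (U' x)) x)" for x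
  proof -
    have "(norm x)\<^sup>2 \<le> (norm (S x) * Ki)\<^sup>2" using Ki(2)[of "S x"] by (intro power_mono) (auto simp: S)
    then have "K * c / Ki\<^sup>2 * (norm x)\<^sup>2 \<le> K * (c * (norm (S x))\<^sup>2)"
      using K U Ki by (simp add: field_simps power_mult_distrib)
    also have "\<dots> \<le> K * Re (cinner (W (U (S x))) (S x))" using K U(4) by (intro mult_left_mono) auto
    finally show ?thesis by (simp add: JU')
  qed
  moreover have "cinner (J (U' x)) y = cinner (J x) (U' y)" for x y by (simp add: JU' U(5))
  moreover have "U' x \<in> DL \<and> J (L (U' x)) = U' (J (L x))" if "x \<in> DL" for x
  proof -
    have Sx: "S x \<in> D" using SD that by auto
    then have *: "U (S x) \<in> D" "A (U (S x)) = U (A (S x))" using U(6) by auto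
    have "S (J (L (U' x))) = U (S (J (L x)))" using *(2) AS[OF *(1)] AS[OF Sx] by (simp add: U'_def S)
    then have "Si (S (J (L (U' x)))) = U' (J (L x))" by (simp add: U'_def)
    then show ?thesis using SiD[OF *(1)] by (simp add: U'_def S)
  qed
  ultimately show ?thesis by blast
qed

section \<open>The semigroup generated by a positive symmetric operator\<close>

text \<open>Termwise differentiation under uniform convergence of the derivatives. It serves for the
  exponential series and for the passage from the Yosida flows to their limit.\<close>

lemma has_vector_derivative_uniform_limit:
  fixes f :: "nat \<Rightarrow> real \<Rightarrow> 'a::banach"
  assumes S: "convex S"
    and f: "\<And>n x. x \<in> S \<Longrightarrow> (f n has_vector_derivative f' n x) (at x within S)"
    and f': "uniform_limit S f' g' sequentially"
    and lim: "\<And>x. x \<in> S \<Longrightarrow> (\<lambda>n. f n x) \<longlonglongrightarrow> F x" and x: "x \<in> S"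
  shows "(F has_vector_derivative g' x) (at x within S)"
proof -
  have d: "(f n has_derivative (\<lambda>h. h *\<^sub>R f' n x)) (at x within S)" if "x \<in> S" for n x
    using f[OF that] by (simp add: has_vector_derivative_def)
  have e: "\<forall>\<^sub>F n in sequentially. \<forall>x\<in>S. \<forall>h. norm (h *\<^sub>R f' n x - h *\<^sub>R g' x) \<le> e * norm h" if "e > 0" for e
    using uniform_limitD[OF f' that]
    by eventually_elim (auto simp: scaleR_diff_right[symmetric] dist_norm mult.commute[of e] less_imp_le intro!: mult_left_mono)
  have "\<exists>g. \<forall>x\<in>S. (\<lambda>n. f n x) \<longlonglongrightarrow> g x \<and> (g has_derivative (\<lambda>h. h *\<^sub>R g' x)) (at x within S)"
    by (rule has_derivative_sequence[where f' = "\<lambda>n x h. h *\<^sub>R f' n x" and g' = "\<lambda>x h. h *\<^sub>R g' x", OF S d e x lim[OF x]])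
  then obtain g where g: "\<And>x. x \<in> S \<Longrightarrow> (\<lambda>n. f n x) \<longlonglongrightarrow> g x"
      "\<And>x. x \<in> S \<Longrightarrow> (g has_vector_derivative g' x) (at x within S)"
    by (auto simp: has_vector_derivative_def)
  have "F x = g x" if "x \<in> S" for x using LIMSEQ_unique[OF lim g(1)] that by blast
  then show ?thesis using g(2)[OF x] x
    by (rule_tac has_vector_derivative_transform[of x S F g]) auto
qed

lemma has_vector_derivative_affine:
  fixes u :: "real \<Rightarrow> 'a::real_normed_vector"
  assumes "(u has_vector_derivative d) (at (m * r + k))"
  shows "((\<lambda>r. u (m * r + k)) has_vector_derivative m *\<^sub>R d) (at r)"
proof -
  have "((\<lambda>r. m * r + k) has_vector_derivative m) (at r)"
    by (auto simp flip: has_real_derivative_iff_has_vector_derivative intro!: derivative_eq_intros)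
  from vector_diff_chain_at[OF this assms] show ?thesis by (simp add: o_def)
qed

lemma linear_ode_exists:
  fixes C :: "'a::banach \<Rightarrow> 'a"
  assumes C: "bounded_linear C"
  shows "\<exists>u. u 0 = f \<and> (\<forall>t. (u has_vector_derivative C (u t)) (at t))"
proof -
  interpret C: bounded_linear C by fact
  obtain K where K: "K > 0" "\<And>x. norm (C x) \<le> norm x * K" using C.pos_bounded by blast
  have CK: "norm ((C ^^ k) f) \<le> K ^ k * norm f" for k
  proof (induction k)
    case (Suc k)
    have "norm (C ((C ^^ k) f)) \<le> norm ((C ^^ k) f) * K" by (rule K)
    also have "\<dots> \<le> (K ^ k * norm f) * K" using Suc K(1) by (intro mult_right_mono) auto
    finally show ?case by (simp add: ac_simps)
  qed simp
  define v where "v n t = (\<Sum>k<n. (t ^ k / fact k) *\<^sub>R (C ^^ k) f)" for n :: nat and t :: real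
  define u where "u t = (\<Sum>k. (t ^ k / fact k) *\<^sub>R (C ^^ k) f)" for t :: real
  have unif: "uniform_limit {-a..a} v u sequentially" for a :: real
    unfolding v_def u_def
  proof (rule Weierstrass_m_test)
    show "summable (\<lambda>k. (a * K) ^ k /\<^sub>R fact k * norm f)"
      by (intro summable_mult2 summable_exp_generic)
    show "norm ((t ^ k / fact k) *\<^sub>R (C ^^ k) f) \<le> (a * K) ^ k /\<^sub>R fact k * norm f"
      if "t \<in> {-a..a}" for k t
    proof -
      have "\<bar>t\<bar> ^ k \<le> a ^ k" using that by (intro power_mono) auto
      then have "\<bar>t\<bar> ^ k * norm ((C ^^ k) f) \<le> a ^ k * (K ^ k * norm f)"
        using CK[of k] by (intro mult_mono) (auto intro: order_trans[OF zero_le_power[of "\<bar>t\<bar>"]])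
      then show ?thesis by (simp add: power_abs power_mult_distrib divide_simps)
    qed
  qed
  \<comment> \<open>Differentiation lowers the degree by one, so the derivative of a partial sum is
    \<open>C\<close> applied to the preceding one. Uniform convergence of the partial sums thus
    already gives that of the derivatives.\<close>
  have dv: "(v (Suc n) has_vector_derivative C (v n t)) (at t within S)" for n t S
  proof (induction n)
    case 0
    have "v (Suc 0) = (\<lambda>t. f)" "v 0 t = 0" by (auto simp: v_def)
    then show ?case by (simp add: C.zero has_vector_derivative_const)
  next
    case (Suc n)
    have eq: "v (Suc (Suc n)) = (\<lambda>t. v (Suc n) t + (t ^ Suc n / fact (Suc n)) *\<^sub>R (C ^^ Suc n) f)"
      by (simp add: v_def fun_eq_iff)
    have "((\<lambda>t. t ^ Suc n / fact (Suc n)) has_real_derivative (t ^ n / fact n)) (at t within S)"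
      by (auto intro!: derivative_eq_intros simp: field_simps simp del: power_Suc fact_Suc)
        (simp add: field_simps)
    then have "((\<lambda>t. (t ^ Suc n / fact (Suc n)) *\<^sub>R (C ^^ Suc n) f) has_vector_derivative
        (t ^ n / fact n) *\<^sub>R (C ^^ Suc n) f) (at t within S)"
      using has_vector_derivative_scaleR[OF _ has_vector_derivative_const[of "(C ^^ Suc n) f"]] by force
    from has_vector_derivative_add[OF Suc this]
    show ?case unfolding eq by (simp add: v_def C.add C.scaleR)
  qed
  have "(u has_vector_derivative C (u t)) (at t)" for t
  proof -
    define a where "a = \<bar>t\<bar> + 1"
    have t: "t \<in> interior {-a..a}" "t \<in> {-a..a}" by (auto simp: a_def)
    have "(u has_vector_derivative C (u t)) (at t within {-a..a})"
    proof (rule has_vector_derivative_uniform_limit[OF _ dv])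
      show "uniform_limit {-a..a} (\<lambda>n t. C (v n t)) (\<lambda>t. C (u t)) sequentially"
        by (rule bounded_linear.uniform_limit[OF C unif])
      show "(\<lambda>n. v (Suc n) x) \<longlonglongrightarrow> u x" if "x \<in> {-a..a}" for x
        using LIMSEQ_Suc[OF tendsto_uniform_limitI[OF unif that]] .
    qed (use t in auto)
    then show ?thesis using at_within_interior[OF t(1)] by simp
  qed
  moreover have "u 0 = f"
  proof -
    have "v (Suc n) 0 = f" for n by (induction n) (auto simp: v_def)
    then show ?thesis
      using LIMSEQ_unique[OF LIMSEQ_Suc[OF tendsto_uniform_limitI[OF unif[of 0], of 0]], of f] by simp
  qed
  ultimately show ?thesis by blast
qed

section \<open>Energy estimates for a coercive form and the flow of a bounded monotone
  operator\<close>

text \<open>The form stands for the real part of an inner product equivalent to the given one. Real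
  scalars suffice for all energy arguments; complex linearity of the semigroup is recovered
  afterwards by commutation with \<open>scaleC z\<close>.\<close>

locale coercive_form =
  fixes b :: "'a::banach \<Rightarrow> 'a \<Rightarrow> real" and c :: real
  assumes bounded_bilinear: "bounded_bilinear b"
    and sym: "b x y = b y x"
    and c_pos: "c > 0"
    and coercive: "c * (norm x)\<^sup>2 \<le> b x x"
begin

sublocale b: bounded_bilinear b by (rule bounded_bilinear)

lemma nonneg: "0 \<le> b x x"
  using coercive[of x] c_pos by (meson order_trans zero_le_mult_iff zero_le_power2 less_imp_le)

lemma zero_if_nonpos: "b x x \<le> 0 \<Longrightarrow> x = 0"
  using coercive[of x] c_pos by (smt (verit) mult_pos_pos zero_less_norm_iff zero_less_power2 norm_eq_zero)

lemma norm_sq_le: "(norm x)\<^sup>2 \<le> b x x / c"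
  using coercive[of x] c_pos by (simp add: field_simps)

lemma upper: "\<exists>K>0. \<forall>x. b x x \<le> K * (norm x)\<^sup>2"
proof -
  obtain K where "K > 0" "\<And>x y. norm (b x y) \<le> norm x * norm y * K" using b.pos_bounded by blast
  then show ?thesis by (intro exI[of _ K]) (auto simp: power2_eq_square mult.commute abs_le_iff)
qed

lemma b_add_sq: "b (x + y) (x + y) = b x x + 2 * b x y + b y y"
  by (simp add: b.add_left b.add_right sym[of y x])

lemma b_diff_sq: "b (x - y) (x - y) = b x x - 2 * b x y + b y y"
  by (simp add: b.diff_left b.diff_right sym[of y x])

lemma two_b_le: "2 * b x y \<le> b x x + b y y"
  using nonneg[of "x - y"] by (simp add: b_diff_sq)

lemma Cauchy_Schwarz: "(b x y)\<^sup>2 \<le> b x x * b y y"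
proof (rule quadratic_nonneg_discriminant[OF _ nonneg])
  show "0 \<le> b x x + 2 * t * b x y + t\<^sup>2 * b y y" for t
    using nonneg[of "x + t *\<^sub>R y"]
    by (simp add: b_add_sq b.scaleR_right b.scaleR_left power2_eq_square mult.assoc)
qed

lemma energy_derivative:
  assumes "(u has_vector_derivative u') (at t)"
  shows "((\<lambda>t. b (u t) (u t)) has_real_derivative 2 * b u' (u t)) (at t)"
  using b.has_vector_derivative[OF assms assms]
  by (simp add: has_real_derivative_iff_has_vector_derivative sym[of "u t" u'])

text \<open>Differentiability is asked only in the open interval because strong solutions, and
  orbits starting outside the domain, are merely continuous at the end points.\<close>

lemma energy_decreasing:
  assumes "0 \<le> a" "continuous_on {0..a} u"
    and "\<And>t. 0 < t \<Longrightarrow> t < a \<Longrightarrow> (u has_vector_derivative u' t) (at t) \<and> b (u' t) (u t) \<le> 0"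
  shows "b (u a) (u a) \<le> b (u 0) (u 0)"
proof (cases "a = 0")
  case False
  show ?thesis
  proof (rule DERIV_nonpos_imp_decreasing_open[of 0 a "\<lambda>t. b (u t) (u t)"])
    show "continuous_on {0..a} (\<lambda>t. b (u t) (u t))" by (intro b.continuous_on assms)
    show "\<exists>y. ((\<lambda>t. b (u t) (u t)) has_real_derivative y) (at t) \<and> y \<le> 0" if "0 < t" "t < a" for t
      using energy_derivative[of u "u' t" t] assms(3)[OF that] by (intro exI[of _ "2 * b (u' t) (u t)"]) auto
  qed (use assms False in auto)
qed simp

text \<open>Gronwall's argument: \<open>exp (- t) * b (u t) (u t) - t * d\<close> is
  nonincreasing.\<close>

lemma energy_growth:
  assumes "0 \<le> a" "continuous_on {0..a} u" "u 0 = 0" "0 \<le> d"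
    and "\<And>t. 0 < t \<Longrightarrow> t < a \<Longrightarrow> (u has_vector_derivative u' t) (at t) \<and> 2 * b (u' t) (u t) \<le> b (u t) (u t) + d"
  shows "b (u a) (u a) \<le> exp a * (a * d)"
proof (cases "a = 0")
  case True
  then show ?thesis using assms by (simp add: b.zero_left)
next
  case False
  have "exp (- a) * b (u a) (u a) - a * d \<le> exp (- 0) * b (u 0) (u 0) - 0 * d"
  proof (rule DERIV_nonpos_imp_decreasing_open[of 0 a "\<lambda>t. exp (- t) * b (u t) (u t) - t * d"])
    show "continuous_on {0..a} (\<lambda>t. exp (- t) * b (u t) (u t) - t * d)"
      by (intro continuous_intros b.continuous_on assms)
    show "\<exists>y. ((\<lambda>t. exp (- t) * b (u t) (u t) - t * d) has_real_derivative y) (at t) \<and> y \<le> 0"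
      if t: "0 < t" "t < a" for t
    proof (intro exI conjI)
      show "((\<lambda>t. exp (- t) * b (u t) (u t) - t * d) has_real_derivative
         (exp (- t) * (2 * b (u' t) (u t) - b (u t) (u t)) - d)) (at t)"
        using energy_derivative[of u "u' t" t] assms(5)[OF t]
        by (auto intro!: derivative_eq_intros simp: algebra_simps)
      have "exp (- t) * (2 * b (u' t) (u t) - b (u t) (u t)) \<le> exp (- t) * d"
        using assms(5)[OF t] by (intro mult_left_mono) auto
      also have "\<dots> \<le> 1 * d" using t assms(4) by (intro mult_right_mono) auto
      finally show "exp (- t) * (2 * b (u' t) (u t) - b (u t) (u t)) - d \<le> 0" by simp
    qed
  qed (use assms False in auto)
  then have "exp (- a) * b (u a) (u a) \<le> a * d" using assms(3) by (simp add: b.zero_left)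
  then have "exp a * (exp (- a) * b (u a) (u a)) \<le> exp a * (a * d)" by (intro mult_left_mono) auto
  then show ?thesis by (simp add: mult.assoc[symmetric] exp_add[symmetric])
qed

text \<open>This is the flow \<open>e^(-tA)\<close>. The choice is made once for the whole
  trajectory and only then evaluated at \<open>t\<close>, so the differential equation is inherited;
  for \<open>0 \<le> t\<close> monotonicity of \<open>A\<close> makes the choice immaterial.\<close>

definition evolution :: "('a \<Rightarrow> 'a) \<Rightarrow> real \<Rightarrow> 'a \<Rightarrow> 'a" where
  "evolution A t f = (SOME u. u 0 = f \<and> (\<forall>t. (u has_vector_derivative - A (u t)) (at t))) t"

end

locale bounded_monotone = coercive_form +
  fixes A :: "'a \<Rightarrow> 'a"
  assumes A_bounded_linear: "bounded_linear A" and A_nonneg: "0 \<le> b (A x) x"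
begin

sublocale A: bounded_linear A by (rule A_bounded_linear)

lemma evolution_0 [simp]: "evolution A 0 f = f"
  and evolution_derivative: "((\<lambda>t. evolution A t f) has_vector_derivative - A (evolution A t f)) (at t)"
proof -
  have "\<exists>u. u 0 = f \<and> (\<forall>t. (u has_vector_derivative - A (u t)) (at t))"
    by (rule linear_ode_exists[OF bounded_linear_minus[OF A_bounded_linear]])
  from someI_ex[OF this]
  show "evolution A 0 f = f" "((\<lambda>t. evolution A t f) has_vector_derivative - A (evolution A t f)) (at t)"
    unfolding evolution_def by auto
qed

lemma evolution_unique:
  assumes "u 0 = f" "\<And>t. (u has_vector_derivative - A (u t)) (at t)" "0 \<le> t"
  shows "u t = evolution A t f"
proof -
  define w where "w t = u t - evolution A t f" for t
  have dw: "(w has_vector_derivative - A (w t)) (at t)" for t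
    using has_vector_derivative_diff[OF assms(2) evolution_derivative[of f t]]
    unfolding w_def by (simp add: A.diff)
  have "b (w t) (w t) \<le> b (w 0) (w 0)"
  proof (rule energy_decreasing[OF assms(3), of w "\<lambda>t. - A (w t)"])
    show "continuous_on {0..t} w"
      using dw by (intro continuous_at_imp_continuous_on) (auto intro: has_vector_derivative_continuous)
  qed (use dw A_nonneg in \<open>auto simp: b.minus_left\<close>)
  then show ?thesis using zero_if_nonpos[of "w t"] assms(1) by (simp add: w_def b.zero_left)
qed

lemma evolution_continuous: "continuous_on S (\<lambda>t. evolution A t f)"
  by (intro continuous_at_imp_continuous_on ballI has_vector_derivative_continuous[OF evolution_derivative])

lemma evolution_contraction:
  assumes "0 \<le> t" shows "b (evolution A t f) (evolution A t f) \<le> b f f"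
  using energy_decreasing[OF assms evolution_continuous, of f "\<lambda>t. - A (evolution A t f)"]
    evolution_derivative A_nonneg by (simp add: b.minus_left)

text \<open>Both sides solve the same initial value problem.\<close>

lemma evolution_commute:
  assumes Q: "bounded_linear Q" "\<And>x. Q (A x) = A (Q x)" and t: "0 \<le> t"
  shows "Q (evolution A t f) = evolution A t (Q f)"
proof (rule evolution_unique[OF _ _ t])
  interpret Q: bounded_linear Q by fact
  show "((\<lambda>t. Q (evolution A t f)) has_vector_derivative - A (Q (evolution A t f))) (at t)" for t
    using Q.has_vector_derivative[OF evolution_derivative[of f t]] by (simp add: Q.neg Q(2))
qed simp

lemma evolution_add:
  assumes "0 \<le> t" shows "evolution A t (f + g) = evolution A t f + evolution A t g"
  by (rule evolution_unique[symmetric])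
    (use assms has_vector_derivative_add[OF evolution_derivative[of f] evolution_derivative[of g]] in \<open>auto simp: A.add\<close>)

lemma evolution_scaleR:
  assumes "0 \<le> t" shows "evolution A t (r *\<^sub>R f) = r *\<^sub>R evolution A t f"
  by (rule evolution_commute[OF bounded_linear_scaleR_right _ assms, symmetric]) (simp add: A.scaleR)

lemma evolution_diff:
  assumes "0 \<le> t" shows "evolution A t (f - g) = evolution A t f - evolution A t g"
  using evolution_add[OF assms, of "f - g" g] by simp

text \<open>The derivative of \<open>b u u / 2 + t b (A u) u + t\<^sup>2 b (A u) (A u)\<close> along a trajectory \<open>u\<close>
  is \<open>- 2 t\<^sup>2 b (A (A u)) (A u)\<close>.\<close>
lemma evolution_smoothing:
  assumes symA: "\<And>x y. b (A x) y = b x (A y)" and t: "0 \<le> t"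
  shows "t\<^sup>2 * b (A (evolution A t f)) (A (evolution A t f)) \<le> b f f / 2"
proof -
  define u where "u t = evolution A t f" for t
  have du: "(u has_vector_derivative - A (u t)) (at t)" for t
    unfolding u_def by (rule evolution_derivative)
  have dAu: "((\<lambda>t. A (u t)) has_vector_derivative - A (A (u t))) (at t)" for t
    using A.has_vector_derivative[OF du] by (simp add: A.neg)
  have d1: "((\<lambda>t. b (u t) (u t)) has_real_derivative - 2 * b (A (u t)) (u t)) (at t)" for t
    using energy_derivative[OF du] by (simp add: b.minus_left)
  have d2: "((\<lambda>t. b (A (u t)) (u t)) has_real_derivative - 2 * b (A (u t)) (A (u t))) (at t)" for t
    using b.has_vector_derivative[OF dAu du, of t]
    by (simp add: has_real_derivative_iff_has_vector_derivative b.minus_left b.minus_right symA[of "A (u t)"])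
  have d3: "((\<lambda>t. b (A (u t)) (A (u t))) has_real_derivative - 2 * b (A (A (u t))) (A (u t))) (at t)" for t
    using energy_derivative[OF dAu] by (simp add: b.minus_left)
  define \<Phi> where "\<Phi> t = b (u t) (u t) / 2 + t * b (A (u t)) (u t) + t\<^sup>2 * b (A (u t)) (A (u t))" for t
  have "\<Phi> t \<le> \<Phi> 0"
  proof (rule DERIV_nonpos_imp_nonincreasing[OF t])
    fix s assume s: "0 \<le> s" "s \<le> t"
    have "(\<Phi> has_real_derivative - 2 * s\<^sup>2 * b (A (A (u s))) (A (u s))) (at s)"
      unfolding \<Phi>_def using d1[of s] d2[of s] d3[of s]
      by (auto intro!: derivative_eq_intros simp: field_simps power2_eq_square)
    moreover have "- 2 * s\<^sup>2 * b (A (A (u s))) (A (u s)) \<le> 0"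
      using A_nonneg[of "A (u s)"] by (simp add: mult_nonneg_nonneg)
    ultimately show "\<exists>y. (\<Phi> has_real_derivative y) (at s) \<and> y \<le> 0" by blast
  qed
  moreover have "0 \<le> b (u t) (u t) / 2 + t * b (A (u t)) (u t)"
    using t A_nonneg nonneg by (intro add_nonneg_nonneg mult_nonneg_nonneg) auto
  ultimately show ?thesis by (simp add: \<Phi>_def u_def)
qed

end

section \<open>The Yosida approximation of a positive symmetric operator\<close>

text \<open>The range condition \<open>T_onto\<close> is the form in which self-adjointness of
  \<open>T\<close> with respect to \<open>b\<close> is used; it says that the monotone operator
  \<open>T\<close> is maximal.\<close>

locale positive_symmetric_operator = coercive_form +
  fixes D :: "'a set" and T :: "'a \<Rightarrow> 'a"
  assumes D_subspace: "subspace D" and D_dense: "closure D = UNIV"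
    and T_add: "x \<in> D \<Longrightarrow> y \<in> D \<Longrightarrow> T (x + y) = T x + T y"
    and T_scaleR: "x \<in> D \<Longrightarrow> T (r *\<^sub>R x) = r *\<^sub>R T x"
    and T_sym: "x \<in> D \<Longrightarrow> y \<in> D \<Longrightarrow> b (T x) y = b x (T y)"
    and T_nonneg: "x \<in> D \<Longrightarrow> 0 \<le> b (T x) x"
    and T_onto: "0 < l \<Longrightarrow> \<exists>x\<in>D. T x + l *\<^sub>R x = y"
begin

lemmas D_closed = subspace_add[OF D_subspace] subspace_diff[OF D_subspace] subspace_scale[OF D_subspace]
  subspace_0[OF D_subspace] subspace_neg[OF D_subspace]

lemma T_neg: "x \<in> D \<Longrightarrow> T (- x) = - T x"
  using T_scaleR[of x "-1"] by simp

lemma T_diff: "x \<in> D \<Longrightarrow> y \<in> D \<Longrightarrow> T (x - y) = T x - T y"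
  using T_add[of x "- y"] T_neg[of y] D_closed by simp

lemma resolvent_estimate:
  assumes "x \<in> D" "0 < l"
  shows "l\<^sup>2 * b x x \<le> b (T x + l *\<^sub>R x) (T x + l *\<^sub>R x)"
proof -
  have "b (T x + l *\<^sub>R x) (T x + l *\<^sub>R x) = b (T x) (T x) + 2 * l * b (T x) x + l\<^sup>2 * b x x"
    by (simp add: b_add_sq b.scaleR_left b.scaleR_right power2_eq_square mult.assoc)
  then show ?thesis using nonneg[of "T x"] T_nonneg[OF assms(1)] assms(2) by simp
qed

definition resolvent :: "real \<Rightarrow> 'a \<Rightarrow> 'a" where
  "resolvent l y = (THE x. x \<in> D \<and> T x + l *\<^sub>R x = y)"

lemma resolvent_unique:
  assumes l: "0 < l" and x: "x \<in> D" "T x + l *\<^sub>R x = y"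
  shows "resolvent l y = x"
  unfolding resolvent_def
proof (rule the_equality)
  fix z assume z: "z \<in> D \<and> T z + l *\<^sub>R z = y"
  have "T (z - x) + l *\<^sub>R (z - x) = (T z + l *\<^sub>R z) - (T x + l *\<^sub>R x)"
    using z x by (simp add: T_diff algebra_simps)
  also have "\<dots> = 0" using z x(2) by simp
  finally have "T (z - x) + l *\<^sub>R (z - x) = 0" .
  then have "l\<^sup>2 * b (z - x) (z - x) \<le> 0"
    using resolvent_estimate[of "z - x" l] z x l D_closed by (simp add: b.zero_left)
  then have "b (z - x) (z - x) \<le> 0" using l by (simp add: mult_le_0_iff)
  then show "z = x" using zero_if_nonpos by force
qed (use x in auto)

lemma resolvent:
  assumes "0 < l" shows resolvent_in_D: "resolvent l y \<in> D" and resolvent_eq: "T (resolvent l y) + l *\<^sub>R resolvent l y = y"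
  using T_onto[OF assms, of y] resolvent_unique[OF assms] by auto

lemma resolvent_bounded_linear: assumes l: "0 < l" shows "bounded_linear (resolvent l)"
proof -
  obtain K where K: "K > 0" "\<And>x. b x x \<le> K * (norm x)\<^sup>2" using upper by blast
  show ?thesis
  proof (rule bounded_linear_intro)
    show "resolvent l (x + y) = resolvent l x + resolvent l y" for x y
      using resolvent[OF l, of x] resolvent[OF l, of y]
      by (intro resolvent_unique[OF l]) (auto simp: D_closed T_add scaleR_add_right algebra_simps)
    show "resolvent l (r *\<^sub>R x) = r *\<^sub>R resolvent l x" for r x
    proof (rule resolvent_unique[OF l])
      have "T (r *\<^sub>R resolvent l x) + l *\<^sub>R r *\<^sub>R resolvent l x = r *\<^sub>R (T (resolvent l x) + l *\<^sub>R resolvent l x)"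
        by (simp add: T_scaleR resolvent_in_D[OF l] scaleR_add_right mult.commute)
      then show "T (r *\<^sub>R resolvent l x) + l *\<^sub>R r *\<^sub>R resolvent l x = r *\<^sub>R x" by (simp only: resolvent_eq[OF l])
    qed (simp add: resolvent[OF l] D_closed)
    show "norm (resolvent l y) \<le> norm y * sqrt (K / (c * l\<^sup>2))" for y
    proof (rule power2_le_imp_le)
      have "(norm (resolvent l y))\<^sup>2 \<le> b (resolvent l y) (resolvent l y) / c" by (rule norm_sq_le)
      also have "\<dots> \<le> (b y y / l\<^sup>2) / c"
        using resolvent_estimate[OF resolvent_in_D[OF l] l, of y] resolvent_eq[OF l, of y] l c_pos
        by (intro divide_right_mono) (auto simp: field_simps)
      also have "\<dots> \<le> (K * (norm y)\<^sup>2 / l\<^sup>2) / c" using K l c_pos by (intro divide_right_mono) auto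
      finally show "(norm (resolvent l y))\<^sup>2 \<le> (norm y * sqrt (K / (c * l\<^sup>2)))\<^sup>2"
        using K c_pos by (simp add: power_mult_distrib field_simps)
    qed (use K c_pos in auto)
  qed
qed

lemma resolvent_contraction: assumes "0 < l" shows "b (l *\<^sub>R resolvent l y) (l *\<^sub>R resolvent l y) \<le> b y y"
  using resolvent_estimate[OF resolvent_in_D[OF assms] assms, of y] resolvent_eq[OF assms, of y]
  by (simp add: b.scaleR_left b.scaleR_right power2_eq_square mult.assoc)

lemma resolvent_sym: assumes l: "0 < l" shows "b (resolvent l x) y = b x (resolvent l y)"
proof -
  have "b (resolvent l x) (T (resolvent l y) + l *\<^sub>R resolvent l y) = b (T (resolvent l x) + l *\<^sub>R resolvent l x) (resolvent l y)"
    by (simp add: b.add_right b.add_left b.scaleR_left b.scaleR_right T_sym[OF resolvent_in_D[OF l] resolvent_in_D[OF l]])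
  then show ?thesis by (simp add: resolvent_eq[OF l])
qed

lemma resolvent_commute: assumes l: "0 < l" and m: "0 < m" shows "resolvent l (resolvent m x) = resolvent m (resolvent l x)"
proof (cases "l = m")
  case False
  \<comment> \<open>The resolvent identity. Exchanging \<open>l\<close> and \<open>m\<close> leaves
    the difference on the left unchanged up to sign, and the two versions together give
    commutation.\<close>
  have id: "resolvent l x - resolvent m x = (m - l) *\<^sub>R resolvent l (resolvent m x)" if l: "0 < l" and m: "0 < m" for l m
  proof -
    interpret resolvent: bounded_linear "resolvent l" by (rule resolvent_bounded_linear[OF l])
    have "resolvent l (T (resolvent m x) + l *\<^sub>R resolvent m x) = resolvent m x"
      using resolvent_unique[OF l resolvent_in_D[OF m] refl] .
    moreover have "T (resolvent m x) + l *\<^sub>R resolvent m x = x + (l - m) *\<^sub>R resolvent m x"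
      using resolvent_eq[OF m, of x] by (simp add: algebra_simps)
    ultimately have "resolvent l x + (l - m) *\<^sub>R resolvent l (resolvent m x) = resolvent m x" by (simp add: resolvent.add resolvent.scaleR)
    then show ?thesis by (simp add: algebra_simps)
  qed
  have "(m - l) *\<^sub>R resolvent l (resolvent m x) = (m - l) *\<^sub>R resolvent m (resolvent l x)"
    unfolding id[OF l m, symmetric] using id[OF m l]
    by (metis minus_diff_eq scaleR_minus_left)
  then show ?thesis using False by simp
qed simp

text \<open>Closedness is inherited from continuity of the everywhere defined resolvent at
  1.\<close>

lemma T_closed:
  assumes "\<And>n. x n \<in> D" "x \<longlonglongrightarrow> y" "(\<lambda>n. T (x n)) \<longlonglongrightarrow> z"
  shows "y \<in> D" "T y = z"
proof -
  have "(\<lambda>n. resolvent 1 (T (x n) + 1 *\<^sub>R x n)) \<longlonglongrightarrow> resolvent 1 (z + 1 *\<^sub>R y)"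
    by (intro bounded_linear.tendsto[OF resolvent_bounded_linear] tendsto_intros assms) simp
  moreover have "resolvent 1 (T (x n) + 1 *\<^sub>R x n) = x n" for n by (rule resolvent_unique) (use assms(1) in auto)
  ultimately have "y = resolvent 1 (z + y)" using assms(2) LIMSEQ_unique by simp
  then show "y \<in> D" "T y = z" using resolvent_in_D[of 1 "z + y"] resolvent_eq[of 1 "z + y"] by auto
qed

text \<open>The Yosida approximation \<open>n T (T + n)^(-1)\<close>, in the form that shows its
  boundedness; \<open>Suc n\<close> keeps the resolvent parameter positive.\<close>

definition yosida :: "nat \<Rightarrow> 'a \<Rightarrow> 'a" where
  "yosida n y = real (Suc n) *\<^sub>R (y - real (Suc n) *\<^sub>R resolvent (real (Suc n)) y)"

lemma yosida_eq: "yosida n y = real (Suc n) *\<^sub>R T (resolvent (real (Suc n)) y)"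
  using resolvent_eq[of "real (Suc n)" y] unfolding yosida_def by (metis add_diff_cancel_right' of_nat_0_less_iff zero_less_Suc)

lemma yosida_monotone: "bounded_monotone b c (yosida n)"
proof (intro bounded_monotone.intro coercive_form_axioms bounded_monotone_axioms.intro)
  let ?l = "real (Suc n)"
  have l: "?l > 0" by simp
  show "bounded_linear (yosida n)" unfolding yosida_def
    by (intro bounded_linear_compose[OF bounded_linear_scaleR_right] bounded_linear_sub
        bounded_linear_ident bounded_linear_compose[OF bounded_linear_scaleR_right resolvent_bounded_linear] l)
  fix y
  \<comment> \<open>Writing \<open>y\<close> as \<open>T + l\<close> applied to its resolvent turns
    the pairing into a sum of two visibly nonnegative terms.\<close>
  have "b (yosida n y) (T (resolvent ?l y) + ?l *\<^sub>R resolvent ?l y) = ?l * (b (T (resolvent ?l y)) (T (resolvent ?l y)) + ?l * b (T (resolvent ?l y)) (resolvent ?l y))"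
    unfolding yosida_eq by (simp add: b.scaleR_left b.scaleR_right b.add_right distrib_left del: of_nat_Suc)
  also have "\<dots> \<ge> 0" using nonneg T_nonneg[OF resolvent_in_D[OF l]] by (intro mult_nonneg_nonneg add_nonneg_nonneg) auto
  finally show "0 \<le> b (yosida n y) y" unfolding resolvent_eq[OF l] .
qed

sublocale yosida: bounded_monotone b c "yosida n" for n by (rule yosida_monotone)

lemma yosida_sym: "b (yosida n x) y = b x (yosida n y)"
  unfolding yosida_def by (simp add: b.scaleR_left b.scaleR_right b.diff_left b.diff_right resolvent_sym)

lemma yosida_commute: "yosida n (yosida m x) = yosida m (yosida n x)"
proof -
  interpret Rn: bounded_linear "resolvent (real (Suc n))" by (rule resolvent_bounded_linear) simp
  interpret Rm: bounded_linear "resolvent (real (Suc m))" by (rule resolvent_bounded_linear) simp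
  show ?thesis
    unfolding yosida_def Rn.scaleR Rm.scaleR Rn.diff Rm.diff resolvent_commute[of "real (Suc n)" "real (Suc m)", simplified]
    by (simp add: algebra_simps resolvent_commute)
qed

lemma resolvent_on_D:
  assumes f: "f \<in> D" and l: "0 < l"
  shows "f - l *\<^sub>R resolvent l f = resolvent l (T f)"
proof -
  interpret resolvent: bounded_linear "resolvent l" by (rule resolvent_bounded_linear[OF l])
  have "resolvent l (T f + l *\<^sub>R f) = f" by (rule resolvent_unique[OF l f refl])
  then show ?thesis by (simp only: resolvent.add resolvent.scaleR) (metis add_diff_cancel_right')
qed

lemma yosida_on_D: "f \<in> D \<Longrightarrow> yosida n f = real (Suc n) *\<^sub>R resolvent (real (Suc n)) (T f)"
  unfolding yosida_def by (simp only: resolvent_on_D of_nat_0_less_iff zero_less_Suc)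

text \<open>Equivalence of \<open>b\<close> with the square of the norm: one constant
  \<open>M\<close> converts every \<open>b\<close>-contraction into a norm bound, which is needed
  uniformly in \<open>n\<close> and \<open>t\<close>.\<close>

lemma uniform_bound:
  obtains M where "M > 0" "\<And>F x. b (F x) (F x) \<le> b x x \<Longrightarrow> norm (F x :: 'a) \<le> M * norm x"
proof -
  obtain K where K: "K > 0" "\<And>x. b x x \<le> K * (norm x)\<^sup>2" using upper by blast
  have "norm (F x) \<le> sqrt (K / c) * norm x" if "b (F x) (F x) \<le> b x x" for F :: "'a \<Rightarrow> 'a" and x
  proof (rule power2_le_imp_le)
    have "(norm (F x))\<^sup>2 \<le> b (F x) (F x) / c" by (rule norm_sq_le)
    also have "\<dots> \<le> K * (norm x)\<^sup>2 / c" using K(2)[of x] that c_pos by (intro divide_right_mono) auto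
    finally show "(norm (F x))\<^sup>2 \<le> (sqrt (K / c) * norm x)\<^sup>2" using K c_pos by (simp add: power_mult_distrib)
  qed (use K c_pos in auto)
  moreover have "sqrt (K / c) > 0" using K c_pos by simp
  ultimately show thesis using that by blast
qed

lemma dense_approx: "e > 0 \<Longrightarrow> \<exists>g\<in>D. norm (f - g) < e"
  using D_dense closure_approachable[of f D] by (metis UNIV_I dist_norm norm_minus_commute)

text \<open>On the domain the error is the resolvent of \<open>T f\<close>, of order
  \<open>1 / n\<close>. The maps are uniformly bounded, so density of \<open>D\<close> carries the
  limit over to all vectors.\<close>

lemma resolvent_tendsto_id: "(\<lambda>n. real (Suc n) *\<^sub>R resolvent (real (Suc n)) g) \<longlonglongrightarrow> g"
proof -
  let ?J = "\<lambda>n g. real (Suc n) *\<^sub>R resolvent (real (Suc n)) g"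
  obtain M where M: "M > 0" "\<And>F x. b (F x) (F x) \<le> b x x \<Longrightarrow> norm (F x :: 'a) \<le> M * norm x"
    using uniform_bound by blast
  have J: "norm (?J n x) \<le> M * norm x" for n x
    using M(2)[of "?J n" x] resolvent_contraction[of "real (Suc n)" x] by simp
  have D: "(\<lambda>n. ?J n f - f) \<longlonglongrightarrow> 0" if "f \<in> D" for f
  proof (rule Lim_null_comparison)
    have "?J n f - f = - resolvent (real (Suc n)) (T f)" for n
      using resolvent_on_D[OF that, of "real (Suc n)"] by (metis minus_diff_eq of_nat_0_less_iff zero_less_Suc)
    moreover have "norm (resolvent (real (Suc n)) (T f)) \<le> M * norm (T f) * (1 / real (Suc n))" for n
    proof -
      have "real (Suc n) * norm (resolvent (real (Suc n)) (T f)) \<le> M * norm (T f)"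
        using J[of n "T f"] by (simp del: of_nat_Suc)
      then show ?thesis by (simp add: field_simps del: of_nat_Suc)
    qed
    ultimately show "\<forall>\<^sub>F n in sequentially. norm (?J n f - f) \<le> M * norm (T f) * (1 / real (Suc n))"
      by (simp only: norm_minus_cancel eventually_True simp_thms)
    show "(\<lambda>n. M * norm (T f) * (1 / real (Suc n))) \<longlonglongrightarrow> 0"
      by (rule tendsto_mult_right_zero) (rule LIMSEQ_Suc[OF lim_1_over_n])
  qed
  show ?thesis
  proof (rule metric_LIMSEQ_I)
    fix e :: real assume e: "e > 0"
    obtain f where f: "f \<in> D" "norm (g - f) < e / (2 * (M + 1))"
      using dense_approx[of "e / (2 * (M + 1))" g] e M by auto
    obtain N where N: "\<And>n. n \<ge> N \<Longrightarrow> norm (?J n f - f) < e / 2"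
      using metric_LIMSEQ_D[OF D[OF f(1)], of "e / 2"] e by (auto simp: dist_norm)
    have "dist (?J n g) g < e" if "n \<ge> N" for n
    proof -
      interpret resolvent: bounded_linear "resolvent (real (Suc n))" by (rule resolvent_bounded_linear) simp
      have "?J n (g - f) = ?J n g - ?J n f" by (simp only: resolvent.diff scaleR_diff_right)
      then have "?J n g - g = ?J n (g - f) + (?J n f - f) - (g - f)" by (simp del: of_nat_Suc)
      then have "norm (?J n g - g) \<le> norm (?J n (g - f) + (?J n f - f)) + norm (g - f)"
        by (simp only: norm_triangle_ineq4)
      also have "\<dots> \<le> norm (?J n (g - f)) + norm (?J n f - f) + norm (g - f)"
        by (intro add_right_mono norm_triangle_ineq)
      also have "\<dots> < M * norm (g - f) + e / 2 + norm (g - f)" using J[of n "g - f"] N[OF that] by linarith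
      also have "\<dots> = (M + 1) * norm (g - f) + e / 2" by (simp add: algebra_simps)
      also have "\<dots> < e" using f(2) M by (simp add: field_simps)
      finally show ?thesis by (simp add: dist_norm)
    qed
    then show "\<exists>N. \<forall>n\<ge>N. dist (?J n g) g < e" by blast
  qed
qed

lemma yosida_tendsto_T: "f \<in> D \<Longrightarrow> (\<lambda>n. yosida n f) \<longlonglongrightarrow> T f"
  using resolvent_tendsto_id[of "T f"] by (simp add: yosida_on_D)

abbreviation P :: "nat \<Rightarrow> real \<Rightarrow> 'a \<Rightarrow> 'a" where "P n \<equiv> evolution (yosida n)"

lemma P_bounded:
  obtains M where "M > 0" "\<And>n t x. 0 \<le> t \<Longrightarrow> norm (P n t x) \<le> M * norm x"
proof -
  obtain M where M: "M > 0" "\<And>F x. b (F x) (F x) \<le> b x x \<Longrightarrow> norm (F x :: 'a) \<le> M * norm x"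
    using uniform_bound by blast
  show thesis
  proof (rule that[OF M(1)])
    show "norm (P n t x) \<le> M * norm x" if "0 \<le> t" for n t x
      using M(2)[of "P n t" x] yosida.evolution_contraction[OF that] by simp
  qed
qed

text \<open>The difference of two flows solves the equation of the first one with the forcing term
  \<open>?g\<close>. Since the approximations commute, \<open>?g\<close> is the second flow applied
  to \<open>yosida n f - yosida m f\<close>; it therefore never exceeds its initial size, and the
  growth estimate applies.\<close>

lemma P_difference:
  assumes "0 \<le> t"
  shows "b (P n t f - P m t f) (P n t f - P m t f) \<le> exp t * (t * b (yosida n f - yosida m f) (yosida n f - yosida m f))"
proof (rule energy_growth[OF assms])
  let ?w = "\<lambda>t. P n t f - P m t f"
  show "continuous_on {0..t} ?w" by (intro continuous_on_diff yosida.evolution_continuous)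
  show "?w 0 = 0" by simp
  show "0 \<le> b (yosida n f - yosida m f) (yosida n f - yosida m f)" by (rule nonneg)
  fix s assume s: "0 < s" "s < t"
  let ?g = "yosida n (P m s f) - yosida m (P m s f)"
  have "bounded_linear (\<lambda>x. yosida n x - yosida m x)" by (intro bounded_linear_sub yosida.A_bounded_linear)
  from yosida.evolution_commute[OF this, of m s f]
  have "?g = P m s (yosida n f - yosida m f)" using s by (simp add: yosida.A.diff yosida_commute[of n m])
  then have g: "b ?g ?g \<le> b (yosida n f - yosida m f) (yosida n f - yosida m f)" using yosida.evolution_contraction s by simp
  have "(?w has_vector_derivative (- yosida n (P n s f)) - (- yosida m (P m s f))) (at s)"
    by (intro has_vector_derivative_diff yosida.evolution_derivative)
  also have "(- yosida n (P n s f)) - (- yosida m (P m s f)) = - yosida n (?w s) - ?g" by (simp add: yosida.A.diff)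
  finally have "(?w has_vector_derivative - yosida n (?w s) - ?g) (at s)" .
  moreover have "2 * b (- yosida n (?w s) - ?g) (?w s) \<le> b (?w s) (?w s) + b (yosida n f - yosida m f) (yosida n f - yosida m f)"
    using yosida.A_nonneg[of n "?w s"] two_b_le[of "- ?g" "?w s"] g
    by (simp only: b.diff_left b.minus_left b.minus_right) argo
  ultimately show "(?w has_vector_derivative - yosida n (?w s) - ?g) (at s) \<and>
      2 * b (- yosida n (?w s) - ?g) (?w s) \<le> b (?w s) (?w s) + b (yosida n f - yosida m f) (yosida n f - yosida m f)" by blast
qed

text \<open>For \<open>f\<close> in \<open>D\<close> the bound of \<open>P_difference\<close> tends
  to zero because \<open>yosida n f\<close> converges. For general \<open>f\<close> an approximation
  from \<open>D\<close> is used, with an error uniform in \<open>n\<close> and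
  \<open>t\<close>.\<close>

lemma P_uniformly_Cauchy: "uniformly_Cauchy_on {0..a} (\<lambda>n t. P n t f)"
proof -
  obtain K where K: "K > 0" "\<And>x. b x x \<le> K * (norm x)\<^sup>2" using upper by blast
  obtain M where M: "M > 0" and PM: "\<And>n t x. 0 \<le> t \<Longrightarrow> norm (P n t x) \<le> M * norm x"
    using P_bounded by blast
  have D: "uniformly_Cauchy_on {0..a} (\<lambda>n t. P n t f)" if f: "f \<in> D" for f
  proof (cases "a \<ge> 0")
    case a: True
    define B0 where "B0 = exp a * (a * K) / c"
    have B0: "0 \<le> B0" unfolding B0_def using a K(1) c_pos by simp
    define B where "B = sqrt B0 + 1"
    have B: "B > 0" unfolding B_def using B0 by (intro add_nonneg_pos) auto
    have est: "norm (P n t f - P m t f) \<le> B * norm (yosida n f - yosida m f)" if t: "t \<in> {0..a}" for n m t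
    proof -
      have "(norm (P n t f - P m t f))\<^sup>2 \<le> b (P n t f - P m t f) (P n t f - P m t f) / c" by (rule norm_sq_le)
      also have "\<dots> \<le> exp t * (t * b (yosida n f - yosida m f) (yosida n f - yosida m f)) / c"
        using P_difference[of t n f m] t c_pos by (intro divide_right_mono) auto
      also have "\<dots> \<le> exp a * (a * (K * (norm (yosida n f - yosida m f))\<^sup>2)) / c"
      proof (intro divide_right_mono mult_mono)
        show "b (yosida n f - yosida m f) (yosida n f - yosida m f) \<le> K * (norm (yosida n f - yosida m f))\<^sup>2" by (rule K)
      qed (use t c_pos a nonneg in \<open>auto intro: mult_nonneg_nonneg\<close>)
      also have "\<dots> = B0 * (norm (yosida n f - yosida m f))\<^sup>2" by (simp add: B0_def)
      also have "\<dots> = (sqrt B0 * norm (yosida n f - yosida m f))\<^sup>2"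
        unfolding power_mult_distrib real_sqrt_pow2[OF B0] ..
      finally have "norm (P n t f - P m t f) \<le> sqrt B0 * norm (yosida n f - yosida m f)"
        by (rule power2_le_imp_le) (simp add: B0)
      also have "\<dots> \<le> B * norm (yosida n f - yosida m f)" by (intro mult_right_mono) (auto simp: B_def)
      finally show ?thesis .
    qed
    show ?thesis unfolding uniformly_Cauchy_on_def
    proof (intro allI impI)
      fix e :: real assume "e > 0"
      then obtain N where N: "\<And>m n. m \<ge> N \<Longrightarrow> n \<ge> N \<Longrightarrow> norm (yosida m f - yosida n f) < e / B"
        using metric_CauchyD[OF LIMSEQ_imp_Cauchy[OF yosida_tendsto_T[OF f]], of "e / B"] B by (auto simp: dist_norm)
      have "dist (P m t f) (P n t f) < e" if "t \<in> {0..a}" "m \<ge> N" "n \<ge> N" for m n t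
      proof -
        have "B * norm (yosida m f - yosida n f) < e" using N[OF that(2,3)] B by (simp add: field_simps)
        then show ?thesis using est[OF that(1), of m n] by (simp add: dist_norm)
      qed
      then show "\<exists>N. \<forall>t\<in>{0..a}. \<forall>m\<ge>N. \<forall>n\<ge>N. dist (P m t f) (P n t f) < e" by blast
    qed
  qed (auto simp: uniformly_Cauchy_on_def)
  show ?thesis unfolding uniformly_Cauchy_on_def
  proof (intro allI impI)
    fix e :: real assume e: "e > 0"
    obtain g where g: "g \<in> D" "norm (f - g) < e / (4 * M)"
      using dense_approx[of "e / (4 * M)" f] e M by auto
    obtain N where N: "\<And>t m n. t \<in> {0..a} \<Longrightarrow> m \<ge> N \<Longrightarrow> n \<ge> N \<Longrightarrow> dist (P m t g) (P n t g) < e / 2"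
      using D[OF g(1)] e unfolding uniformly_Cauchy_on_def by (meson half_gt_zero)
    have "dist (P m t f) (P n t f) < e" if t: "t \<in> {0..a}" "m \<ge> N" "n \<ge> N" for m n t
    proof -
      have Pd: "norm (P k t f - P k t g) < e / 4" for k
      proof -
        have "norm (P k t f - P k t g) \<le> M * norm (f - g)"
          using PM[of t k "f - g"] t yosida.evolution_diff[of t k f g] by simp
        also have "\<dots> < e / 4" using g(2) M by (simp add: field_simps)
        finally show ?thesis .
      qed
      have "dist (P m t f) (P n t f) \<le> dist (P m t f) (P m t g) + dist (P m t g) (P n t g) + dist (P n t g) (P n t f)"
        by metric
      also have "\<dots> < e / 4 + e / 2 + e / 4"
        using Pd[of m] Pd[of n] N[OF t] by (simp add: dist_norm norm_minus_commute[of "P n t g"])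
      finally show ?thesis by simp
    qed
    then show "\<exists>N. \<forall>t\<in>{0..a}. \<forall>m\<ge>N. \<forall>n\<ge>N. dist (P m t f) (P n t f) < e" by blast
  qed
qed

section \<open>The limit semigroup, its smoothing property and its generator\<close>

definition S :: "real \<Rightarrow> 'a \<Rightarrow> 'a" where "S t f = lim (\<lambda>n. P n t f)"

lemma S_uniform_limit: "uniform_limit {0..a} (\<lambda>n t. P n t f) (\<lambda>t. S t f) sequentially"
proof -
  have "uniformly_convergent_on {0..a} (\<lambda>n t. P n t f)"
    by (rule Cauchy_uniformly_convergent[OF P_uniformly_Cauchy])
  then obtain l where l: "uniform_limit {0..a} (\<lambda>n t. P n t f) l sequentially"
    unfolding uniformly_convergent_on_def by blast
  have "S t f = l t" if "t \<in> {0..a}" for t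
    unfolding S_def by (rule limI[OF tendsto_uniform_limitI[OF l that]])
  then show ?thesis
    using uniform_limit_cong'[of "{0..a}" "\<lambda>n t. P n t f" "\<lambda>n t. P n t f" "\<lambda>t. S t f" l sequentially] l by simp
qed

lemma S_limit: "0 \<le> t \<Longrightarrow> (\<lambda>n. P n t f) \<longlonglongrightarrow> S t f"
  using tendsto_uniform_limitI[OF S_uniform_limit[where a = t and f = f], of t] by simp

lemma S_0 [simp]: "S 0 f = f"
proof -
  have "(\<lambda>n. P n 0 f) \<longlonglongrightarrow> S 0 f" by (rule S_limit) simp
  then show ?thesis by (simp add: LIMSEQ_const_iff)
qed

lemma S_add: assumes t: "0 \<le> t" shows "S t (f + g) = S t f + S t g"
proof (rule LIMSEQ_unique[OF S_limit[OF t]])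
  show "(\<lambda>n. P n t (f + g)) \<longlonglongrightarrow> S t f + S t g"
    unfolding yosida.evolution_add[OF t] by (intro tendsto_add S_limit t)
qed

lemma S_scaleR: assumes t: "0 \<le> t" shows "S t (r *\<^sub>R f) = r *\<^sub>R S t f"
proof (rule LIMSEQ_unique[OF S_limit[OF t]])
  show "(\<lambda>n. P n t (r *\<^sub>R f)) \<longlonglongrightarrow> r *\<^sub>R S t f"
    unfolding yosida.evolution_scaleR[OF t] by (intro tendsto_scaleR tendsto_const S_limit t)
qed

lemma S_contraction: assumes t: "0 \<le> t" shows "b (S t f) (S t f) \<le> b f f"
proof (rule tendsto_upperbound)
  note lim = S_limit[OF t, of f]
  show "(\<lambda>n. b (P n t f) (P n t f)) \<longlonglongrightarrow> b (S t f) (S t f)"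
    by (rule b.tendsto[OF lim lim])
  show "\<forall>\<^sub>F n in sequentially. b (P n t f) (P n t f) \<le> b f f"
    by (rule always_eventually, rule allI, rule yosida.evolution_contraction[OF t])
qed simp

lemma S_bounded: obtains M where "M > 0" "\<And>t f. 0 \<le> t \<Longrightarrow> norm (S t f) \<le> M * norm f"
proof -
  obtain M where M: "M > 0" "\<And>F x. b (F x) (F x) \<le> b x x \<Longrightarrow> norm (F x :: 'a) \<le> M * norm x"
    using uniform_bound by blast
  show thesis
  proof (rule that[OF M(1)])
    show "norm (S t f) \<le> M * norm f" if "0 \<le> t" for t f
      using M(2)[of "S t" f] S_contraction[OF that] by simp
  qed
qed

lemma S_bounded_linear: assumes "0 \<le> t" shows "bounded_linear (S t)"
proof -
  obtain M where "M > 0" "\<And>t f. 0 \<le> t \<Longrightarrow> norm (S t f) \<le> M * norm f" using S_bounded by blast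
  then show ?thesis using assms
    by (intro bounded_linear_intro[where K = M]) (auto simp: S_add S_scaleR mult.commute)
qed

lemma S_continuous: "continuous_on {0..} (\<lambda>t. S t f)"
proof -
  have "continuous_on {0..<a} (\<lambda>t. S t f)" for a
    by (rule continuous_on_subset[OF uniform_limit_theorem[OF _ S_uniform_limit[where a = a]]])
       (auto intro!: always_eventually yosida.evolution_continuous)
  then show ?thesis
    unfolding continuous_on_eq_continuous_within
  proof (intro ballI)
    fix t :: real assume t: "t \<in> {0..}" and *: "\<And>a. \<forall>x\<in>{0..<a}. continuous (at x within {0..<a}) (\<lambda>t. S t f)"
    have "at t within {0..} = at t within {0..<t + 1}"
      using t by (intro at_within_nhd[of t "{..<t + 1}"]) auto
    then show "continuous (at t within {0..}) (\<lambda>t. S t f)" using *[of "t + 1"] t by auto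
  qed
qed

lemma S_uniform_limit_yosida:
  assumes f: "f \<in> D"
  shows "uniform_limit {0..a} (\<lambda>n t. yosida n (P n t f)) (\<lambda>t. S t (T f)) sequentially"
proof (rule uniform_limitI)
  fix e :: real assume e: "e > 0"
  obtain M where M: "M > 0" and PM: "\<And>n t x. 0 \<le> t \<Longrightarrow> norm (P n t x) \<le> M * norm x"
    using P_bounded by blast
  have "\<forall>\<^sub>F n in sequentially. dist (yosida n f) (T f) < e / (2 * M)"
    using tendstoD[OF yosida_tendsto_T[OF f]] e M by simp
  moreover have "\<forall>\<^sub>F n in sequentially. \<forall>t\<in>{0..a}. dist (P n t (T f)) (S t (T f)) < e / 2"
    using uniform_limitD[OF S_uniform_limit] e by (meson half_gt_zero)
  ultimately show "\<forall>\<^sub>F n in sequentially. \<forall>t\<in>{0..a}. dist (yosida n (P n t f)) (S t (T f)) < e"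
  proof (eventually_elim, intro ballI)
    fix n t assume n: "dist (yosida n f) (T f) < e / (2 * M)" "\<forall>t\<in>{0..a}. dist (P n t (T f)) (S t (T f)) < e / 2"
      and t: "t \<in> {0..a}"
    have "dist (P n t (yosida n f)) (P n t (T f)) \<le> M * dist (yosida n f) (T f)"
      using PM[of t n "yosida n f - T f"] t yosida.evolution_diff[of t n "yosida n f" "T f"] by (simp add: dist_norm)
    also have "\<dots> < e / 2" using n(1) M by (simp add: field_simps)
    finally have "dist (P n t (yosida n f)) (S t (T f)) < e / 2 + e / 2"
      using n(2) t by (smt (verit) dist_triangle)
    then show "dist (yosida n (P n t f)) (S t (T f)) < e"
      using yosida.evolution_commute[OF yosida.A_bounded_linear, of n n t f] t by simp
  qed
qed

lemma S_D:
  assumes f: "f \<in> D" and t: "0 \<le> t" shows "S t f \<in> D" "T (S t f) = S t (T f)"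
    "(\<lambda>n. yosida n (P n t f)) \<longlonglongrightarrow> S t (T f)"
proof -
  show lim: "(\<lambda>n. yosida n (P n t f)) \<longlonglongrightarrow> S t (T f)"
    using tendsto_uniform_limitI[OF S_uniform_limit_yosida[OF f, of t], of t] t by simp
  \<comment> \<open>The flow \<open>P n t f\<close> itself need not lie in \<open>D\<close>. Its
    images under \<open>?J n\<close> do, they have the same limit, and \<open>T\<close> maps them to
    \<open>yosida n (P n t f)\<close>; closedness of \<open>T\<close> then concludes.\<close>
  let ?J = "\<lambda>n g. real (Suc n) *\<^sub>R resolvent (real (Suc n)) g"
  have "(\<lambda>n. ?J n (P n t f)) \<longlonglongrightarrow> S t f"
  proof -
    obtain M where M: "M > 0" "\<And>F x. b (F x) (F x) \<le> b x x \<Longrightarrow> norm (F x :: 'a) \<le> M * norm x"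
      using uniform_bound by blast
    have J: "norm (?J n x) \<le> M * norm x" for n x
      using M(2)[of "?J n" x] resolvent_contraction[of "real (Suc n)" x] by simp
    have "(\<lambda>n. ?J n (P n t f - S t f)) \<longlonglongrightarrow> 0"
    proof (rule Lim_null_comparison)
      show "(\<lambda>n. M * norm (P n t f - S t f)) \<longlonglongrightarrow> 0"
        by (intro tendsto_mult_right_zero tendsto_norm_zero LIM_zero S_limit t)
    qed (use J in auto)
    from tendsto_add[OF this resolvent_tendsto_id[of "S t f"]]
    have "(\<lambda>n. ?J n (P n t f - S t f) + ?J n (S t f)) \<longlonglongrightarrow> S t f" by (simp only: add_0)
    moreover have "?J n (P n t f - S t f) + ?J n (S t f) = ?J n (P n t f)" for n
    proof -
      interpret resolvent: bounded_linear "resolvent (real (Suc n))" by (rule resolvent_bounded_linear) simp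
      show ?thesis by (simp only: resolvent.diff scaleR_diff_right diff_add_cancel)
    qed
    ultimately show ?thesis by simp
  qed
  moreover have "T (?J n (P n t f)) = yosida n (P n t f)" for n
    using resolvent_in_D[of "real (Suc n)"] by (simp only: yosida_eq) (subst T_scaleR, auto)
  ultimately show "S t f \<in> D" "T (S t f) = S t (T f)"
    using T_closed[of "\<lambda>n. ?J n (P n t f)" "S t f" "S t (T f)"] lim resolvent_in_D D_closed by auto
qed

lemma S_derivative_D:
  assumes f: "f \<in> D" and t: "0 \<le> t"
  shows "((\<lambda>t. S t f) has_vector_derivative - T (S t f)) (at t within {0..})"
proof -
  have "((\<lambda>t. S t f) has_vector_derivative - S t (T f)) (at t within {0..t+1})"
    by (rule has_vector_derivative_uniform_limit[of "{0..t+1}" "\<lambda>n t. P n t f" "\<lambda>n t. - yosida n (P n t f)"])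
       (use t in \<open>auto intro!: uniform_limit_uminus S_uniform_limit_yosida[OF f] S_limit has_vector_derivative_at_within yosida.evolution_derivative\<close>)
  moreover have "at t within {0..} = at t within {0..t+1}"
    using t by (intro at_within_nhd[of t "{..<t + 1}"]) auto
  ultimately show ?thesis using S_D[OF f t] by simp
qed

lemma ode_difference_zero:
  assumes a: "0 \<le> a" and u: "continuous_on {0..a} u" "u 0 = 0"
    and "\<And>t. 0 < t \<Longrightarrow> t < a \<Longrightarrow> u t \<in> D \<and> (u has_vector_derivative - T (u t)) (at t)"
  shows "u a = 0"
proof -
  have "b (u a) (u a) \<le> b (u 0) (u 0)"
    by (rule energy_decreasing[OF a u(1), of "\<lambda>t. - T (u t)"]) (use assms(4) T_nonneg in \<open>auto simp: b.minus_left\<close>)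
  then show ?thesis using zero_if_nonpos u(2) by (simp add: b.zero_left)
qed

lemma linear_eq_on_D:
  assumes "bounded_linear F" "bounded_linear G" "\<And>x. x \<in> D \<Longrightarrow> F x = (G x :: 'a)"
  shows "F x = G x"
proof -
  have "closed {x. F x = G x}"
    using assms(1,2) by (intro closed_Collect_eq) (auto simp: linear_continuous_on)
  then have "closure D \<subseteq> {x. F x = G x}" by (intro closure_minimal) (use assms(3) in auto)
  then show ?thesis using D_dense by auto
qed

lemma S_derivative_D_at:
  assumes f: "f \<in> D" and t: "0 < t"
  shows "((\<lambda>t. S t f) has_vector_derivative - T (S t f)) (at t)"
  using S_derivative_D[OF f, of t] t at_within_interior[of t "{0..}"] by (simp add: interior_Ici)

lemma S_semigroup:
  assumes s: "0 \<le> s" and t: "0 \<le> t" shows "S (s + t) f = S s (S t f)"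
proof (rule linear_eq_on_D[where F = "S (s + t)" and G = "\<lambda>f. S s (S t f)"])
  show "bounded_linear (S (s + t))" "bounded_linear (\<lambda>f. S s (S t f))"
    using s t by (auto intro!: S_bounded_linear bounded_linear_compose[of "S s" "S t"])
  fix f assume f: "f \<in> D"
  let ?u = "\<lambda>r. S (r + t) f - S r (S t f)"
  have "?u s = 0"
  proof (rule ode_difference_zero[OF s])
    show "continuous_on {0..s} ?u"
      using t by (intro continuous_on_diff continuous_on_compose2[OF S_continuous] continuous_intros) auto
    show "?u 0 = 0" by simp
    fix r assume r: "0 < r" "r < s"
    have rt: "S (r + t) f \<in> D" "S r (S t f) \<in> D" using r t f S_D by simp_all
    have "((\<lambda>r. S (r + t) f) has_vector_derivative - T (S (r + t) f)) (at r)"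
      using has_vector_derivative_affine[OF S_derivative_D_at[OF f], of 1 r t] r t by simp
    from has_vector_derivative_diff[OF this S_derivative_D_at[OF S_D(1)[OF f t] r(1)]]
    show "?u r \<in> D \<and> (?u has_vector_derivative - T (?u r)) (at r)"
      using rt by (simp add: D_closed T_diff)
  qed
  then show "S (s + t) f = S s (S t f)" by simp
qed

text \<open>The estimate for the bounded approximations survives the limit and bounds
  \<open>T (S t g)\<close> by a multiple of \<open>norm g\<close> for \<open>g\<close> in
  \<open>D\<close>, with a factor that depends on \<open>t\<close> only. Closedness of
  \<open>T\<close> extends this to every vector. It is the reason why arbitrary boundary data yield
  solutions with values in the domain.\<close>

lemma S_smoothing: assumes t: "0 < t" shows "S t f \<in> D"
proof -
  have est: "t\<^sup>2 * b (T (S t g)) (T (S t g)) \<le> b g g / 2" if g: "g \<in> D" for g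
  proof (rule LIMSEQ_le_const2)
    show "(\<lambda>n. t\<^sup>2 * b (yosida n (P n t g)) (yosida n (P n t g))) \<longlonglongrightarrow> t\<^sup>2 * b (T (S t g)) (T (S t g))"
      using t S_D[OF g, of t] by (intro tendsto_intros b.tendsto) auto
  qed (use yosida.evolution_smoothing[OF yosida_sym, of t] t in auto)
  obtain K where K: "K > 0" "\<And>x. b x x \<le> K * (norm x)\<^sup>2" using upper by blast
  define B where "B = sqrt (K / (2 * t\<^sup>2 * c))"
  have B: "B > 0" using K t c_pos by (simp add: B_def)
  have TB: "norm (T (S t g)) \<le> B * norm g" if g: "g \<in> D" for g
  proof (rule power2_le_imp_le)
    have "(norm (T (S t g)))\<^sup>2 \<le> b (T (S t g)) (T (S t g)) / c" by (rule norm_sq_le)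
    also have "\<dots> \<le> (b g g / (2 * t\<^sup>2)) / c"
      using est[OF g] t c_pos by (intro divide_right_mono) (auto simp: field_simps)
    also have "\<dots> \<le> (K * (norm g)\<^sup>2 / (2 * t\<^sup>2)) / c" using K t c_pos by (intro divide_right_mono) auto
    finally show "(norm (T (S t g)))\<^sup>2 \<le> (B * norm g)\<^sup>2"
      using K t c_pos by (simp add: B_def power_mult_distrib)
  qed (use B in auto)
  obtain g where g: "\<And>n. g n \<in> D" "g \<longlonglongrightarrow> f"
    using D_dense closure_sequential[of f D] by auto
  have "Cauchy (\<lambda>n. T (S t (g n)))"
  proof (rule Cauchy_of_norm_estimate[OF LIMSEQ_imp_Cauchy[OF g(2)]])
    fix m n
    interpret St: bounded_linear "S t" using t by (intro S_bounded_linear) simp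
    have "T (S t (g m)) - T (S t (g n)) = T (S t (g m - g n))"
      using g(1) t S_D(1) by (simp add: St.diff T_diff)
    then show "norm (T (S t (g m)) - T (S t (g n))) \<le> B * norm (g m - g n)"
      using TB[of "g m - g n"] g(1) D_closed by simp
  qed
  then obtain z where z: "(\<lambda>n. T (S t (g n))) \<longlonglongrightarrow> z" using Cauchy_convergent_iff convergent_def by blast
  have "(\<lambda>n. S t (g n)) \<longlonglongrightarrow> S t f"
    using t by (intro bounded_linear.tendsto[OF S_bounded_linear g(2)]) simp
  then show ?thesis using T_closed(1)[OF _ _ z] S_D(1) g(1) t by simp
qed

lemma S_shift:
  assumes "0 < t" "t / 2 \<le> r"
  shows "S r f = S (r - t / 2) (S (t / 2) f)"
  using S_semigroup[of "r - t / 2" "t / 2" f] assms by simp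

text \<open>After time \<open>t / 2\<close> the orbit has entered \<open>D\<close>, where the
  derivative is known.\<close>

lemma S_derivative: assumes t: "0 < t"
  shows "((\<lambda>t. S t f) has_vector_derivative - T (S t f)) (at t)"
proof -
  let ?g = "S (t / 2) f"
  have g: "?g \<in> D" using S_smoothing t by simp
  have "((\<lambda>r. S (r - t / 2) ?g) has_vector_derivative - T (S (t - t / 2) ?g)) (at t)"
    using has_vector_derivative_affine[OF S_derivative_D_at[OF g], of 1 t "- t / 2"] t by simp
  then have "((\<lambda>r. S r f) has_vector_derivative - T (S (t - t / 2) ?g)) (at t)"
  proof (rule has_vector_derivative_transform_within_open[where S = "{t / 2<..}"])
    show "S (r - t / 2) ?g = S r f" if "r \<in> {t / 2<..}" for r
      using S_shift[OF t, of r f] that by simp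
  qed (use t in auto)
  moreover have "S (t - t / 2) ?g = S t f" using S_shift[OF t, of t f] t by simp
  ultimately show ?thesis by (simp only:)
qed

lemma T_S_continuous: "continuous_on {0<..} (\<lambda>t. T (S t f))"
proof (rule continuous_at_imp_continuous_on, rule ballI)
  fix t :: real assume "t \<in> {0<..}"
  then have t: "t > 0" by simp
  let ?g = "S (t / 2) f"
  have g: "?g \<in> D" using S_smoothing t by simp
  have eq: "T (S r f) = S (r - t / 2) (T ?g)" if "t / 2 < r" for r
    using S_shift[OF t, of r f] S_D(2)[OF g, of "r - t / 2"] that by simp
  have "continuous_on {t/2<..} (\<lambda>r. S (r - t / 2) (T ?g))"
    by (intro continuous_on_compose2[OF S_continuous] continuous_intros) auto
  then have "continuous_on {t/2<..} (\<lambda>r. T (S r f))"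
    by (subst continuous_on_cong[OF refl eq]) auto
  then show "isCont (\<lambda>t. T (S t f)) t" using t by (subst (asm) continuous_on_eq_continuous_at) auto
qed

lemma ode_unique:
  assumes a: "0 \<le> a" and u: "continuous_on {0..a} u"
    and du: "\<And>t. 0 < t \<Longrightarrow> t < a \<Longrightarrow> u t \<in> D \<and> (u has_vector_derivative - T (u t)) (at t)"
    and t: "t \<in> {0..a}"
  shows "u t = S t (u 0)"
proof -
  let ?w = "\<lambda>t. u t - S t (u 0)"
  have "?w t = 0"
  proof (rule ode_difference_zero[of t ?w])
    show "continuous_on {0..t} ?w"
      using t by (intro continuous_on_diff continuous_on_subset[OF u] continuous_on_subset[OF S_continuous]) auto
    show "?w r \<in> D \<and> (?w has_vector_derivative - T (?w r)) (at r)" if "0 < r" "r < t" for r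
    proof -
      have r: "u r \<in> D" "(u has_vector_derivative - T (u r)) (at r)" using du[of r] that t by auto
      show ?thesis using has_vector_derivative_diff[OF r(2) S_derivative[OF that(1)], of "u 0"]
        r S_smoothing[OF that(1)] by (simp add: D_closed T_diff)
    qed
  qed (use t in auto)
  then show ?thesis by simp
qed

text \<open>The orbit transported by \<open>Q\<close> solves the same equation, so uniqueness
  applies. The lemma is used with \<open>Q\<close> a complex scalar, the symmetry \<open>U\<close>,
  a reducing projection, and a competing semigroup.\<close>

lemma S_commute:
  assumes Q: "bounded_linear Q" "\<And>x. x \<in> D \<Longrightarrow> Q x \<in> D" "\<And>x. x \<in> D \<Longrightarrow> T (Q x) = Q (T x)"
    and t: "0 \<le> t"
  shows "Q (S t f) = S t (Q f)"
proof -
  interpret Q: bounded_linear Q by fact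
  have "Q (S t f) = S t (Q (S 0 f))"
  proof (rule ode_unique[where a = t])
    show "continuous_on {0..t} (\<lambda>t. Q (S t f))"
      by (intro Q.continuous_on continuous_on_subset[OF S_continuous]) auto
    show "Q (S r f) \<in> D \<and> ((\<lambda>t. Q (S t f)) has_vector_derivative - T (Q (S r f))) (at r)" if "0 < r" for r
      using Q.has_vector_derivative[OF S_derivative[OF that, of f]] S_smoothing[OF that, of f] Q by (simp add: Q.neg)
  qed (use t in auto)
  then show ?thesis by simp
qed

text \<open>The function \<open>?\<phi>\<close> interpolates between the two sides and has zero
  derivative, by symmetry of \<open>T\<close>.\<close>

lemma S_sym: assumes t: "0 \<le> t" shows "b (S t f) g = b f (S t g)"
proof (cases "t = 0")
  case False
  let ?\<phi> = "\<lambda>s. b (S s f) (S (t - s) g)"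
  have "?\<phi> t = ?\<phi> 0"
  proof (rule DERIV_isconst_end[of 0 t ?\<phi>])
    show "0 < t" using t False by simp
    show "continuous_on {0..t} ?\<phi>"
      by (intro b.continuous_on continuous_on_compose2[OF S_continuous] continuous_intros) auto
    fix s assume s: "0 < s" "s < t"
    have "((\<lambda>s. S (t - s) g) has_vector_derivative (- 1) *\<^sub>R (- T (S (t - s) g))) (at s)"
      using has_vector_derivative_affine[OF S_derivative, of "- 1" s t g] s by simp
    from b.has_vector_derivative[OF S_derivative[OF s(1), of f] this]
    show "(?\<phi> has_real_derivative 0) (at s)"
      using s by (simp add: has_real_derivative_iff_has_vector_derivative b.minus_left T_sym S_smoothing)
  qed
  then show ?thesis by simp
qed simp

lemma S_generator:
  "((\<lambda>h. (1 / h) *\<^sub>R (S h f - f)) \<longlongrightarrow> g) (at_right 0) \<longleftrightarrow> f \<in> D \<and> g = - T f"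
proof -
  have deriv: "((\<lambda>h. (1 / h) *\<^sub>R (S h f - f)) \<longlongrightarrow> - T f) (at_right 0)" if f: "f \<in> D" for f
  proof -
    have *: "((\<lambda>t. S t f) has_vector_derivative - T f) (at 0 within {0<..})"
      using S_derivative_D[OF f, of 0] by (auto intro: has_vector_derivative_within_subset)
    then show ?thesis
      unfolding has_vector_derivative_def has_derivative_iff_norm
    proof (elim conjE)
      assume "((\<lambda>y. norm (S y f - S 0 f - (y - 0) *\<^sub>R - T f) / norm (y - 0)) \<longlongrightarrow> 0) (at_right 0)"
      then have "((\<lambda>h. (1 / h) *\<^sub>R (S h f - f) - - T f) \<longlongrightarrow> 0) (at_right 0)"
      proof (rule Lim_null_comparison[rotated])
        have "\<forall>\<^sub>F h in at_right (0::real). h > 0" by (rule eventually_at_right_less)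
        then show "\<forall>\<^sub>F h in at_right 0. norm ((1 / h) *\<^sub>R (S h f - f) - - T f)
            \<le> norm (S h f - S 0 f - (h - 0) *\<^sub>R - T f) / norm (h - 0)"
        proof eventually_elim
          fix h :: real assume h: "h > 0"
          have "(1 / h) *\<^sub>R (S h f - f) - - T f = (1 / h) *\<^sub>R (S h f - S 0 f - (h - 0) *\<^sub>R - T f)"
            using h by (simp add: algebra_simps)
          then show "norm ((1 / h) *\<^sub>R (S h f - f) - - T f)
            \<le> norm (S h f - S 0 f - (h - 0) *\<^sub>R - T f) / norm (h - 0)" using h by simp
        qed
      qed
      then show ?thesis by (rule LIM_zero_cancel)
    qed
  qed
  have "f \<in> D" "g = - T f" if lim: "((\<lambda>h. (1 / h) *\<^sub>R (S h f - f)) \<longlongrightarrow> g) (at_right 0)"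
  proof -
    \<comment> \<open>This choice makes the difference quotients of \<open>w = f - p\<close> at 0
      converge to \<open>w\<close> itself. A contraction semigroup only allows quotients with
      nonpositive pairing against \<open>w\<close>, which forces \<open>w = 0\<close>.\<close>
    define p where "p = resolvent 1 (f - g)"
    have p: "p \<in> D" "T p + p = f - g" using resolvent_in_D[of 1 "f - g"] resolvent_eq[of 1 "f - g"] by (auto simp: p_def)
    define w where "w = f - p"
    have "((\<lambda>h. (1 / h) *\<^sub>R (S h f - f) - (1 / h) *\<^sub>R (S h p - p)) \<longlongrightarrow> g - - T p) (at_right 0)"
      by (intro tendsto_diff lim deriv p)
    moreover have "g - - T p = w" using p(2) by (simp add: w_def algebra_simps)
    moreover have "\<forall>\<^sub>F h in at_right 0. (1 / h) *\<^sub>R (S h f - f) - (1 / h) *\<^sub>R (S h p - p) = (1 / h) *\<^sub>R (S h w - w)"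
    proof (rule eventually_mono[OF eventually_at_right_less[of "0::real"]])
      fix h :: real assume "0 < h"
      then interpret Sh: bounded_linear "S h" by (intro S_bounded_linear) simp
      show "(1 / h) *\<^sub>R (S h f - f) - (1 / h) *\<^sub>R (S h p - p) = (1 / h) *\<^sub>R (S h w - w)"
        by (simp add: w_def Sh.diff algebra_simps)
    qed
    ultimately have "((\<lambda>h. (1 / h) *\<^sub>R (S h w - w)) \<longlongrightarrow> w) (at_right 0)"
      by (simp add: tendsto_cong)
    then have "((\<lambda>h. b ((1 / h) *\<^sub>R (S h w - w)) w) \<longlongrightarrow> b w w) (at_right 0)"
      by (intro b.tendsto tendsto_const)
    moreover have "\<forall>\<^sub>F h in at_right 0. b ((1 / h) *\<^sub>R (S h w - w)) w \<le> 0"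
    proof (rule eventually_mono[OF eventually_at_right_less[of "0::real"]])
      fix h :: real assume h: "0 < h"
      have "b (S h w) w \<le> b w w" using two_b_le[of "S h w" w] S_contraction[of h w] h by linarith
      then show "b ((1 / h) *\<^sub>R (S h w - w)) w \<le> 0"
        using h by (simp add: b.scaleR_left b.diff_left divide_nonpos_pos)
    qed
    ultimately have "b w w \<le> 0" by (rule tendsto_upperbound) simp
    then have "w = 0" by (rule zero_if_nonpos)
    then have "f = p" by (simp add: w_def)
    then show "f \<in> D" "g = - T f" using p by (auto simp: eq_neg_iff_add_eq_0 add.commute)
  qed
  then show ?thesis using deriv by blast
qed

end

section \<open>The uniform boundedness principle\<close>

text \<open>The argument of A. Sokal: move in steps \<open>3\<^sup>-\<^sup>k\<close>, each time in a direction in which the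
  \<open>k\<close>-th operator is almost extremal.\<close>
lemma uniform_boundedness:
  fixes F :: "nat \<Rightarrow> 'a::banach \<Rightarrow> 'b::real_normed_vector"
  assumes F: "\<And>n. bounded_linear (F n)" and ptw: "\<And>x. \<exists>B. \<forall>n. norm (F n x) \<le> B"
  shows "\<exists>B. \<forall>n x. norm (F n x) \<le> B * norm x"
proof (rule ccontr)
  assume "\<not> ?thesis"
  then have big: "\<exists>n. onorm (F n) > B" for B
    by (metis F linorder_not_le mult_right_mono norm_ge_zero onorm order_trans)
  have "\<exists>n. \<forall>k. onorm (F (n k)) > 4 ^ k" by (rule choice) (use big in blast)
  then obtain n where n: "\<And>k. onorm (F (n k)) > 4 ^ k" by blast
  define r :: "nat \<Rightarrow> real" where "r k = (1/3) ^ Suc k" for k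
  have r: "r k > 0" for k by (simp add: r_def)
  have ex: "\<exists>y. norm (y - x) \<le> r k \<and> norm (F (n k) y) \<ge> r k * (2/3 * onorm (F (n k)))" for k x
  proof -
    interpret Fk: bounded_linear "F (n k)" by (rule F)
    let ?o = "onorm (F (n k))"
    have o: "?o > 0" using n[of k] by (meson less_trans zero_less_power zero_less_numeral)
    have "\<exists>v. norm (F (n k) v) > 2/3 * ?o * norm v"
    proof (rule ccontr)
      assume "\<not> ?thesis"
      then have "?o \<le> 2/3 * ?o" using o by (intro onorm_bound) (auto simp: not_less)
      then show False using o by simp
    qed
    then obtain v where v: "norm (F (n k) v) > 2/3 * ?o * norm v" by blast
    then have v0: "v \<noteq> 0" by (auto simp: Fk.zero)
    define u where "u = (1 / norm v) *\<^sub>R v"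
    have u: "norm u = 1" "norm (F (n k) u) \<ge> 2/3 * ?o"
      using v v0 by (auto simp: u_def Fk.scaleR field_simps)
    have "2 * r k * norm (F (n k) u) = norm (F (n k) (x + r k *\<^sub>R u) - F (n k) (x - r k *\<^sub>R u))"
      using r[of k] by (simp add: Fk.add Fk.diff Fk.scaleR scaleR_left_distrib[symmetric])
    also have "\<dots> \<le> norm (F (n k) (x + r k *\<^sub>R u)) + norm (F (n k) (x - r k *\<^sub>R u))"
      by (rule norm_triangle_ineq4)
    finally have "norm (F (n k) (x + r k *\<^sub>R u)) \<ge> r k * norm (F (n k) u)
        \<or> norm (F (n k) (x - r k *\<^sub>R u)) \<ge> r k * norm (F (n k) u)" by argo
    moreover have "r k * norm (F (n k) u) \<ge> r k * (2/3 * ?o)" using r[of k] u(2) by (intro mult_left_mono) auto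
    moreover have "norm (x + r k *\<^sub>R u - x) \<le> r k" "norm (x - r k *\<^sub>R u - x) \<le> r k" using u r[of k] by auto
    ultimately show ?thesis by (meson order_trans)
  qed
  define step where "step k x = (SOME y. norm (y - x) \<le> r k \<and> norm (F (n k) y) \<ge> r k * (2/3 * onorm (F (n k))))" for k x
  have step: "norm (step k x - x) \<le> r k" "norm (F (n k) (step k x)) \<ge> r k * (2/3 * onorm (F (n k)))" for k x
    unfolding step_def using someI_ex[OF ex[of x k]] by blast+
  define X where "X = rec_nat 0 step"
  have X: "X (Suc k) = step k (X k)" for k by (simp add: X_def)
  have tail: "norm (X (k + m) - X k) \<le> (1/3) ^ k / 2 * (1 - (1/3) ^ m)" for k m
  proof (induction m)
    case (Suc m)
    have "norm (X (k + Suc m) - X k) \<le> norm (X (Suc (k + m)) - X (k + m)) + norm (X (k + m) - X k)"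
      by (metis add_Suc_right diff_add_cancel add_diff_eq norm_triangle_ineq)
    also have "\<dots> \<le> r (k + m) + (1/3) ^ k / 2 * (1 - (1/3) ^ m)"
      unfolding X by (intro add_mono Suc step(1))
    also have "\<dots> = (1/3) ^ k / 2 * (1 - (1/3) ^ Suc m)" by (simp add: r_def power_add field_simps)
    finally show ?case .
  qed simp
  have tail': "norm (X (k + m) - X k) \<le> (1/3) ^ k / 2" for k m
    by (rule order_trans[OF tail]) (simp add: mult_left_le)
  have "Cauchy X"
  proof (rule metric_CauchyI)
    fix e :: real assume "e > 0"
    then obtain N where N: "(1/3 :: real) ^ N < e" using real_arch_pow_inv[of e "1/3"] by auto
    have "dist (X i) (X j) < e" if "i \<ge> N" "j \<ge> N" for i j
    proof -
      have "dist (X i) (X j) \<le> norm (X i - X N) + norm (X j - X N)"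
        by (metis dist_norm dist_triangle2)
      also have "\<dots> \<le> (1/3) ^ N / 2 + (1/3) ^ N / 2"
        using tail'[of N "i - N"] tail'[of N "j - N"] that by simp
      finally show ?thesis using N by simp
    qed
    then show "\<exists>M. \<forall>i\<ge>M. \<forall>j\<ge>M. dist (X i) (X j) < e" by blast
  qed
  then obtain x where x: "X \<longlonglongrightarrow> x" using Cauchy_convergent_iff convergent_def by blast
  have xk: "norm (x - X k) \<le> (1/3) ^ k / 2" for k
  proof (rule LIMSEQ_le_const2)
    show "(\<lambda>m. norm (X (k + m) - X k)) \<longlonglongrightarrow> norm (x - X k)"
      using LIMSEQ_ignore_initial_segment[OF x, of k] by (intro tendsto_intros) (simp add: add.commute)
  qed (use tail' in auto)
  obtain B where B: "\<And>n. norm (F n x) \<le> B" using ptw by blast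
  have "(4/3) ^ k \<le> 18 * B" for k
  proof -
    interpret Fk: bounded_linear "F (n k)" by (rule F)
    let ?o = "onorm (F (n k))"
    have "norm (F (n k) (X (Suc k))) \<le> norm (F (n k) x) + norm (F (n k) (x - X (Suc k)))"
      by (metis Fk.diff norm_triangle_sub norm_minus_commute)
    also have "norm (F (n k) (x - X (Suc k))) \<le> ?o * ((1/3) ^ Suc k / 2)"
      by (rule order_trans[OF onorm[OF F]]) (intro mult_left_mono xk onorm_pos_le F)
    finally have "r k * (2/3 * ?o) \<le> B + ?o * (r k / 2)" using step(2)[of k "X k"] B[of "n k"] by (simp add: X r_def)
    then have "r k * ?o \<le> 6 * B" by (simp add: field_simps)
    moreover have "r k * 4 ^ k \<le> r k * ?o" using n[of k] r[of k] by (intro mult_left_mono) auto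
    moreover have "r k * 4 ^ k = (4/3) ^ k / 3" by (simp add: r_def power_divide)
    ultimately show ?thesis by simp
  qed
  moreover obtain k where "(4/3 :: real) ^ k > 18 * B" using real_arch_pow[of "4/3"] by auto
  ultimately show False by (simp add: not_le[symmetric])
qed

section \<open>Positive operators in a space with a fundamental symmetry\<close>

text \<open>The symmetry \<open>U\<close> is a parameter because the setting is entered twice: with
  the symmetry built from the similarity, and with the one belonging to an arbitrary given
  decomposition.\<close>

locale krein_setting =
  fixes J L U :: "'a::chilbert \<Rightarrow> 'a" and DL :: "'a set" and c :: real
  assumes signature: "signature_op J" and self_adjoint: "self_adjoint DL L" and positive: "positive_op DL L"
    and U_clinear: "bounded_clinear_op U" and UU [simp]: "U (U x) = x"
    and JU_sym: "cinner (J (U x)) y = cinner (J x) (U y)"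
    and c_pos: "c > 0" and JU_coercive: "c * (norm x)\<^sup>2 \<le> Re (cinner (J (U x)) x)"
    and U_DL: "x \<in> DL \<Longrightarrow> U x \<in> DL" and U_commute: "x \<in> DL \<Longrightarrow> J (L (U x)) = U (J (L x))"
begin

lemma JJ [simp]: "J (J x) = x" and J_sym: "cinner (J x) y = cinner x (J y)"
  and J_bounded_linear: "bounded_linear J" and J_scaleC: "J (scaleC z x) = scaleC z (J x)"
  and U_bounded_linear: "bounded_linear U" and U_scaleC: "U (scaleC z x) = scaleC z (U x)"
  using signature U_clinear unfolding signature_op_def by (auto simp: bounded_clinear_op_iff)

sublocale J: bounded_linear J by (rule J_bounded_linear)
sublocale U: bounded_linear U by (rule U_bounded_linear)

definition G :: "'a \<Rightarrow> 'a" where "G x = J (U x)"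
definition T :: "'a \<Rightarrow> 'a" where "T x = U (J (L x))"
definition b :: "'a \<Rightarrow> 'a \<Rightarrow> real" where "b x y = Re (cinner (G x) y)"

lemma G_bounded_linear: "bounded_linear G" and G_scaleC: "G (scaleC z x) = scaleC z (G x)"
  unfolding G_def using bounded_linear_compose[OF J_bounded_linear U_bounded_linear]
  by (auto simp: J_scaleC U_scaleC)

sublocale G: bounded_linear G by (rule G_bounded_linear)

lemma G_inverse [simp]: "G (U (J x)) = x" "U (J (G x)) = x"
  by (simp_all add: G_def)

lemma G_sym: "cinner (G x) y = cinner x (G y)"
  unfolding G_def by (rule trans[OF JU_sym J_sym])

lemma G_self_real: "Im (cinner (G x) x) = 0"
  using cinner_commute[of x "G x"] G_sym[of x x] by (metis Im_complex_of_real Reals_cnj_iff complex_is_Real_iff)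

lemma G_T [simp]: "G (T x) = L x" and UJL: "T x = U (J (L x))"
  by (simp_all add: T_def)

lemma DL_csubspace: "csubspace DL" and L_add: "x \<in> DL \<Longrightarrow> y \<in> DL \<Longrightarrow> L (x + y) = L x + L y"
  and L_scaleC: "x \<in> DL \<Longrightarrow> L (scaleC z x) = scaleC z (L x)" and DL_dense: "closure DL = UNIV"
  using self_adjoint unfolding self_adjoint_def clinear_on_def by auto

lemma DL_subspace: "subspace DL" by (rule csubspace_imp_subspace[OF DL_csubspace])

lemma DL_scaleC: "x \<in> DL \<Longrightarrow> scaleC z x \<in> DL"
  using DL_csubspace unfolding csubspace_def by blast

lemma T_scaleC: "x \<in> DL \<Longrightarrow> T (scaleC z x) = scaleC z (T x)"
  by (simp add: T_def L_scaleC J_scaleC U_scaleC)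

lemma T_U: "x \<in> DL \<Longrightarrow> T (U x) = U (T x)"
  by (simp add: T_def U_commute)

lemma L_self: "x \<in> DL \<Longrightarrow> Im (cinner (L x) x) = 0 \<and> Re (cinner (L x) x) \<ge> 0"
  using cinner_commute[of x "L x"] self_adjoint_symmetric[OF self_adjoint, of x x] positive
  unfolding positive_op_def by (metis Im_complex_of_real Reals_cnj_iff complex_is_Real_iff)

lemma L_injective: "x \<in> DL \<Longrightarrow> L x = 0 \<Longrightarrow> x = 0"
  using positive unfolding positive_op_def by blast

lemma coercive: "c * (norm x)\<^sup>2 \<le> Re (cinner (G x) x)"
  using JU_coercive[of x] by (simp add: G_def)

lemma T_closed_graph:
  assumes s: "\<And>n. s n \<in> DL" "s \<longlonglongrightarrow> x" "(\<lambda>n. T (s n)) \<longlonglongrightarrow> y"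
  shows "x \<in> DL" "T x = y"
proof -
  have "(\<lambda>n. L (s n)) \<longlonglongrightarrow> G y" using G.tendsto[OF s(3)] by simp
  then have "x \<in> DL" "L x = G y" using self_adjoint_closed[OF self_adjoint s(1,2)] by blast+
  then show "x \<in> DL" "T x = y" by (simp_all add: T_def)
qed

section \<open>Reducing projections and the equation \<open>T x - z x = y\<close> off the
  half-line\<close>

text \<open>Projections that are orthogonal for the inner product given by \<open>G\<close> and
  commute with \<open>T\<close>. The notion covers the identity and both spectral projections, so
  solvability is proved once for the whole space and its two halves.\<close>

definition reducing :: "('a \<Rightarrow> 'a) \<Rightarrow> bool" where
  "reducing Q \<longleftrightarrow> bounded_clinear_op Q \<and> (\<forall>x. Q (Q x) = Q x)
     \<and> (\<forall>x y. cinner (G (Q x)) y = cinner (G x) (Q y)) \<and> (\<forall>x\<in>DL. Q x \<in> DL \<and> T (Q x) = Q (T x))"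

lemma reducingD:
  assumes "reducing Q"
  shows "bounded_linear Q" "Q (scaleC z x) = scaleC z (Q x)" "Q (Q x) = Q x"
    "cinner (G (Q x)) y = cinner (G x) (Q y)" "x \<in> DL \<Longrightarrow> Q x \<in> DL" "x \<in> DL \<Longrightarrow> T (Q x) = Q (T x)"
  using assms unfolding reducing_def bounded_clinear_op_iff by auto

lemma reducing_id: "reducing (\<lambda>x. x)"
  unfolding reducing_def bounded_clinear_op_iff by (auto simp: bounded_linear_ident)

lemma T_add_DL: "x \<in> DL \<Longrightarrow> y \<in> DL \<Longrightarrow> T (x + y) = T x + T y"
  by (simp add: T_def L_add J.add U.add)

lemma DL_diff: "x \<in> DL \<Longrightarrow> y \<in> DL \<Longrightarrow> x - y \<in> DL"
  by (rule csubspace_diff[OF DL_csubspace])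

lemma DL_add: "x \<in> DL \<Longrightarrow> y \<in> DL \<Longrightarrow> x + y \<in> DL"
  by (rule subspace_add[OF DL_subspace])

lemma DL_0: "0 \<in> DL"
  by (rule subspace_0[OF DL_subspace])

lemma T_diff_DL: "x \<in> DL \<Longrightarrow> y \<in> DL \<Longrightarrow> T (x - y) = T x - T y"
  using T_add_DL[of "x - y" y] DL_diff[of x y] by (simp add: algebra_simps)

lemma T_0: "T 0 = 0"
  using T_diff_DL[OF DL_0 DL_0] by simp

text \<open>The range of \<open>T - z\<close> on the range of \<open>Q\<close>, enlarged by the
  kernel of \<open>Q\<close>. The enlargement makes surjectivity on the range of \<open>Q\<close>
  equivalent to this set being the whole space, where the criterion by orthogonal complements is
  available.\<close>

definition range_space :: "('a \<Rightarrow> 'a) \<Rightarrow> complex \<Rightarrow> 'a set" where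
  "range_space Q z = {w. \<exists>x\<in>DL. Q x = x \<and> T x - scaleC z x = Q w}"

lemma range_space_csubspace:
  assumes red: "reducing Q"
  shows "csubspace (range_space Q z)"
  unfolding csubspace_def
proof (intro conjI ballI allI)
  note Q = reducingD[OF red]
  interpret Q: bounded_linear Q by (rule Q)
  show "0 \<in> range_space Q z" unfolding range_space_def using DL_0 T_0 by (auto intro!: bexI[of _ 0] simp: Q.zero)
  fix w assume w: "w \<in> range_space Q z"
  then obtain x where x: "x \<in> DL" "Q x = x" "T x - scaleC z x = Q w" unfolding range_space_def by blast
  show "w + w' \<in> range_space Q z" if w': "w' \<in> range_space Q z" for w'
  proof -
    obtain x' where x': "x' \<in> DL" "Q x' = x'" "T x' - scaleC z x' = Q w'" using w' unfolding range_space_def by blast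
    have "T (x + x') - scaleC z (x + x') = Q (w + w')"
      unfolding Q.add x(3)[symmetric] x'(3)[symmetric] using x(1) x'(1) by (simp add: T_add_DL scaleC_add_right)
    then show ?thesis unfolding range_space_def using x x' DL_add by (auto intro!: bexI[of _ "x + x'"] simp: Q.add)
  qed
  show "scaleC k w \<in> range_space Q z" for k
  proof -
    have "T (scaleC k x) - scaleC z (scaleC k x) = Q (scaleC k w)"
      unfolding Q(2) x(3)[symmetric] using x(1)
      by (simp add: T_scaleC scaleC_diff_right scaleC_scaleC mult.commute)
    then show ?thesis unfolding range_space_def using x DL_scaleC by (auto intro!: bexI[of _ "scaleC k x"] simp: Q(2))
  qed
qed

text \<open>Write \<open>v = G g\<close>. Orthogonality to the kernel of \<open>Q\<close> gives
  \<open>Q g = g\<close>; orthogonality to the remaining vectors says that \<open>g\<close>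
  satisfies \<open>L g = cnj z G g\<close> weakly. Self-adjointness of \<open>L\<close> puts
  \<open>g\<close> into the domain, and \<open>inj\<close> finishes.\<close>

lemma range_space_orthogonal:
  assumes red: "reducing Q"
    and inj: "\<And>g. g \<in> DL \<Longrightarrow> Q g = g \<Longrightarrow> T g = scaleC (cnj z) g \<Longrightarrow> g = 0"
    and v: "\<And>w. w \<in> range_space Q z \<Longrightarrow> cinner w v = 0"
  shows "v = 0"
proof -
  note Q = reducingD[OF red]
  interpret Q: bounded_linear Q by (rule Q)
  define g where "g = U (J v)"
  have v_eq: "v = G g" by (simp add: g_def)
  have ker: "cinner w (G g) = 0" if "Q w = 0" for w
  proof -
    have "w \<in> range_space Q z" unfolding range_space_def using that DL_0 T_0 by (auto intro!: bexI[of _ 0] simp: Q.zero)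
    then show ?thesis using v v_eq by simp
  qed
  have Qg: "Q g = g"
  proof -
    have 0: "Q (g - Q g) = 0" by (simp add: Q.diff Q(3))
    have "cinner (G (g - Q g)) (Q g) = cinner (G (Q (g - Q g))) g" by (simp only: Q(4))
    also have "\<dots> = 0" unfolding 0 by (simp add: G.zero)
    finally have "cinner (G (g - Q g)) (g - Q g) = 0"
      using ker[OF 0] by (simp add: G_sym[of "g - Q g" g] cinner_diff(2))
    then have "c * (norm (g - Q g))\<^sup>2 \<le> 0" using coercive[of "g - Q g"] by simp
    then show ?thesis using c_pos by (simp add: mult_le_0_iff)
  qed
  have "cinner (L f) g = cinner f (scaleC (cnj z) (G g))" if f: "f \<in> DL" for f
  proof -
    have Qf: "Q f \<in> DL" "T (Q f) = Q (T f)" using Q f by auto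
    let ?w = "T f - scaleC z f"
    have "Q ?w \<in> range_space Q z" unfolding range_space_def using Qf
      by (auto intro!: bexI[of _ "Q f"] simp: Q(3) Q.diff Q(2))
    then have "cinner (Q ?w) (G g) = 0" using v v_eq by simp
    moreover have "cinner (?w - Q ?w) (G g) = 0" by (rule ker) (simp add: Q.diff Q(3))
    ultimately have "cinner ?w (G g) = 0" by (simp add: cinner_diff(1))
    then have "cinner (G (T f)) g = z * cinner f (G g)"
      by (simp add: cinner_diff cinner_scaleC_left G_sym[of "T f"] del: G_T)
    then show ?thesis by (simp add: cinner_scaleC_right)
  qed
  from self_adjoint_adjointD[OF self_adjoint this]
  have "g \<in> DL" "L g = scaleC (cnj z) (G g)" by blast+
  then have "g = 0" using inj[OF _ Qg] by (simp add: T_def J_scaleC U_scaleC)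
  then show ?thesis by (simp add: v_eq G.zero)
qed

lemma range_onto:
  assumes red: "reducing Q"
    and K: "\<And>x. x \<in> DL \<Longrightarrow> Q x = x \<Longrightarrow> norm x \<le> K * norm (T x - scaleC z x)"
    and inj: "\<And>g. g \<in> DL \<Longrightarrow> Q g = g \<Longrightarrow> T g = scaleC (cnj z) g \<Longrightarrow> g = 0"
    and y: "Q y = y"
  shows "\<exists>x\<in>DL. Q x = x \<and> T x - scaleC z x = y"
proof -
  note Q = reducingD[OF red]
  interpret Q: bounded_linear Q by (rule Q)
  have "closed (range_space Q z)"
    unfolding closed_sequential_limits
  proof (intro allI impI, elim conjE)
    fix w l assume w: "\<forall>n. w n \<in> range_space Q z" and l: "w \<longlonglongrightarrow> l"
    have "\<exists>x. \<forall>n. x n \<in> DL \<and> Q (x n) = x n \<and> T (x n) - scaleC z (x n) = Q (w n)"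
      by (rule choice) (use w in \<open>auto simp: range_space_def\<close>)
    then obtain x where x: "\<And>n. x n \<in> DL" "\<And>n. Q (x n) = x n" "\<And>n. T (x n) - scaleC z (x n) = Q (w n)" by blast
    have Qw: "(\<lambda>n. Q (w n)) \<longlonglongrightarrow> Q l" by (rule Q.tendsto[OF l])
    have est: "norm (x m - x n) \<le> \<bar>K\<bar> * norm (Q (w m) - Q (w n))" for m n
    proof -
      have "norm (x m - x n) \<le> K * norm (T (x m - x n) - scaleC z (x m - x n))"
        by (rule K) (use x DL_diff in \<open>auto simp: Q.diff\<close>)
      also have "\<dots> \<le> \<bar>K\<bar> * norm (T (x m - x n) - scaleC z (x m - x n))" by (intro mult_right_mono) auto
      also have "T (x m - x n) - scaleC z (x m - x n) = Q (w m) - Q (w n)"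
        unfolding x(3)[symmetric] using x(1) by (simp add: T_diff_DL scaleC_diff_right)
      finally show ?thesis .
    qed
    have "Cauchy x" by (rule Cauchy_of_norm_estimate[OF LIMSEQ_imp_Cauchy[OF Qw] est])
    then obtain p where p: "x \<longlonglongrightarrow> p" using Cauchy_convergent_iff convergent_def by blast
    have "(\<lambda>n. Q (w n) + scaleC z (x n)) \<longlonglongrightarrow> Q l + scaleC z p"
      by (intro tendsto_add Qw bounded_linear.tendsto[OF bounded_linear_scaleC] p)
    moreover have "Q (w n) + scaleC z (x n) = T (x n)" for n using x(3)[of n] by (simp add: algebra_simps)
    ultimately have "(\<lambda>n. T (x n)) \<longlonglongrightarrow> Q l + scaleC z p" by simp
    from T_closed_graph[OF x(1) p this] have "p \<in> DL" "T p = Q l + scaleC z p" .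
    moreover have "Q p = p" using LIMSEQ_unique[OF Q.tendsto[OF p]] p x(2) by simp
    ultimately show "l \<in> range_space Q z" unfolding range_space_def by (auto intro!: bexI[of _ p])
  qed
  then have "range_space Q z = UNIV"
    by (rule closed_csubspace_eq_UNIV[OF range_space_csubspace[OF red] _ range_space_orthogonal[OF red inj]])
  then have "y \<in> range_space Q z" by simp
  then show ?thesis using y unfolding range_space_def by auto
qed

text \<open>Pairing \<open>G (T x - z x)\<close> with \<open>x\<close> gives
  \<open>(L x, x) - z (G x, x)\<close>, where both products are real and nonnegative. The real part
  is used when \<open>Re z < 0\<close> and the imaginary part otherwise.\<close>

lemma bounded_below_off_halfline:
  assumes z: "Im z \<noteq> 0 \<or> Re z < 0"
  shows "\<exists>K. \<forall>x\<in>DL. norm x \<le> K * norm (T x - scaleC z x)"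
proof -
  obtain KG where KG: "KG > 0" "\<And>x. norm (G x) \<le> norm x * KG" using G.pos_bounded by blast
  define d where "d = (if Re z < 0 then - Re z else \<bar>Im z\<bar>)"
  have d: "d > 0" using z by (auto simp: d_def)
  have "norm x \<le> KG / (c * d) * norm (T x - scaleC z x)" if x: "x \<in> DL" for x
  proof (cases "x = 0")
    case False
    let ?w = "T x - scaleC z x"
    have e: "cinner (G ?w) x = cinner (L x) x - z * cinner (G x) x"
      by (simp add: G.diff G_scaleC cinner_diff cinner_scaleC_left)
    have p: "Im (cinner (L x) x) = 0" "Re (cinner (L x) x) \<ge> 0" "Im (cinner (G x) x) = 0"
      using L_self[OF x] G_self_real by auto
    have q: "0 \<le> Re (cinner (G x) x)" using coercive[of x] c_pos by (meson mult_nonneg_nonneg less_imp_le order_trans zero_le_power2)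
    have "d * Re (cinner (G x) x) \<le> cmod (cinner (G ?w) x)"
    proof (cases "Re z < 0")
      case True
      have "d * Re (cinner (G x) x) \<le> Re (cinner (G ?w) x)" using True p unfolding e by (simp add: d_def)
      also have "\<dots> \<le> cmod (cinner (G ?w) x)" by (rule complex_Re_le_cmod)
      finally show ?thesis .
    next
      case False
      have "d * Re (cinner (G x) x) = \<bar>Im (cinner (G ?w) x)\<bar>"
        using False p q unfolding e by (simp add: d_def abs_mult)
      then show ?thesis using abs_Im_le_cmod by simp
    qed
    also have "\<dots> \<le> norm (G ?w) * norm x" by (rule cmod_cinner_le)
    also have "\<dots> \<le> (norm ?w * KG) * norm x" by (intro mult_right_mono KG) auto
    finally have "d * (c * (norm x)\<^sup>2) \<le> norm ?w * KG * norm x"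
      using mult_left_mono[OF coercive[of x], of d] d by linarith
    then have "d * c * norm x \<le> norm ?w * KG" using False by (simp add: power2_eq_square)
    then show ?thesis using d c_pos by (simp add: field_simps)
  qed (use KG d c_pos in simp)
  then show ?thesis by blast
qed

lemma injective_off_halfline:
  assumes "Im z \<noteq> 0 \<or> Re z < 0" "x \<in> DL" "T x = scaleC z x" shows "x = 0"
  using bounded_below_off_halfline[OF assms(1)] assms(2,3) by force

lemma onto_off_halfline:
  assumes "reducing Q" "Im z \<noteq> 0 \<or> Re z < 0" "Q y = y"
  shows "\<exists>x\<in>DL. Q x = x \<and> T x - scaleC z x = y"
proof -
  obtain K where "\<And>x. x \<in> DL \<Longrightarrow> norm x \<le> K * norm (T x - scaleC z x)"
    using bounded_below_off_halfline[OF assms(2)] by blast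
  moreover have "g = 0" if "g \<in> DL" "T g = scaleC (cnj z) g" for g
    using injective_off_halfline[of "cnj z" g] that assms(2) by simp
  ultimately show ?thesis using range_onto[OF assms(1) _ _ assms(3)] by blast
qed

sublocale positive_symmetric_operator b c DL T
proof unfold_locales
  show "b x (y + z) = b x y + b x z" "b (x + y) z = b x z + b y z" "b (r *\<^sub>R x) y = r *\<^sub>R b x y"
    "b x (r *\<^sub>R y) = r *\<^sub>R b x y" for x y z r
    by (simp_all add: b_def G.add G.scaleR cinner_add_left cinner_add_right cinner_scaleR)
  obtain KG where KG: "KG > 0" "\<And>x. norm (G x) \<le> norm x * KG" using G.pos_bounded by blast
  have "norm (b x y) \<le> norm x * norm y * KG" for x y
  proof -
    have "norm (b x y) \<le> norm (G x) * norm y" using Re_cinner_le[of "G x" y] by (simp add: b_def)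
    also have "\<dots> \<le> (norm x * KG) * norm y" by (intro mult_right_mono KG) auto
    finally show ?thesis by (simp add: ac_simps)
  qed
  then show "\<exists>K. \<forall>x y. norm (b x y) \<le> norm x * norm y * K" by blast
  show "b x y = b y x" for x y unfolding b_def G_sym[of x y] by (rule Re_cinner_commute)
  show "c > 0" by (rule c_pos)
  show "c * (norm x)\<^sup>2 \<le> b x x" for x using coercive[of x] by (simp add: b_def)
  show "subspace DL" by (rule DL_subspace)
  show "closure DL = UNIV" by (rule DL_dense)
  show "T (x + y) = T x + T y" if "x \<in> DL" "y \<in> DL" for x y
    using that by (simp add: T_def L_add J.add U.add)
  show "T (r *\<^sub>R x) = r *\<^sub>R T x" if "x \<in> DL" for r x using T_scaleC[OF that] by (simp add: scaleR_scaleC)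
  show "b (T x) y = b x (T y)" if "x \<in> DL" "y \<in> DL" for x y
    using self_adjoint_symmetric[OF self_adjoint that] by (simp add: b_def G_sym[of x])
  show "0 \<le> b (T x) x" if "x \<in> DL" for x using L_self[OF that] by (simp add: b_def)
  \<comment> \<open>The point \<open>- l\<close> lies off the half-line, so solvability there
    applies with \<open>Q\<close> the identity.\<close>
  show "\<exists>x\<in>DL. T x + l *\<^sub>R x = y" if "0 < l" for l y
    using onto_off_halfline[OF reducing_id, of "of_real (- l)" y] that by (auto simp: scaleR_scaleC)
qed

lemma S_scaleC: "0 \<le> t \<Longrightarrow> S t (scaleC z f) = scaleC z (S t f)"
  by (rule S_commute[symmetric]) (auto simp: bounded_linear_scaleC DL_scaleC T_scaleC)

lemma S_reducing: "reducing Q \<Longrightarrow> 0 \<le> t \<Longrightarrow> Q (S t f) = S t (Q f)"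
  by (rule S_commute) (auto simp: reducingD)

end

section \<open>Semigroups and their generators\<close>

context krein_setting begin

lemma semigroup_generator_exists:
  assumes red: "reducing Q" and V: "V = {x. Q x = x}"
    and A: "\<And>f. f \<in> DL \<Longrightarrow> Q f = f \<Longrightarrow> A f = - T f"
  shows "semigroup_gen V (DL \<inter> V) A (\<lambda>t f. if 0 \<le> t \<and> f \<in> V then S t f else 0)"
proof -
  note Q = reducingD[OF red]
  interpret Q: bounded_linear Q by (rule Q)
  have SV: "S t f \<in> V" if "0 \<le> t" "f \<in> V" for t f using S_reducing[OF red that(1), of f] that by (simp add: V)
  have csV: "csubspace V" unfolding csubspace_def V by (auto simp: Q.add Q(2) Q.zero)
  obtain M where M: "M > 0" "\<And>t f. 0 \<le> t \<Longrightarrow> norm (S t f) \<le> M * norm f" using S_bounded by blast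
  let ?W = "\<lambda>t f. if 0 \<le> t \<and> f \<in> V then S t f else 0"
  have cont: "((\<lambda>t. ?W t f) \<longlongrightarrow> f) (at_right 0)" if f: "f \<in> V" for f
  proof -
    have "((\<lambda>t. S t f) \<longlongrightarrow> S 0 f) (at 0 within {0..})"
      using S_continuous[of f] unfolding continuous_on_def by (rule bspec) simp
    then have "((\<lambda>t. S t f) \<longlongrightarrow> S 0 f) (at_right 0)" by (rule tendsto_within_subset) auto
    then have "((\<lambda>t. S t f) \<longlongrightarrow> f) (at_right 0)" by simp
    then show ?thesis
      by (rule Lim_transform_eventually) (use f in \<open>auto intro!: eventually_mono[OF eventually_at_right_less]\<close>)
  qed
  have gen: "((\<lambda>h. (1 / h) *\<^sub>R (?W h f - f)) \<longlongrightarrow> g) (at_right 0) \<longleftrightarrow> (f \<in> DL \<inter> V \<and> g = A f)" if f: "f \<in> V" for f g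
  proof -
    have "((\<lambda>h. (1 / h) *\<^sub>R (?W h f - f)) \<longlongrightarrow> g) (at_right 0) \<longleftrightarrow>
        ((\<lambda>h. (1 / h) *\<^sub>R (S h f - f)) \<longlongrightarrow> g) (at_right 0)"
      by (intro tendsto_cong eventually_mono[OF eventually_at_right_less]) (use f in auto)
    then show ?thesis using S_generator[of f g] A[of f] f by (auto simp: V)
  qed
  have lin: "clinear_on V (?W t)" if "0 \<le> t" for t
    using csV that unfolding clinear_on_def by (auto simp: S_add S_scaleC csubspace_def)
  show ?thesis unfolding semigroup_gen_def
  proof (intro conjI)
    show "\<forall>t\<ge>0. clinear_on V (?W t) \<and> (\<exists>K. \<forall>f\<in>V. norm (?W t f) \<le> K * norm f)"
      using lin M by (auto intro!: exI[of _ M])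
    show "\<forall>s\<ge>0. \<forall>t\<ge>0. \<forall>f\<in>V. ?W (s + t) f = ?W s (?W t f)"
      by (auto simp: SV S_semigroup)
    show "\<forall>f\<in>V. ((\<lambda>t. ?W t f) \<longlongrightarrow> f) (at_right 0)" using cont by blast
    show "\<forall>f\<in>V. \<forall>g. ((\<lambda>h. (1 / h) *\<^sub>R (?W h f - f)) \<longlongrightarrow> g) (at_right 0) \<longleftrightarrow> (f \<in> DL \<inter> V \<and> g = A f)"
      using gen by blast
  qed (auto simp: SV)
qed

end

section \<open>Uniqueness of the semigroup with a given generator\<close>

text \<open>Precomposition with a projection onto \<open>V\<close> replaces an operator on
  \<open>V\<close> by one defined everywhere, to which the results on bounded operators
  apply.\<close>

lemma bounded_linear_restriction:
  fixes F :: "'a::chilbert \<Rightarrow> 'a"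
  assumes F: "clinear_on V F" "\<forall>f\<in>V. norm (F f) \<le> K * norm f" and Q: "bounded_linear Q" "\<And>x. Q x \<in> V"
  shows "bounded_linear (\<lambda>x. F (Q x))"
proof -
  interpret Q: bounded_linear Q by fact
  obtain KQ where KQ: "KQ > 0" "\<And>x. norm (Q x) \<le> norm x * KQ" using Q.pos_bounded by blast
  show ?thesis
  proof (rule bounded_linear_intro)
    show "F (Q (x + y)) = F (Q x) + F (Q y)" for x y
      using F(1) Q(2) by (simp add: Q.add clinear_on_def)
    show "F (Q (r *\<^sub>R x)) = r *\<^sub>R F (Q x)" for r x
      using F(1) Q(2) unfolding Q.scaleR unfolding scaleR_scaleC clinear_on_def by blast
    show "norm (F (Q x)) \<le> norm x * (\<bar>K\<bar> * KQ)" for x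
    proof -
      have "norm (F (Q x)) \<le> K * norm (Q x)" using F(2) Q(2) by blast
      also have "\<dots> \<le> \<bar>K\<bar> * norm (Q x)" by (intro mult_right_mono) auto
      also have "\<dots> \<le> \<bar>K\<bar> * (norm x * KQ)" by (intro mult_left_mono KQ) auto
      finally show ?thesis by (simp add: ac_simps)
    qed
  qed
qed

text \<open>If no bound held near 0, times \<open>s n\<close> tending to 0 would carry operators of
  unbounded norm. Strong continuity at 0 makes them pointwise bounded, contradicting the uniform
  boundedness principle. The semigroup law then propagates the bound to
  \<open>[0, t]\<close>.\<close>

lemma semigroup_locally_bounded:
  fixes W :: "real \<Rightarrow> 'a::chilbert \<Rightarrow> 'a"
  assumes W: "semigroup_gen V D A W" and Q: "bounded_linear Q" "\<And>x. Q x \<in> V" "\<And>x. x \<in> V \<Longrightarrow> Q x = x"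
  shows "\<exists>M. \<forall>s\<in>{0..t}. \<forall>f\<in>V. norm (W s f) \<le> M * norm f"
proof -
  have WV: "\<And>t f. 0 \<le> t \<Longrightarrow> f \<in> V \<Longrightarrow> W t f \<in> V"
    and Wlin: "\<And>t. 0 \<le> t \<Longrightarrow> clinear_on V (W t)"
    and Wbd: "\<And>t. 0 \<le> t \<Longrightarrow> \<exists>K. \<forall>f\<in>V. norm (W t f) \<le> K * norm f"
    and W0: "\<And>f. f \<in> V \<Longrightarrow> W 0 f = f"
    and Wsg: "\<And>s t f. 0 \<le> s \<Longrightarrow> 0 \<le> t \<Longrightarrow> f \<in> V \<Longrightarrow> W (s + t) f = W s (W t f)"
    and Wc: "\<And>f. f \<in> V \<Longrightarrow> ((\<lambda>t. W t f) \<longlongrightarrow> f) (at_right 0)"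
    using W unfolding semigroup_gen_def by blast+
  have WQ: "bounded_linear (\<lambda>f. W s (Q f))" if "0 \<le> s" for s
    using bounded_linear_restriction[OF Wlin[OF that] _ Q(1,2)] Wbd[OF that] by blast
  have "\<exists>d>0. \<exists>M. \<forall>s\<in>{0..d}. \<forall>f\<in>V. norm (W s f) \<le> M * norm f"
  proof (rule ccontr)
    assume neg: "\<not> ?thesis"
    have "\<exists>s f. s \<in> {0..1 / Suc n} \<and> f \<in> V \<and> norm (W s f) > real n * norm f" for n
    proof (rule ccontr)
      assume "\<not> ?thesis"
      then have "\<forall>s\<in>{0..1 / Suc n}. \<forall>f\<in>V. norm (W s f) \<le> real n * norm f" by (auto simp: not_less)
      then show False using neg by (metis of_nat_0_less_iff zero_less_Suc zero_less_divide_1_iff)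
    qed
    then obtain s f where sf: "\<And>n. s n \<in> {0..1 / Suc n}" "\<And>n. f n \<in> V" "\<And>n. norm (W (s n) (f n)) > real n * norm (f n)"
      by metis
    have s0: "s \<longlonglongrightarrow> 0"
      by (rule tendsto_sandwich[OF _ _ tendsto_const LIMSEQ_Suc[OF lim_1_over_n]]) (use sf(1) in auto)
    have "\<exists>B. \<forall>n. norm (W (s n) (Q x)) \<le> B" for x
    proof -
      have "((\<lambda>t. W t (Q x)) \<longlongrightarrow> W 0 (Q x)) (at 0 within {0..})"
        using Wc[OF Q(2)[of x]] W0[OF Q(2)[of x]] by (simp add: at_within_Ici_at_right)
      then have "continuous (at 0 within {0..}) (\<lambda>t. W t (Q x))" by (simp add: continuous_within)
      then have "(\<lambda>n. W (s n) (Q x)) \<longlonglongrightarrow> W 0 (Q x)"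
        by (rule continuous_within_tendsto_compose') (use sf(1) s0 in auto)
      then have "Bseq (\<lambda>n. W (s n) (Q x))" by (rule convergent_imp_Bseq[OF convergentI])
      then show ?thesis by (auto simp: Bseq_def)
    qed
    from uniform_boundedness[OF WQ this]
    obtain B where B: "\<And>n x. norm (W (s n) (Q x)) \<le> B * norm x" using sf(1) by auto
    obtain n where "real n > B" using reals_Archimedean2 by blast
    then have "B * norm (f n) \<le> real n * norm (f n)" by (intro mult_right_mono) auto
    then show False using B[of n "f n"] sf(3)[of n] Q(3)[OF sf(2)[of n]] by simp
  qed
  then obtain d M0 where d: "d > 0" and M0: "\<And>s f. s \<in> {0..d} \<Longrightarrow> f \<in> V \<Longrightarrow> norm (W s f) \<le> M0 * norm f" by blast
  \<comment> \<open>With \<open>M\<close> at least 1 the powers \<open>M ^ k\<close> increase, so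
    the bound for a longer interval covers the shorter ones.\<close>
  define M where "M = max 1 M0"
  have M: "norm (W s f) \<le> M * norm f" if "s \<in> {0..d}" "f \<in> V" for s f
  proof -
    have "norm (W s f) \<le> M0 * norm f" by (rule M0[OF that])
    also have "\<dots> \<le> M * norm f" by (rule mult_right_mono) (simp_all add: M_def)
    finally show ?thesis .
  qed
  have M1: "M \<ge> 1" by (simp add: M_def)
  have pow: "\<forall>s\<in>{0..real k * d}. \<forall>f\<in>V. norm (W s f) \<le> M ^ k * norm f" for k
  proof (induction k)
    case 0
    then show ?case using W0 by auto
  next
    case (Suc k)
    show ?case
    proof (intro ballI)
      fix s f assume s: "s \<in> {0..real (Suc k) * d}" and f: "f \<in> V"
      show "norm (W s f) \<le> M ^ Suc k * norm f"
      proof (cases "s \<le> real k * d")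
        case True
        then have "norm (W s f) \<le> M ^ k * norm f" using Suc s f by auto
        also have "\<dots> \<le> M ^ Suc k * norm f" using M1 by (intro mult_right_mono power_increasing) auto
        finally show ?thesis .
      next
        case False
        define r where "r = real k * d"
        have r: "0 \<le> r" "s - r \<in> {0..d}" using False s d by (auto simp: r_def algebra_simps)
        have "W s f = W (s - r) (W r f)" using Wsg[of "s - r" r f] r f by simp
        also have "norm \<dots> \<le> M * norm (W r f)" using M[OF r(2) WV[OF r(1) f]] .
        also have "\<dots> \<le> M * (M ^ k * norm f)" using Suc M1 r f by (intro mult_left_mono) (auto simp: r_def)
        finally show ?thesis by simp
      qed
    qed
  qed
  obtain k where "t < real k * d" using reals_Archimedean3[OF d] by blast
  then show ?thesis using pow[of k] by (intro exI[of _ "M ^ k"]) auto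
qed

lemma semigroup_commutes_with_generator:
  fixes W :: "real \<Rightarrow> 'a::chilbert \<Rightarrow> 'a"
  assumes W: "semigroup_gen V D A W" and f: "f \<in> V" "f \<in> D" and t: "0 \<le> t" and AV: "A f \<in> V"
  shows "W t f \<in> D \<and> A (W t f) = W t (A f)"
proof -
  have WV: "\<And>t f. 0 \<le> t \<Longrightarrow> f \<in> V \<Longrightarrow> W t f \<in> V" and Wlin: "clinear_on V (W t)"
    and Wsg: "\<And>s t f. 0 \<le> s \<Longrightarrow> 0 \<le> t \<Longrightarrow> f \<in> V \<Longrightarrow> W (s + t) f = W s (W t f)"
    and Wg: "\<And>f g. f \<in> V \<Longrightarrow> ((\<lambda>h. (1 / h) *\<^sub>R (W h f - f)) \<longlongrightarrow> g) (at_right 0) \<longleftrightarrow> (f \<in> D \<and> g = A f)"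
    and Wbd: "\<exists>K. \<forall>f\<in>V. norm (W t f) \<le> K * norm f"
    using W t unfolding semigroup_gen_def by blast+
  obtain K where K: "\<forall>f\<in>V. norm (W t f) \<le> K * norm f" using Wbd by blast
  have csV: "csubspace V" using Wlin unfolding clinear_on_def by blast
  have sV: "subspace V" by (rule csubspace_imp_subspace[OF csV])
  note Vc = subspace_diff[OF sV] subspace_scale[OF sV]
  have Wsc: "W t (r *\<^sub>R x) = r *\<^sub>R W t x" if "x \<in> V" for r x
    using Wlin that unfolding clinear_on_def by (simp add: scaleR_scaleC)
  have Wdiff: "W t (x - y) = W t x - W t y" if "x \<in> V" "y \<in> V" for x y
  proof -
    have "W t ((x - y) + y) = W t (x - y) + W t y"
      using Wlin Vc(1)[OF that] that(2) unfolding clinear_on_def by blast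
    then show ?thesis by (simp add: algebra_simps)
  qed
  let ?q = "\<lambda>h. (1 / h) *\<^sub>R (W h f - f)"
  have q: "?q h \<in> V" "W t (?q h) = (1 / h) *\<^sub>R (W h (W t f) - W t f)" if "0 < h" for h
    using that t f(1) Wsg[of t h f] Wsg[of h t f] by (simp_all add: Vc WV Wsc Wdiff add.commute)
  have "((\<lambda>h. W t (?q h) - W t (A f)) \<longlongrightarrow> 0) (at_right 0)"
  proof (rule Lim_null_comparison)
    show "((\<lambda>h. K * norm (?q h - A f)) \<longlongrightarrow> 0) (at_right 0)"
      using Wg[OF f(1)] f(2) by (intro tendsto_mult_right_zero tendsto_norm_zero LIM_zero) blast
    show "\<forall>\<^sub>F h in at_right 0. norm (W t (?q h) - W t (A f)) \<le> K * norm (?q h - A f)"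
    proof (rule eventually_mono[OF eventually_at_right_less[of "0::real"]])
      show "norm (W t (?q h) - W t (A f)) \<le> K * norm (?q h - A f)" if "0 < h" for h
        using K Vc(1)[OF q(1)[OF that] AV] unfolding Wdiff[OF q(1)[OF that] AV, symmetric] by blast
    qed
  qed
  then have "((\<lambda>h. W t (?q h)) \<longlongrightarrow> W t (A f)) (at_right 0)" by (rule LIM_zero_cancel)
  then have "((\<lambda>h. (1 / h) *\<^sub>R (W h (W t f) - W t f)) \<longlongrightarrow> W t (A f)) (at_right 0)"
  proof (rule Lim_transform_eventually)
    show "\<forall>\<^sub>F h in at_right 0. W t (?q h) = (1 / h) *\<^sub>R (W h (W t f) - W t f)"
      by (rule eventually_mono[OF eventually_at_right_less[of "0::real"]]) (rule q(2))
  qed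
  then show ?thesis using Wg[OF WV[OF t f(1)]] by auto
qed

context krein_setting begin

text \<open>Both semigroups commute, so with \<open>h = t / n\<close> the difference \<open>W t f - S t f\<close> telescopes into \<open>n\<close>
  terms, each bounded by a multiple of \<open>W h f - S h f = o(h)\<close>.\<close>
lemma semigroup_generator_unique:
  assumes red: "reducing Q" and V: "V = {x. Q x = x}"
    and A: "\<And>f. f \<in> DL \<Longrightarrow> Q f = f \<Longrightarrow> A f = - T f"
    and W: "semigroup_gen V (DL \<inter> V) A W" and t: "0 \<le> t" and f: "f \<in> V"
  shows "W t f = S t f"
proof -
  note Q = reducingD[OF red]
  interpret Q: bounded_linear Q by (rule Q)
  have QV: "Q x \<in> V" "x \<in> V \<Longrightarrow> Q x = x" for x using Q(3) by (auto simp: V)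
  have WV: "\<And>t f. 0 \<le> t \<Longrightarrow> f \<in> V \<Longrightarrow> W t f \<in> V" and W0: "\<And>f. f \<in> V \<Longrightarrow> W 0 f = f"
    and Wsg: "\<And>s t f. 0 \<le> s \<Longrightarrow> 0 \<le> t \<Longrightarrow> f \<in> V \<Longrightarrow> W (s + t) f = W s (W t f)"
    and Wlin: "\<And>t. 0 \<le> t \<Longrightarrow> clinear_on V (W t) \<and> (\<exists>K. \<forall>f\<in>V. norm (W t f) \<le> K * norm f)"
    and Wg: "\<And>f. f \<in> V \<Longrightarrow> f \<in> DL \<Longrightarrow> ((\<lambda>h. (1 / h) *\<^sub>R (W h f - f)) \<longlongrightarrow> A f) (at_right 0)"
    using W unfolding semigroup_gen_def by blast+
  have WQ: "bounded_linear (\<lambda>x. W r (Q x))" if r: "0 \<le> r" for r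
  proof -
    obtain K where "\<forall>f\<in>V. norm (W r f) \<le> K * norm f" using Wlin[OF r] by blast
    then show ?thesis using bounded_linear_restriction[OF _ _ Q(1) QV(1)] Wlin[OF r] by blast
  qed
  have comm: "W r (S s g) = S s (W r g)" if r: "0 \<le> r" and s: "0 \<le> s" and g: "g \<in> V" for r s g
  proof -
    \<comment> \<open>\<open>W r\<close> preserves the domain of its generator and commutes with it;
      composed with \<open>Q\<close> it becomes an admissible commuting operator for
      \<open>S_commute\<close>.\<close>
    have "W r (Q (S s g)) = S s (W r (Q g))"
    proof (rule S_commute[where Q = "\<lambda>x. W r (Q x)", OF WQ[OF r] _ _ s])
      fix x assume x: "x \<in> DL"
      have AQ: "A (Q x) = - Q (T x)" using A[of "Q x"] Q(3,5,6)[of x] x by simp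
      then have "A (Q x) \<in> V" using Q(3) by (simp add: V Q.neg)
      from semigroup_commutes_with_generator[OF W QV(1) _ r this]
      have wx: "W r (Q x) \<in> DL" "A (W r (Q x)) = W r (- Q (T x))" using Q(5)[OF x] QV(1) AQ by auto
      show "W r (Q x) \<in> DL" by (rule wx)
      have "- T (W r (Q x)) = W r (- Q (T x))" using wx A[OF wx(1)] WV[OF r QV(1)] QV(2) by simp
      also have "\<dots> = - W r (Q (T x))"
        using linear_neg[OF bounded_linear.linear[OF WQ[OF r]], of "T x"] by (simp add: Q.neg)
      finally show "T (W r (Q x)) = W r (Q (T x))" by simp
    qed
    then show ?thesis using S_reducing[OF red s, of g] QV(2)[OF g] by simp
  qed
  obtain M where M: "\<forall>s\<in>{0..t}. \<forall>f\<in>V. norm (W s f) \<le> M * norm f"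
    using semigroup_locally_bounded[OF W Q(1) QV] by blast
  obtain N where N: "N > 0" "\<And>t f. 0 \<le> t \<Longrightarrow> norm (S t f) \<le> N * norm f" using S_bounded by blast
  have SV: "S s g \<in> V" if "0 \<le> s" "g \<in> V" for s g
    using S_reducing[OF red that(1), of g] that QV(2)[OF that(2)] by (simp add: V)
  \<comment> \<open>The extra factor with index \<open>j\<close> collects the operators
    \<open>S h\<close> split off in the induction. They are bounded together by \<open>N\<close>,
    where separate bounds would accumulate to a power of \<open>N\<close>.\<close>
  have telescope: "norm (S (real j * h) (W (real n * h) g - S (real n * h) g)) \<le> real n * (N * (M * norm (W h g - S h g)))"
    if g: "g \<in> V" and h: "0 \<le> h" and n: "real n * h \<le> t" for g h n j
    using n
  proof (induction n arbitrary: j)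
    case 0
    then show ?case using W0[OF g] linear_0[OF bounded_linear.linear[OF S_bounded_linear]] h by simp
  next
    case (Suc n)
    have n: "0 \<le> real n * h" "real n * h \<le> t" "0 \<le> real j * h" using Suc.prems h by (auto simp: algebra_simps)
    interpret Sj: bounded_linear "S (real j * h)" using n by (intro S_bounded_linear)
    interpret Sh: bounded_linear "S h" using h by (intro S_bounded_linear)
    interpret Wn: bounded_linear "\<lambda>x. W (real n * h) (Q x)" using n by (intro WQ)
    let ?d = "W h g - S h g"
    have dV: "?d \<in> V" using WV[OF h g] SV[OF h g] by (simp add: V Q.diff)
    have "W (real (Suc n) * h) g = W (real n * h) (W h g)"
      using Wsg[OF n(1) h g] by (simp add: algebra_simps)
    moreover have "S (real (Suc n) * h) g = S h (S (real n * h) g)"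
      using S_semigroup[OF h n(1), of g] by (simp add: algebra_simps)
    moreover have "W (real n * h) (W h g) = W (real n * h) ?d + S h (W (real n * h) g)"
      using Wn.diff[of "W h g" "S h g"] comm[OF n(1) h g] QV(2) WV[OF h g] SV[OF h g] dV by simp
    ultimately have "W (real (Suc n) * h) g - S (real (Suc n) * h) g
        = W (real n * h) ?d + S h (W (real n * h) g - S (real n * h) g)" by (simp add: Sh.diff)
    moreover have "S (real j * h) (S h x) = S (real (Suc j) * h) x" for x
      using S_semigroup[OF n(3) h, of x] by (simp add: algebra_simps)
    ultimately have "norm (S (real j * h) (W (real (Suc n) * h) g - S (real (Suc n) * h) g))
        = norm (S (real j * h) (W (real n * h) ?d) + S (real (Suc j) * h) (W (real n * h) g - S (real n * h) g))"
      by (simp only: Sj.add)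
    also have "\<dots> \<le> N * (M * norm ?d) + real n * (N * (M * norm ?d))"
    proof (rule norm_triangle_mono)
      have "norm (S (real j * h) (W (real n * h) ?d)) \<le> N * norm (W (real n * h) ?d)" by (rule N(2)[OF n(3)])
      also have "\<dots> \<le> N * (M * norm ?d)" using N(1) M n dV by (intro mult_left_mono) auto
      finally show "norm (S (real j * h) (W (real n * h) ?d)) \<le> N * (M * norm ?d)" .
    qed (rule Suc.IH[OF n(2)])
    also have "\<dots> = real (Suc n) * (N * (M * norm ?d))" by (simp only: of_nat_Suc distrib_right mult_1)
    finally show ?case .
  qed
  have D: "W t g = S t g" if g: "g \<in> V" "g \<in> DL" for g
  proof (cases "t = 0")
    case False
    then have t0: "0 < t" using t by simp
    let ?q = "\<lambda>h. norm ((1 / h) *\<^sub>R (W h g - g) - (1 / h) *\<^sub>R (S h g - g))"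
    let ?h = "\<lambda>n. t / real (Suc n)"
    have Ag: "A g = - T g" using A[OF g(2)] QV(2)[OF g(1)] by simp
    then have "((\<lambda>h. (1 / h) *\<^sub>R (S h g - g)) \<longlongrightarrow> A g) (at_right 0)" using S_generator[of g "A g"] g(2) by blast
    then have "(?q \<longlongrightarrow> norm (A g - A g)) (at_right 0)" by (intro tendsto_intros Wg g)
    moreover have "filterlim ?h (at_right 0) sequentially"
      unfolding filterlim_at
      using t0 tendsto_mult_right_zero[OF LIMSEQ_Suc[OF lim_1_over_n], of t] by (auto intro!: always_eventually)
    ultimately have "(\<lambda>n. ?q (?h n)) \<longlonglongrightarrow> 0" using filterlim_compose by force
    then have "(\<lambda>n. N * M * t * ?q (?h n)) \<longlonglongrightarrow> 0" by (rule tendsto_mult_right_zero)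
    moreover have "norm (W t g - S t g) \<le> N * M * t * ?q (?h n)" for n
    proof -
      have scale: "norm (W h g - S h g) = h * ?q h" if "0 < h" for h
      proof -
        have "?q h = norm ((1 / h) *\<^sub>R (W h g - S h g))" by (simp add: scaleR_diff_right[symmetric])
        then show ?thesis using that by simp
      qed
      have h: "0 < ?h n" "real (Suc n) * ?h n = t" using t0 by (auto simp del: of_nat_Suc)
      have "norm (W t g - S t g) \<le> real (Suc n) * (N * (M * (?h n * ?q (?h n))))"
        using telescope[OF g(1) less_imp_le[OF h(1)], of "Suc n" 0] h(2) scale[OF h(1)] by simp
      also have "\<dots> = N * M * (real (Suc n) * ?h n) * ?q (?h n)" by (simp only: ac_simps)
      finally show ?thesis unfolding h(2) .
    qed
    ultimately have "norm (W t g - S t g) \<le> 0" by (intro LIMSEQ_le_const) auto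
    then show ?thesis by simp
  qed (use W0 g in simp)
  have "W t (Q f) = S t (Q f)"
    by (rule linear_eq_on_D[OF WQ[OF t] bounded_linear_compose[OF S_bounded_linear[OF t] Q(1)]])
      (use D QV(1) Q(5) in blast)
  then show ?thesis using QV f by simp
qed

lemma op_exp_eq:
  assumes red: "reducing Q" and V: "V = {x. Q x = x}"
    and A: "\<And>f. f \<in> DL \<Longrightarrow> Q f = f \<Longrightarrow> A f = - T f"
    and t: "0 \<le> t" and f: "f \<in> V"
  shows "op_exp V (DL \<inter> V) A t f = S t f"
proof -
  let ?W = "\<lambda>t f. if 0 \<le> t \<and> f \<in> V then S t f else 0"
  have "op_exp V (DL \<inter> V) A = ?W"
    unfolding op_exp_def
  proof (rule the_equality)
    show "semigroup_gen V (DL \<inter> V) A ?W" by (rule semigroup_generator_exists[OF red V A])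
    fix W assume W: "semigroup_gen V (DL \<inter> V) A W"
    show "W = ?W"
    proof (intro ext)
      fix t f
      show "W t f = ?W t f"
      proof (cases "0 \<le> t \<and> f \<in> V")
        case True
        then show ?thesis using semigroup_generator_unique[OF red V A W] by simp
      next
        case False
        then have "t < 0 \<or> f \<notin> V" by auto
        then show ?thesis using W False unfolding semigroup_gen_def by auto
      qed
    qed
  qed
  then show ?thesis using t f by simp
qed

end

section \<open>The spectrum on the two eigenspaces of the symmetry\<close>

lemma csubspace_closure:
  assumes S: "csubspace (S :: 'a::chilbert set)" shows "csubspace (closure S)"
  unfolding csubspace_def
proof (intro conjI ballI allI)
  show "0 \<in> closure S" using S closure_subset unfolding csubspace_def by blast
  fix x assume "x \<in> closure S"
  then obtain s where s: "\<And>n. s n \<in> S" "s \<longlonglongrightarrow> x" unfolding closure_sequential by blast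
  show "x + y \<in> closure S" if y: "y \<in> closure S" for y
  proof -
    obtain t where t: "\<And>n. t n \<in> S" "t \<longlonglongrightarrow> y" using y unfolding closure_sequential by blast
    show ?thesis unfolding closure_sequential
      using s(1) t(1) S tendsto_add[OF s(2) t(2)] unfolding csubspace_def
      by (intro exI[of _ "\<lambda>n. s n + t n"]) simp
  qed
  show "scaleC k x \<in> closure S" for k
    unfolding closure_sequential
    using s(1) S bounded_linear.tendsto[OF bounded_linear_scaleC s(2), of k] unfolding csubspace_def
    by (intro exI[of _ "\<lambda>n. scaleC k (s n)"]) simp
qed

context krein_setting begin

section \<open>Lower bounds for \<open>T - z\<close> in place of the spectrum\<close>

definition bounded_below :: "('a \<Rightarrow> 'a) \<Rightarrow> complex \<Rightarrow> bool" where
  "bounded_below Q z \<longleftrightarrow> (\<exists>K. \<forall>x\<in>DL. Q x = x \<longrightarrow> norm x \<le> K * norm (T x - scaleC z x))"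

lemma bounded_belowE:
  assumes "bounded_below Q z"
  obtains K where "K > 0" "\<And>x. x \<in> DL \<Longrightarrow> Q x = x \<Longrightarrow> norm x \<le> K * norm (T x - scaleC z x)"
proof -
  obtain K where K: "\<And>x. x \<in> DL \<Longrightarrow> Q x = x \<Longrightarrow> norm x \<le> K * norm (T x - scaleC z x)"
    using assms unfolding bounded_below_def by blast
  have "norm x \<le> (\<bar>K\<bar> + 1) * norm (T x - scaleC z x)" if "x \<in> DL" "Q x = x" for x
    by (rule order_trans[OF K[OF that]]) (intro mult_right_mono, auto)
  then show thesis by (intro that[of "\<bar>K\<bar> + 1"]) auto
qed

lemma bounded_below_off_halfline':
  assumes "Im z \<noteq> 0 \<or> Re z < 0" shows "bounded_below Q z"
proof -
  obtain K where "\<forall>x\<in>DL. norm x \<le> K * norm (T x - scaleC z x)"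
    using bounded_below_off_halfline[OF assms] by (elim exE)
  then show ?thesis unfolding bounded_below_def by (intro exI[of _ K]) simp
qed

text \<open>For real \<open>z\<close> the kernel condition at \<open>cnj z = z\<close> is part of
  the lower bound; for other \<open>z\<close> solvability is already known. Hence being bounded
  below decides whether \<open>z\<close> is a regular point.\<close>

lemma bounded_below_onto:
  assumes red: "reducing Q" and bb: "bounded_below Q z" and y: "Q y = y"
  shows "\<exists>x\<in>DL. Q x = x \<and> T x - scaleC z x = y"
proof (cases "Im z = 0")
  case True
  obtain K where K: "K > 0" "\<And>x. x \<in> DL \<Longrightarrow> Q x = x \<Longrightarrow> norm x \<le> K * norm (T x - scaleC z x)"
    using bb by (rule bounded_belowE) blast
  have "cnj z = z" using True by (simp add: complex_eq_iff)
  then show ?thesis using K(2) by (intro range_onto[OF red K(2) _ y]) force+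
next
  case False
  then show ?thesis using onto_off_halfline[OF red _ y] by blast
qed

lemma bounded_below_open:
  assumes bb: "bounded_below Q z"
  shows "\<exists>d>0. \<forall>w. cmod (w - z) < d \<longrightarrow> bounded_below Q w"
proof -
  obtain K where K: "K > 0" "\<And>x. x \<in> DL \<Longrightarrow> Q x = x \<Longrightarrow> norm x \<le> K * norm (T x - scaleC z x)"
    using bb by (rule bounded_belowE) blast
  \<comment> \<open>Within this radius the perturbation costs at most half of \<open>norm x\<close>,
    whence the constant \<open>2 * K\<close>.\<close>
  have "bounded_below Q w" if w: "cmod (w - z) < 1 / (2 * K)" for w
    unfolding bounded_below_def
  proof (intro exI ballI impI)
    fix x assume x: "x \<in> DL" "Q x = x"
    have "T x - scaleC z x = (T x - scaleC w x) + scaleC (w - z) x"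
      using scaleC_add_left[of "w - z" z x] by simp
    then have "norm (T x - scaleC z x) \<le> norm (T x - scaleC w x) + cmod (w - z) * norm x"
      by (metis norm_triangle_ineq norm_scaleC)
    also have "cmod (w - z) * norm x \<le> 1 / (2 * K) * norm x" using w by (intro mult_right_mono) auto
    finally have "K * norm (T x - scaleC z x) \<le> K * (norm (T x - scaleC w x) + 1 / (2 * K) * norm x)"
      using K(1) by (intro mult_left_mono) auto
    also have "\<dots> = K * norm (T x - scaleC w x) + norm x / 2" using K(1) by (simp add: field_simps)
    finally show "norm x \<le> (2 * K) * norm (T x - scaleC w x)" using K(2)[OF x] by simp
  qed
  then show ?thesis using K(1) by (intro exI[of _ "1 / (2 * K)"]) auto
qed

text \<open>At \<open>z = 0\<close> no lower bound is available, but injectivity of \<open>L\<close>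
  still makes the orthogonal complement trivial.\<close>

lemma range_dense:
  assumes red: "reducing Q" and y: "Q y = y"
  shows "\<exists>z. (\<forall>n::nat. z n \<in> DL \<and> Q (z n) = z n) \<and> (\<lambda>n. T (z n)) \<longlonglongrightarrow> y"
proof -
  interpret Q: bounded_linear Q by (rule reducingD[OF red])
  have "closure (range_space Q 0) = UNIV"
  proof (rule closed_csubspace_eq_UNIV)
    show "csubspace (closure (range_space Q 0))"
      by (rule csubspace_closure[OF range_space_csubspace[OF red]])
    fix v assume v: "\<And>z. z \<in> closure (range_space Q 0) \<Longrightarrow> cinner z v = 0"
    show "v = 0"
    proof (rule range_space_orthogonal[OF red])
      show "g = 0" if "g \<in> DL" "T g = scaleC (cnj 0) g" for g
        using L_injective[OF that(1)] that(2) G_T[of g] by (simp add: G.zero)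
    qed (use v closure_subset in blast)
  qed simp
  then obtain w where w: "\<And>n. w n \<in> range_space Q 0" "w \<longlonglongrightarrow> y" using closure_sequential[of y] by blast
  have "\<forall>n. \<exists>z. z \<in> DL \<and> Q z = z \<and> T z = Q (w n)" using w(1) unfolding range_space_def by force
  then obtain z where z: "\<And>n. z n \<in> DL \<and> Q (z n) = z n \<and> T (z n) = Q (w n)" by metis
  moreover have "(\<lambda>n. Q (w n)) \<longlonglongrightarrow> y" using Q.tendsto[OF w(2)] y by simp
  ultimately show ?thesis by (intro exI[of _ z]) auto
qed

text \<open>With \<open>\<kappa> = \<mu> / 2\<close> the claim says that \<open>F = T - \<kappa>\<close> is bounded below by \<open>\<kappa>\<close>. If the best lower
  bound \<open>\<delta>\<close> were smaller, then \<open>F\<^sup>2 - \<delta>\<^sup>2 = (T - (\<kappa> + \<delta>)) (T - (\<kappa> - \<delta>))\<close> would still be bounded below,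
  and \<open>\<delta>\<close> could be improved.\<close>
lemma gap_positivity:
  assumes red: "reducing Q" and mu: "0 < \<mu>"
    and bb: "\<And>\<kappa>. 0 < \<kappa> \<Longrightarrow> \<kappa> \<le> \<mu> \<Longrightarrow> bounded_below Q (of_real \<kappa>)"
    and x0: "x0 \<in> DL" "Q x0 = x0"
  shows "\<mu> * b (T x0) x0 \<le> b (T x0) (T x0)"
proof (rule ccontr)
  assume neg: "\<not> ?thesis"
  note Q = reducingD[OF red]
  interpret Q: bounded_linear Q by (rule Q)
  define \<kappa> where "\<kappa> = \<mu> / 2"
  define F where "F x = T x - \<kappa> *\<^sub>R x" for x
  define X where "X = {x \<in> DL. Q x = x}"
  have X: "x \<in> DL" "Q x = x" "Q (T x) = T x" if "x \<in> X" for x using that Q(6)[of x] by (auto simp: X_def)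
  have below: "\<exists>K>0. \<forall>x\<in>X. norm x \<le> K * norm (T x - k *\<^sub>R x)" if "0 < k" "k \<le> \<mu>" for k
    using bounded_belowE[OF bb[OF that]] unfolding X_def
    by (metis (mono_tags, lifting) mem_Collect_eq scaleR_scaleC)
  have k: "0 < \<kappa>" "\<kappa> \<le> \<mu>" using mu by (auto simp: \<kappa>_def)
  have onto: "\<exists>w\<in>X. F w = x" if "x \<in> X" for x
    using bounded_below_onto[OF red bb[OF k] X(2)[OF that]] by (auto simp: X_def F_def scaleR_scaleC)
  obtain Kb where Kb: "Kb > 0" "\<And>x. b x x \<le> Kb * (norm x)\<^sup>2" using upper by blast
  \<comment> \<open>Translates a lower bound in norm into one for \<open>b\<close>, at the cost of
    the constants comparing the two.\<close>
  have gain: "c / (Kb * C\<^sup>2) * b x x \<le> b v v" if C: "C > 0" and le: "norm x \<le> C * norm v" for x v C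
  proof -
    have "b x x \<le> Kb * (C * norm v)\<^sup>2"
      using Kb le by (intro order_trans[OF Kb(2)] mult_left_mono power_mono) auto
    also have "\<dots> \<le> Kb * (C\<^sup>2 * (b v v / c))"
      unfolding power_mult_distrib using Kb norm_sq_le[of v] by (intro mult_left_mono) auto
    finally show ?thesis using Kb C c_pos by (simp add: field_simps)
  qed
  \<comment> \<open>\<open>M\<close> collects the squares of the lower bounds for \<open>F\<close>;
    its supremum \<open>p0\<close> is the square of \<delta>. A violation of the claim at
    \<open>x0\<close> amounts to \<open>p0 < \<kappa>\<^sup>2\<close>, because \<mu> = 2
    \<kappa>.\<close>
  define M where "M = {p. \<forall>x\<in>X. p * b x x \<le> b (F x) (F x)}"
  have "b (F x0) (F x0) = b (T x0) (T x0) - \<mu> * b (T x0) x0 + \<kappa>\<^sup>2 * b x0 x0"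
    by (simp add: F_def b_diff_sq b.scaleR_left b.scaleR_right \<kappa>_def power2_eq_square)
  then have small: "b (F x0) (F x0) < \<kappa>\<^sup>2 * b x0 x0" using neg by simp
  then have pos: "b x0 x0 > 0"
    using nonneg[of "F x0"] nonneg[of x0] by (metis less_le_trans mult_eq_0_iff not_less order_le_less)
  have x0X: "x0 \<in> X" using x0 by (simp add: X_def)
  have M_le: "p \<le> b (F x0) (F x0) / b x0 x0" if "p \<in> M" for p
    using that x0X pos by (auto simp: M_def field_simps)
  obtain K0 where K0: "K0 > 0" "\<forall>x\<in>X. norm x \<le> K0 * norm (F x)" using below[OF k] unfolding F_def by blast
  define p0 where "p0 = Sup M"
  have p0_upper: "p \<le> p0" if "p \<in> M" for p
    unfolding p0_def by (rule cSup_upper[OF that bdd_aboveI[OF M_le]])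
  have start: "c / (Kb * K0\<^sup>2) \<in> M" unfolding M_def using gain[OF K0(1)] K0(2) by blast
  have p0_pos: "0 < p0" using p0_upper[OF start] c_pos Kb K0 by (smt (verit) divide_pos_pos mult_pos_pos zero_less_power)
  have "p0 \<le> b (F x0) (F x0) / b x0 x0" unfolding p0_def by (rule cSup_least) (use start M_le in auto)
  also have "\<dots> < \<kappa>\<^sup>2" using small pos by (simp add: field_simps)
  finally have p0_less: "p0 < \<kappa>\<^sup>2" .
  have p0M: "p0 * b x x \<le> b (F x) (F x)" if x: "x \<in> X" for x
  proof (cases "b x x = 0")
    case False
    then have bx: "b x x > 0" using nonneg[of x] by simp
    have "p0 \<le> b (F x) (F x) / b x x"
      unfolding p0_def
    proof (rule cSup_least)
      show "M \<noteq> {}" using start by blast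
      show "p \<le> b (F x) (F x) / b x x" if "p \<in> M" for p using that x bx by (auto simp: M_def field_simps)
    qed
    then show ?thesis using bx by (simp add: field_simps)
  qed (simp add: nonneg)
  define \<delta> where "\<delta> = sqrt p0"
  have d: "0 < \<delta>" "\<delta> < \<kappa>" "\<delta> * \<delta> = p0"
    using p0_pos real_sqrt_less_mono[OF p0_less] k by (auto simp: \<delta>_def)
  \<comment> \<open>Since 0 < \<delta> < \<kappa> = \<mu> / 2, both \<kappa> + \<delta> and \<kappa>
    - \<delta> lie in the interval where lower bounds are assumed.\<close>
  obtain K1 where K1: "K1 > 0" "\<forall>x\<in>X. norm x \<le> K1 * norm (T x - (\<kappa> + \<delta>) *\<^sub>R x)"
    using below[of "\<kappa> + \<delta>"] d by (auto simp: \<kappa>_def)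
  obtain K2 where K2: "K2 > 0" "\<forall>x\<in>X. norm x \<le> K2 * norm (T x - (\<kappa> - \<delta>) *\<^sub>R x)"
    using below[of "\<kappa> - \<delta>"] d by (auto simp: \<kappa>_def)
  define C where "C = (1 + \<delta> * K2) * K1"
  have C: "C > 0" unfolding C_def using d K1 K2 by (intro mult_pos_pos add_pos_pos) auto
  have "p0 + c / (Kb * C\<^sup>2) \<in> M"
    unfolding M_def
  proof (intro CollectI ballI)
    fix x assume x: "x \<in> X"
    obtain w where w: "w \<in> X" "F w = x" using onto[OF x] by blast
    \<comment> \<open>With \<open>x = F w\<close>, \<open>?u\<close> is
      \<open>(F + \<delta>) w\<close> and \<open>?v\<close> is \<open>(F - \<delta>) ?u\<close>, so
      two lower bounds in succession control \<open>w\<close> and \<open>x\<close> by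
      \<open>?v\<close>. Expanding \<open>b ?v ?v\<close> with \<open>p0 * b w w \<le> b x x\<close>
      then shows the gain over \<open>p0\<close>.\<close>
    let ?v = "F x - p0 *\<^sub>R w" and ?u = "x + \<delta> *\<^sub>R w"
    have u: "?u \<in> X" "?u = T w - (\<kappa> - \<delta>) *\<^sub>R w"
      using X[OF x] X[OF w(1)] w(2) by (auto simp: X_def D_closed Q.add Q.scaleR F_def algebra_simps)
    have "?v = T ?u - (\<kappa> + \<delta>) *\<^sub>R ?u"
      using X[OF x] X[OF w(1)] w(2) by (simp add: T_add T_scaleR D_closed F_def d(3)[symmetric] algebra_simps)
    then have "norm ?u \<le> K1 * norm ?v" using K1(2) u(1) by simp
    moreover have "norm w \<le> K2 * norm ?u" using K2(2) w(1) u(2) by simp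
    then have "\<delta> * norm w \<le> \<delta> * (K2 * norm ?u)" using d(1) by (intro mult_left_mono) auto
    moreover have "norm x \<le> norm ?u + \<delta> * norm w" using norm_triangle_ineq4[of ?u "\<delta> *\<^sub>R w"] d(1) by simp
    ultimately have "norm x \<le> (1 + \<delta> * K2) * norm ?u" by (simp add: algebra_simps)
    also have "\<dots> \<le> (1 + \<delta> * K2) * (K1 * norm ?v)"
      using \<open>norm ?u \<le> K1 * norm ?v\<close> d(1) K2(1) by (intro mult_left_mono) auto
    finally have "norm x \<le> C * norm ?v" by (simp add: C_def mult.assoc)
    from gain[OF C this] have "c / (Kb * C\<^sup>2) * b x x \<le> b ?v ?v" .
    moreover have "b ?v ?v \<le> b (F x) (F x) - p0 * b x x"
    proof -
      have "b (F x) w = b x (F w)"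
        using T_sym[OF X(1)[OF x] X(1)[OF w(1)]]
        by (simp add: F_def b.diff_left b.diff_right b.scaleR_left b.scaleR_right)
      then have "b ?v ?v = b (F x) (F x) - 2 * p0 * b x x + p0 * (p0 * b w w)"
        using w(2) by (simp add: b_diff_sq b.scaleR_left b.scaleR_right)
      moreover have "p0 * (p0 * b w w) \<le> p0 * b x x"
        using p0M[OF w(1)] w(2) p0_pos by (intro mult_left_mono) auto
      ultimately show ?thesis by linarith
    qed
    ultimately show "(p0 + c / (Kb * C\<^sup>2)) * b x x \<le> b (F x) (F x)" unfolding distrib_right by linarith
  qed
  moreover have "0 < c / (Kb * C\<^sup>2)" using c_pos Kb C by simp
  ultimately show False using p0_upper by fastforce
qed

text \<open>For \<open>w = T z\<close> in the domain, Cauchy-Schwarz for the form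
  \<open>b (T x) y\<close> and the gap inequality for \<open>z\<close> give
  \<open>\<mu> * b w w \<le> b (T w) w\<close>. So \<open>T\<close> is at least \<mu> on its range,
  which is dense; the resolvents stay bounded as their parameter tends to 0, and no spectrum is left
  at 0.\<close>

lemma bounded_below_zero:
  assumes red: "reducing Q" and mu: "0 < \<mu>"
    and bb: "\<And>\<kappa>. 0 < \<kappa> \<Longrightarrow> \<kappa> \<le> \<mu> \<Longrightarrow> bounded_below Q (of_real \<kappa>)"
  shows "bounded_below Q 0"
proof -
  note Q = reducingD[OF red]
  interpret Q: bounded_linear Q by (rule Q)
  have T_CS: "(b (T x) y)\<^sup>2 \<le> b (T x) x * b (T y) y" if xy: "x \<in> DL" "y \<in> DL" for x y
  proof (rule quadratic_nonneg_discriminant[OF _ T_nonneg[OF xy(2)]])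
    fix t
    have "0 \<le> b (T (x + t *\<^sub>R y)) (x + t *\<^sub>R y)" using xy by (intro T_nonneg D_closed) auto
    also have "\<dots> = b (T x) x + 2 * t * b (T x) y + t\<^sup>2 * b (T y) y"
      using xy T_sym[OF xy] sym[of x "T y"]
      by (simp add: T_add T_scaleR D_closed b.add_left b.add_right b.scaleR_left b.scaleR_right algebra_simps power2_eq_square)
    finally show "0 \<le> b (T x) x + 2 * t * b (T x) y + t\<^sup>2 * b (T y) y" .
  qed
  have ran: "\<mu> * b w w \<le> b (T w) w" if z: "z \<in> DL" "Q z = z" and w: "w = T z" "w \<in> DL" for z w
  proof (cases "w = 0")
    case False
    then have pos: "b w w > 0" using zero_if_nonpos[of w] by (meson not_le)
    have "(b w w)\<^sup>2 \<le> b (T z) z * b (T w) w" using T_CS[OF z(1) w(2)] w(1) by simp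
    then have "\<mu> * (b w w)\<^sup>2 \<le> (\<mu> * b (T z) z) * b (T w) w" using mu by simp
    also have "\<dots> \<le> b w w * b (T w) w"
      using gap_positivity[OF red mu bb z] T_nonneg[OF w(2)] unfolding w(1) by (intro mult_right_mono) auto
    finally have "b w w * (\<mu> * b w w) \<le> b w w * b (T w) w" by (simp add: power2_eq_square ac_simps)
    then show ?thesis using pos by simp
  qed (use b.zero_left in \<open>simp add: b.zero_right\<close>)
  \<comment> \<open>The resolvent of \<open>T z\<close> is \<open>T\<close> of the resolvent of
    \<open>z\<close>: it lies in the range and in the domain, where the inequality
    \<open>ran\<close> holds. Density of the range extends the bound to all \<open>y\<close>,
    uniformly in \<open>l\<close>.\<close>
  have est: "\<mu>\<^sup>2 * b (resolvent l y) (resolvent l y) \<le> b y y" if l: "0 < l" and y: "Q y = y" for l y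
  proof -
    have core: "\<mu>\<^sup>2 * b (resolvent l (T z)) (resolvent l (T z)) \<le> b (T z) (T z)" if z: "z \<in> DL" "Q z = z" for z
    proof -
      let ?x = "resolvent l (T z)" and ?z' = "resolvent l z"
      have z': "?z' \<in> DL" "T ?z' + l *\<^sub>R ?z' = z" using resolvent[OF l] by auto
      have "Q ?z' = ?z'"
        by (rule resolvent_unique[OF l, symmetric])
          (use z' z(2) Q(5,6)[OF z'(1)] in \<open>auto simp: Q.add[symmetric] Q.scaleR[symmetric]\<close>)
      moreover have x: "?x = T ?z'"
        using resolvent_on_D[OF z(1) l] z'(2) by (metis add_diff_cancel_right')
      moreover have xD: "?x \<in> DL" by (rule resolvent_in_D[OF l])
      ultimately have "\<mu> * b ?x ?x \<le> b (T ?x) ?x" using ran[OF z'(1)] by blast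
      also have "\<dots> \<le> b (T ?x + l *\<^sub>R ?x) ?x" using l nonneg by (simp add: b.add_left b.scaleR_left)
      also have "\<dots> = b (T z) ?x" using resolvent_eq[OF l] by simp
      finally have "(\<mu> * b ?x ?x)\<^sup>2 \<le> (b (T z) ?x)\<^sup>2" using mu nonneg by (intro power_mono) auto
      also have "\<dots> \<le> b (T z) (T z) * b ?x ?x" by (rule Cauchy_Schwarz)
      finally have *: "(\<mu>\<^sup>2 * b ?x ?x) * b ?x ?x \<le> b (T z) (T z) * b ?x ?x"
        by (simp add: power2_eq_square ac_simps)
      show ?thesis
      proof (cases "b ?x ?x = 0")
        case False
        then have "b ?x ?x > 0" using nonneg[of ?x] by simp
        then show ?thesis using * by simp
      qed (use nonneg in simp)
    qed
    obtain z where z: "\<And>n::nat. z n \<in> DL \<and> Q (z n) = z n" "(\<lambda>n. T (z n)) \<longlonglongrightarrow> y"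
      using range_dense[OF red y] by blast
    note rl = bounded_linear.tendsto[OF resolvent_bounded_linear[OF l] z(2)]
    show ?thesis
    proof (rule LIMSEQ_le)
      show "(\<lambda>n. \<mu>\<^sup>2 * b (resolvent l (T (z n))) (resolvent l (T (z n)))) \<longlonglongrightarrow> \<mu>\<^sup>2 * b (resolvent l y) (resolvent l y)"
        by (rule tendsto_mult_left[OF b.tendsto[OF rl rl]])
      show "(\<lambda>n. b (T (z n)) (T (z n))) \<longlonglongrightarrow> b y y" by (rule b.tendsto[OF z(2) z(2)])
    qed (use core z(1) in blast)
  qed
  obtain Kb where Kb: "Kb > 0" "\<And>x. b x x \<le> Kb * (norm x)\<^sup>2" using upper by blast
  have "norm x \<le> sqrt (Kb / (c * \<mu>\<^sup>2)) * norm (T x - scaleC 0 x)" if x: "x \<in> DL" "Q x = x" for x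
  proof -
    \<comment> \<open>The bound is used for \<open>y = T x + l x\<close>, whose resolvent is
      \<open>x\<close>, and then \<open>l\<close> tends to 0.\<close>
    have "\<mu>\<^sup>2 * b x x \<le> b (T x + l *\<^sub>R x) (T x + l *\<^sub>R x)" if l: "l > 0" for l
      using est[OF l, of "T x + l *\<^sub>R x"] resolvent_unique[OF l x(1) refl] Q(6)[OF x(1)] x(2)
      by (simp add: Q.add Q.scaleR)
    then have ev: "\<forall>\<^sub>F l in at_right 0. \<mu>\<^sup>2 * b x x \<le> b (T x + l *\<^sub>R x) (T x + l *\<^sub>R x)"
      by (intro eventually_mono[OF eventually_at_right_less]) auto
    have "((\<lambda>l. b (T x + l *\<^sub>R x) (T x + l *\<^sub>R x)) \<longlongrightarrow> b (T x + 0 *\<^sub>R x) (T x + 0 *\<^sub>R x)) (at_right 0)"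
      by (intro b.tendsto tendsto_intros)
    then have "\<mu>\<^sup>2 * b x x \<le> b (T x + 0 *\<^sub>R x) (T x + 0 *\<^sub>R x)"
      using ev by (rule tendsto_lowerbound) simp
    then have "\<mu>\<^sup>2 * (c * (norm x)\<^sup>2) \<le> Kb * (norm (T x))\<^sup>2"
      using coercive_form.coercive[OF coercive_form_axioms, of x] Kb(2)[of "T x"] mu
      by (smt (verit) mult_left_mono zero_le_power2 add.right_neutral scaleR_zero_left)
    then have "(norm x)\<^sup>2 \<le> (sqrt (Kb / (c * \<mu>\<^sup>2)) * norm (T x))\<^sup>2"
      using Kb c_pos mu by (simp add: power_mult_distrib field_simps)
    then have "norm x \<le> sqrt (Kb / (c * \<mu>\<^sup>2)) * norm (T x)"
      by (rule power2_le_imp_le) (use Kb c_pos in simp)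
    then show ?thesis by simp
  qed
  then show ?thesis unfolding bounded_below_def by (intro exI[of _ "sqrt (Kb / (c * \<mu>\<^sup>2))"]) simp
qed

end

context krein_setting begin

section \<open>The two spectral projections and the spectra of the parts of \<open>B\<close>\<close>

text \<open>For \<open>s = 1\<close> and \<open>s = - 1\<close> these are the projections onto the
  eigenspaces of \<open>U\<close>. A signed parameter lets both halves share their proofs, with
  \<open>s * s = 1\<close> as the working hypothesis.\<close>

definition part :: "real \<Rightarrow> 'a \<Rightarrow> 'a" where
  "part s x = (1/2) *\<^sub>R (x + s *\<^sub>R U x)"

lemma part_U: "s * s = 1 \<Longrightarrow> part s (U x) = s *\<^sub>R part s x"
  by (simp add: part_def algebra_simps)

lemma U_part: "s * s = 1 \<Longrightarrow> U (part s x) = s *\<^sub>R part s x"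
  by (simp add: part_def U.scaleR U.add algebra_simps)

lemma part_fixed: assumes "s * s = 1" shows "part s x = x \<longleftrightarrow> U x = s *\<^sub>R x"
proof
  show "U x = s *\<^sub>R x" if "part s x = x" using U_part[OF assms, of x] that by simp
  show "part s x = x" if "U x = s *\<^sub>R x"
    using that assms by (simp add: part_def scaleR_2[symmetric])
qed

lemma part_opposite: assumes "s * s = 1" "U x = - s *\<^sub>R x" shows "part s x = 0"
  using assms by (simp add: part_def)

lemma part_sum: "part 1 x + part (- 1) x = x"
proof -
  have "part 1 x + part (- 1) x = (1/2) *\<^sub>R ((x + U x) + (x - U x))"
    unfolding part_def scaleR_right_distrib[symmetric] by simp
  also have "(x + U x) + (x - U x) = 2 *\<^sub>R x" by (simp add: scaleR_2)
  finally show ?thesis by simp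
qed

lemma part_reducing: assumes s: "s * s = 1" shows "reducing (part s)"
proof -
  have GU: "cinner (G (U x)) y = cinner (G x) (U y)" for x y
    by (simp add: G_def JU_sym)
  have "bounded_linear (part s)"
    unfolding part_def
    by (intro bounded_linear_compose[OF bounded_linear_scaleR_right] bounded_linear_add bounded_linear_ident
        bounded_linear_compose[OF bounded_linear_scaleR_right U_bounded_linear])
  moreover have "part s (scaleC z x) = scaleC z (part s x)" for z x
    by (simp add: part_def U_scaleC scaleC_scaleR scaleC_add_right)
  moreover have "part s (part s x) = part s x" for x
    using part_fixed[OF s] U_part[OF s] by blast
  moreover have "cinner (G (part s x)) y = cinner (G x) (part s y)" for x y
    by (simp add: part_def G.scaleR G.add cinner_scaleR cinner_add_left cinner_add_right GU)
  moreover have "part s x \<in> DL \<and> T (part s x) = part s (T x)" if "x \<in> DL" for x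
    using that U_DL[OF that] by (simp add: part_def D_closed T_scaleR T_add T_U)
  ultimately show ?thesis unfolding reducing_def bounded_clinear_op_iff by simp
qed

lemma JL: "x \<in> DL \<Longrightarrow> J (L x) = U (T x)"
  by (simp add: T_def)

lemma JL_on_part: "x \<in> DL \<Longrightarrow> U x = s *\<^sub>R x \<Longrightarrow> J (L x) = s *\<^sub>R T x"
  using T_U[of x] by (simp add: JL T_scaleR)

text \<open>The spectrum of \<open>T\<close> on the eigenspace of sign \<open>s\<close>, kept as a
  set of reals. Since \<open>B\<close> acts there as \<open>s T\<close>, multiplication by
  \<open>s\<close> gives the spectrum of that part of \<open>B\<close>.\<close>

definition spectral_set :: "real \<Rightarrow> real set" where
  "spectral_set s = {r. \<not> bounded_below (part s) (of_real r)}"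

lemma not_bounded_below_iff: "\<not> bounded_below (part s) z \<longleftrightarrow> (\<exists>r\<in>spectral_set s. z = of_real r)"
proof
  assume nb: "\<not> bounded_below (part s) z"
  then have "z = of_real (Re z)" using bounded_below_off_halfline'[of z "part s"] by (auto simp: complex_eq_iff)
  then show "\<exists>r\<in>spectral_set s. z = of_real r" using nb by (intro bexI[of _ "Re z"]) (auto simp: spectral_set_def)
qed (auto simp: spectral_set_def)

lemma spectral_set_nonneg: "r \<in> spectral_set s \<Longrightarrow> 0 \<le> r"
  using bounded_below_off_halfline'[of "of_real r" "part s"] by (force simp: spectral_set_def)

lemma closed_spectral_set: "closed (spectral_set s)"
  unfolding closed_def open_dist
proof (intro ballI)
  fix r assume "r \<in> - spectral_set s"
  then have "bounded_below (part s) (of_real r)" by (simp add: spectral_set_def)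
  from bounded_below_open[OF this] obtain d
    where d: "d > 0" "\<And>w. cmod (w - of_real r) < d \<Longrightarrow> bounded_below (part s) w" by blast
  have "r' \<in> - spectral_set s" if "dist r' r < d" for r'
    using d(2)[of "of_real r'"] that by (simp add: spectral_set_def dist_real_def flip: of_real_diff)
  then show "\<exists>e>0. \<forall>y. dist y r < e \<longrightarrow> y \<in> - spectral_set s" using d(1) by blast
qed

text \<open>Only the point 0 is in question. If it had a neighbourhood free of positive spectral
  points, \<open>bounded_below_zero\<close> would exclude it from the set.\<close>

lemma closure_spectral_set:
  assumes s: "s * s = 1"
  shows "closure (spectral_set s \<inter> {0<..}) = spectral_set s"
proof
  show "closure (spectral_set s \<inter> {0<..}) \<subseteq> spectral_set s"
    by (intro closure_minimal closed_spectral_set) auto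
  show "spectral_set s \<subseteq> closure (spectral_set s \<inter> {0<..})"
  proof
    fix r assume r: "r \<in> spectral_set s"
    show "r \<in> closure (spectral_set s \<inter> {0<..})"
    proof (cases "r = 0")
      case True
      have "\<exists>r'\<in>spectral_set s \<inter> {0<..}. dist r' 0 < e" if e: "e > 0" for e
      proof (rule ccontr)
        assume "\<not> ?thesis"
        then have bb: "bounded_below (part s) (of_real \<kappa>)" if "0 < \<kappa>" "\<kappa> \<le> e / 2" for \<kappa>
          using that e by (force simp: spectral_set_def)
        have "bounded_below (part s) 0"
          by (rule bounded_below_zero[OF part_reducing[OF s], of "e / 2"]) (use e bb in auto)
        then show False using r True by (simp add: spectral_set_def)
      qed
      then show ?thesis using True by (simp add: closure_approachable)
    next
      case False
      then show ?thesis using r spectral_set_nonneg[OF r] closure_subset by fastforce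
    qed
  qed
qed

lemma spectrum_part:
  assumes s: "s * s = 1" and V: "V = {x. U x = s *\<^sub>R x}"
  shows "spectrum_on V (DL \<inter> V) (\<lambda>f. J (L f)) = (\<lambda>r. of_real (s * r)) ` spectral_set s"
proof -
  note red = part_reducing[OF s]
  interpret Q: bounded_linear "part s" by (rule reducingD[OF red])
  have V': "x \<in> V \<longleftrightarrow> part s x = x" for x using part_fixed[OF s] by (simp add: V)
  have abs_s: "\<bar>s\<bar> = 1" using s by (metis abs_mult abs_one abs_mult_self_eq mult_cancel_left1 abs_ge_zero real_sqrt_abs2 real_sqrt_one)
  \<comment> \<open>On \<open>V\<close> the operator \<open>B\<close> is \<open>s T\<close>, and
    \<open>s * s = 1\<close> allows the factor \<open>s\<close> to be taken out of
    \<open>B - z\<close>.\<close>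
  have eq: "J (L x) - scaleC z x = s *\<^sub>R (T x - scaleC (of_real s * z) x)" if "x \<in> DL \<inter> V" for x z
  proof -
    have "s *\<^sub>R scaleC (of_real s * z) x = scaleC z x"
      using s by (simp add: scaleR_scaleC scaleC_scaleC mult.assoc[symmetric] flip: of_real_mult)
    then show ?thesis using JL_on_part[of x s] that by (simp add: V scaleR_diff_right)
  qed
  have norm_eq: "norm (J (L x) - scaleC z x) = norm (T x - scaleC (of_real s * z) x)" if "x \<in> DL \<inter> V" for x z
    using eq[OF that] abs_s by simp
  have "z \<notin> spectrum_on V (DL \<inter> V) (\<lambda>f. J (L f)) \<longleftrightarrow> bounded_below (part s) (of_real s * z)" for z
  proof
    assume "z \<notin> spectrum_on V (DL \<inter> V) (\<lambda>f. J (L f))"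
    then obtain K where K: "\<And>x. x \<in> DL \<inter> V \<Longrightarrow> norm x \<le> K * norm (J (L x) - scaleC z x)"
      unfolding spectrum_on_def by blast
    show "bounded_below (part s) (of_real s * z)"
      unfolding bounded_below_def
    proof (intro exI ballI impI)
      fix x assume "x \<in> DL" "part s x = x"
      then have x: "x \<in> DL \<inter> V" using V' by blast
      from K[OF x] show "norm x \<le> K * norm (T x - scaleC (of_real s * z) x)" unfolding norm_eq[OF x] .
    qed
  next
    assume bb: "bounded_below (part s) (of_real s * z)"
    obtain K where K: "\<And>x. x \<in> DL \<inter> V \<Longrightarrow> norm x \<le> K * norm (J (L x) - scaleC z x)"
    proof -
      obtain K where "\<And>x. x \<in> DL \<Longrightarrow> part s x = x \<Longrightarrow> norm x \<le> K * norm (T x - scaleC (of_real s * z) x)"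
        using bb bounded_belowE by blast
      then have "norm x \<le> K * norm (J (L x) - scaleC z x)" if "x \<in> DL \<inter> V" for x
        using V' that unfolding norm_eq[OF that] by blast
      then show thesis by (rule that)
    qed
    have "\<exists>!x. x \<in> DL \<inter> V \<and> J (L x) - scaleC z x = y" if y: "y \<in> V" for y
    proof -
      have "part s (s *\<^sub>R y) = s *\<^sub>R y" using y by (simp add: V' Q.scaleR)
      from bounded_below_onto[OF red bb this]
      obtain x where x: "x \<in> DL \<inter> V" "T x - scaleC (of_real s * z) x = s *\<^sub>R y" using V' by auto
      have xy: "J (L x) - scaleC z x = y" using eq[OF x(1), of z] x(2) s by simp
      have "x' = x" if x': "x' \<in> DL \<inter> V" "J (L x') - scaleC z x' = y" for x'
      proof -
        have d: "x' - x \<in> DL \<inter> V" using x(1) x'(1) by (auto simp: DL_diff V' Q.diff)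
        have "J (L (x' - x)) - scaleC z (x' - x) = (J (L x') - scaleC z x') - (J (L x) - scaleC z x)"
          using x(1) x'(1) by (simp add: JL DL_diff T_diff_DL U.diff scaleC_diff_right)
        then show ?thesis using K[OF d] xy x'(2) by simp
      qed
      then show ?thesis using x(1) xy by blast
    qed
    then show "z \<notin> spectrum_on V (DL \<inter> V) (\<lambda>f. J (L f))"
      unfolding spectrum_on_def using K by blast
  qed
  then have "z \<in> spectrum_on V (DL \<inter> V) (\<lambda>f. J (L f)) \<longleftrightarrow> (\<exists>r\<in>spectral_set s. of_real s * z = of_real r)" for z
    using not_bounded_below_iff by blast
  moreover have "of_real s * z = of_real r \<longleftrightarrow> z = of_real (s * r)" for z :: complex and r
  proof -
    have "of_real s * (of_real s * w) = (w :: complex)" for w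
      using s by (simp add: mult.assoc[symmetric] flip: of_real_mult)
    then show ?thesis by (metis of_real_mult)
  qed
  ultimately show ?thesis by auto
qed

text \<open>\<open>B\<close> is \<open>T\<close> on one eigenspace and \<open>- T\<close> on the
  other, hence the argument \<open>- z\<close> in the second condition. The two lower bounds combine
  because the projections are bounded and commute with \<open>B\<close>.\<close>

lemma spectrum_whole:
  "z \<notin> spectrum_on UNIV DL (\<lambda>f. J (L f)) \<longleftrightarrow> bounded_below (part 1) z \<and> bounded_below (part (- 1)) (- z)"
proof -
  have s: "(1::real) * 1 = 1" "(-1::real) * (-1) = 1" by auto
  note red = part_reducing[OF s(1)] part_reducing[OF s(2)]
  interpret P: bounded_linear "part 1" by (rule reducingD[OF red(1)])
  interpret M: bounded_linear "part (- 1)" by (rule reducingD[OF red(2)])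
  define F where "F x = J (L x) - scaleC z x" for x
  have plus: "F x = T x - scaleC z x" if "x \<in> DL" "part 1 x = x" for x
    using JL_on_part[of x 1] that part_fixed[OF s(1)] by (simp add: F_def)
  have minus: "F x = - (T x - scaleC (- z) x)" if "x \<in> DL" "part (- 1) x = x" for x
    using JL_on_part[of x "- 1"] that part_fixed[OF s(2)] by (simp add: F_def)
  have Fdiff: "F (x - y) = F x - F y" and Fadd: "F (x + y) = F x + F y" if "x \<in> DL" "y \<in> DL" for x y
    using that by (simp_all add: F_def JL DL_diff DL_add T_diff_DL T_add_DL U.diff U.add scaleC_diff_right scaleC_add_right)
  have comm: "part 1 (F x) = F (part 1 x)" "part (- 1) (F x) = F (part (- 1) x)" if "x \<in> DL" for x
    using reducingD[OF red(1)] reducingD[OF red(2)] that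
    by (simp_all add: F_def JL P.diff M.diff part_U U_part)
  show ?thesis
  proof
    assume "z \<notin> spectrum_on UNIV DL (\<lambda>f. J (L f))"
    then obtain K where K: "\<And>x. x \<in> DL \<Longrightarrow> norm x \<le> K * norm (F x)"
      unfolding spectrum_on_def F_def by blast
    have "bounded_below (part 1) z"
      unfolding bounded_below_def using K plus by (metis (no_types))
    moreover have "bounded_below (part (- 1)) (- z)"
      unfolding bounded_below_def using K minus by (metis (no_types) norm_minus_cancel)
    ultimately show "bounded_below (part 1) z \<and> bounded_below (part (- 1)) (- z)" by blast
  next
    assume bb: "bounded_below (part 1) z \<and> bounded_below (part (- 1)) (- z)"
    obtain K1 where K1: "K1 > 0" "\<And>x. x \<in> DL \<Longrightarrow> part 1 x = x \<Longrightarrow> norm x \<le> K1 * norm (T x - scaleC z x)"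
      using bb bounded_belowE by blast
    obtain K2 where K2: "K2 > 0" "\<And>x. x \<in> DL \<Longrightarrow> part (- 1) x = x \<Longrightarrow> norm x \<le> K2 * norm (T x - scaleC (- z) x)"
      using bb bounded_belowE by blast
    obtain B1 where B1: "\<And>x. norm (part 1 x) \<le> norm x * B1" using P.pos_bounded by blast
    obtain B2 where B2: "\<And>x. norm (part (- 1) x) \<le> norm x * B2" using M.pos_bounded by blast
    have K: "norm x \<le> (K1 * B1 + K2 * B2) * norm (F x)" if x: "x \<in> DL" for x
    proof -
      have p: "part 1 x \<in> DL" "part 1 (part 1 x) = part 1 x" "part (- 1) x \<in> DL" "part (- 1) (part (- 1) x) = part (- 1) x"
        using reducingD[OF red(1)] reducingD[OF red(2)] x by auto
      have "norm (part 1 x) \<le> K1 * norm (part 1 (F x))" using K1(2)[OF p(1,2)] plus[OF p(1,2)] comm(1)[OF x] by simp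
      also have "\<dots> \<le> K1 * (norm (F x) * B1)" using K1(1) B1 by (intro mult_left_mono) auto
      finally have 1: "norm (part 1 x) \<le> K1 * (norm (F x) * B1)" .
      have "norm (part (- 1) x) \<le> K2 * norm (part (- 1) (F x))"
        using K2(2)[OF p(3,4)] minus[OF p(3,4)] comm(2)[OF x] by (metis norm_minus_cancel)
      also have "\<dots> \<le> K2 * (norm (F x) * B2)" using K2(1) B2 by (intro mult_left_mono) auto
      finally have 2: "norm (part (- 1) x) \<le> K2 * (norm (F x) * B2)" .
      have "norm x \<le> norm (part 1 x) + norm (part (- 1) x)"
        using norm_triangle_ineq[of "part 1 x" "part (- 1) x"] part_sum[of x] by simp
      then show ?thesis using 1 2 by (simp add: algebra_simps)
    qed
    have ex1: "\<exists>!x. x \<in> DL \<and> F x = y" for y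
    proof -
      obtain x1 where x1: "x1 \<in> DL" "part 1 x1 = x1" "T x1 - scaleC z x1 = part 1 y"
        using bounded_below_onto[OF red(1), of z "part 1 y"] bb reducingD(3)[OF red(1)] by blast
      obtain x2 where x2: "x2 \<in> DL" "part (- 1) x2 = x2" "T x2 - scaleC (- z) x2 = part (- 1) (- y)"
        using bounded_below_onto[OF red(2), of "- z" "part (- 1) (- y)"] bb reducingD(3)[OF red(2)] by blast
      have "F x1 = part 1 y" using plus[OF x1(1,2)] x1(3) by simp
      moreover have "F x2 = part (- 1) y" unfolding minus[OF x2(1,2)] x2(3) by (simp add: M.neg)
      ultimately have xy: "x1 + x2 \<in> DL" "F (x1 + x2) = y"
        using x1(1) x2(1) part_sum[of y] by (simp_all add: Fadd DL_add)
      have "x = x1 + x2" if "x \<in> DL" "F x = y" for x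
        using K[of "x - (x1 + x2)"] that xy by (simp add: DL_diff Fdiff)
      then show ?thesis using xy by blast
    qed
    show "z \<notin> spectrum_on UNIV DL (\<lambda>f. J (L f))"
      unfolding spectrum_on_def mem_Collect_eq not_not F_def[symmetric]
      by (intro conjI ballI ex1 exI[of _ "K1 * B1 + K2 * B2"] K)
  qed
qed

text \<open>On the half-line \<open>0 < s * Re z\<close> the eigenspace of the opposite sign
  contributes nothing, since its argument then has negative real part.\<close>

lemma spectrum_halfline:
  assumes s: "s = 1 \<or> s = - 1"
  shows "spectrum_on UNIV DL (\<lambda>f. J (L f)) \<inter> {z. Im z = 0 \<and> 0 < s * Re z}
    = (\<lambda>r. of_real (s * r)) ` (spectral_set s \<inter> {0<..})"
proof (rule set_eqI)
  fix z
  have "z \<in> spectrum_on UNIV DL (\<lambda>f. J (L f)) \<and> Im z = 0 \<and> 0 < s * Re z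
    \<longleftrightarrow> \<not> bounded_below (part s) (of_real s * z) \<and> Im z = 0 \<and> 0 < s * Re z"
    using s spectrum_whole[of z] bounded_below_off_halfline'[of "- z" "part (- 1)"] bounded_below_off_halfline'[of z "part 1"]
    by auto
  also have "\<dots> \<longleftrightarrow> z \<in> (\<lambda>r. of_real (s * r)) ` (spectral_set s \<inter> {0<..})"
  proof
    assume *: "\<not> bounded_below (part s) (of_real s * z) \<and> Im z = 0 \<and> 0 < s * Re z"
    then obtain r where r: "r \<in> spectral_set s" "of_real s * z = of_real r" using not_bounded_below_iff by blast
    have "r = s * Re z" using arg_cong[OF r(2), of Re] by simp
    then show "z \<in> (\<lambda>r. of_real (s * r)) ` (spectral_set s \<inter> {0<..})"
      using * r(1) s by (intro image_eqI[of _ _ r]) (auto simp: complex_eq_iff)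
  next
    assume "z \<in> (\<lambda>r. of_real (s * r)) ` (spectral_set s \<inter> {0<..})"
    then obtain r where r: "r \<in> spectral_set s" "r > 0" "z = of_real (s * r)" by auto
    have "of_real s * z = of_real r" using r(3) s by auto
    then have "\<not> bounded_below (part s) (of_real s * z)" using not_bounded_below_iff r(1) by blast
    then show "\<not> bounded_below (part s) (of_real s * z) \<and> Im z = 0 \<and> 0 < s * Re z" using r s by auto
  qed
  finally show "z \<in> spectrum_on UNIV DL (\<lambda>f. J (L f)) \<inter> {z. Im z = 0 \<and> 0 < s * Re z}
    \<longleftrightarrow> z \<in> (\<lambda>r. of_real (s * r)) ` (spectral_set s \<inter> {0<..})" by blast
qed

lemma spectrum_part_closure:
  assumes s: "s = 1 \<or> s = - 1" and V: "V = {x. U x = s *\<^sub>R x}"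
  shows "spectrum_on V (DL \<inter> V) (\<lambda>f. J (L f))
    = closure (spectrum_on UNIV DL (\<lambda>f. J (L f)) \<inter> {z. Im z = 0 \<and> 0 < s * Re z})"
proof -
  have s': "s * s = 1" using s by auto
  let ?f = "\<lambda>r. of_real (s * r) :: complex"
  have "linear ?f" by (rule linearI) (auto simp: algebra_simps scaleR_conv_of_real)
  moreover have "inj ?f" using s by (auto simp: inj_on_def)
  ultimately have "?f ` closure (spectral_set s \<inter> {0<..}) = closure (?f ` (spectral_set s \<inter> {0<..}))"
    by (rule closure_injective_linear_image)
  then show ?thesis unfolding spectrum_part[OF s' V] spectrum_halfline[OF s] closure_spectral_set[OF s'] .
qed

lemma spectral_decomp_eigenspaces:
  "spectral_decomp J DL L {x. U x = x} {x. U x = - x}"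
proof -
  have s: "(1::real) * 1 = 1" "(-1::real) * (-1) = 1" by auto
  note red = part_reducing[OF s(1)] part_reducing[OF s(2)]
  have fix1: "part 1 x = x \<longleftrightarrow> U x = x" and fix2: "part (- 1) x = x \<longleftrightarrow> U x = - x" for x
    using part_fixed[OF s(1)] part_fixed[OF s(2)] by auto
  have pm: "U (part 1 x) = part 1 x" "U (part (- 1) x) = - part (- 1) x" for x
    using U_part[OF s(1)] U_part[OF s(2)] by auto
  have z1: "part 1 x = 0" if "U x = - x" for x using part_opposite[OF s(1)] that by simp
  have z2: "part (- 1) x = 0" if "U x = x" for x using part_opposite[OF s(2)] that by simp
  interpret P: bounded_linear "part 1" by (rule reducingD[OF red(1)])
  interpret M: bounded_linear "part (- 1)" by (rule reducingD[OF red(2)])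
  have co: "c * (norm x)\<^sup>2 \<le> Re (cinner (J (U x)) x)" for x by (rule JU_coercive)
  have orth: "cinner (J a) b = 0" if a: "U a = a" and b: "U b = - b" for a b
  proof -
    have "cinner (J a) b = - cinner (J a) b" using JU_sym[of a b] a b by simp
    then show ?thesis by simp
  qed
  have clos: "closed {x. U x = x}" "closed {x. U x = - x}"
    by (intro closed_Collect_eq U.continuous_on continuous_intros)+
  have sub: "csubspace {x. U x = x}" "csubspace {x. U x = - x}"
    unfolding csubspace_def by (auto simp: U.zero U.add U_scaleC)
  have decomp: "\<exists>!p. fst p \<in> {x. U x = x} \<and> snd p \<in> {x. U x = - x} \<and> h = fst p + snd p" for h
  proof (rule ex1I[of _ "(part 1 h, part (- 1) h)"])
    show "fst (part 1 h, part (- 1) h) \<in> {x. U x = x} \<and> snd (part 1 h, part (- 1) h) \<in> {x. U x = - x}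
        \<and> h = fst (part 1 h, part (- 1) h) + snd (part 1 h, part (- 1) h)"
      using pm part_sum by simp
    fix p assume p: "fst p \<in> {x. U x = x} \<and> snd p \<in> {x. U x = - x} \<and> h = fst p + snd p"
    then have "part 1 h = fst p" "part (- 1) h = snd p"
      using fix1 fix2 z1 z2 by (simp_all add: P.add M.add)
    then show "p = (part 1 h, part (- 1) h)" by simp
  qed
  have split: "a \<in> DL \<and> b \<in> DL" if "U a = a" "U b = - b" "a + b \<in> DL" for a b
  proof -
    have "part 1 (a + b) = a" "part (- 1) (a + b) = b"
      using that fix1 fix2 z1 z2 by (simp_all add: P.add M.add)
    then show ?thesis using reducingD(5)[OF red(1) that(3)] reducingD(5)[OF red(2) that(3)] by simp
  qed
  have spec: "spectrum_on {x. U x = x} (DL \<inter> {x. U x = x}) (\<lambda>f. J (L f))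
        = closure (spectrum_on UNIV DL (\<lambda>f. J (L f)) \<inter> {z. Im z = 0 \<and> Re z > 0})"
      "spectrum_on {x. U x = - x} (DL \<inter> {x. U x = - x}) (\<lambda>f. J (L f))
        = closure (spectrum_on UNIV DL (\<lambda>f. J (L f)) \<inter> {z. Im z = 0 \<and> Re z < 0})"
    using spectrum_part_closure[of 1 "{x. U x = x}"] spectrum_part_closure[of "- 1" "{x. U x = - x}"] by simp_all
  have bp: "b a a = Re (cinner (J a) a)" if "U a = a" for a using that by (simp add: b_def G_def)
  have bm: "b a a = - Re (cinner (J a) a)" if "U a = - a" for a using that by (simp add: b_def G_def J.neg)
  have invp: "J (L f) \<in> {x. U x = x}" if "f \<in> DL \<inter> {x. U x = x}" for f
    using that U_commute[of f] by simp
  have invm: "J (L f) \<in> {x. U x = - x}" if "f \<in> DL \<inter> {x. U x = - x}" for f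
    using that T_U[of f] T_neg[of f] by (simp add: JL) (metis minus_minus)
  have posp: "c * (norm a)\<^sup>2 \<le> Re (cinner (J a) a)" if "a \<in> {x. U x = x}" for a
    using co[of a] that by simp
  have posm: "c * (norm a)\<^sup>2 \<le> - Re (cinner (J a) a)" if "a \<in> {x. U x = - x}" for a
    using co[of a] that by (simp add: J.neg)
  show ?thesis
    unfolding spectral_decomp_def
  proof (intro conjI sub clos spec)
    show "\<forall>a\<in>{x. U x = x}. \<forall>b\<in>{x. U x = - x}. a + b \<in> DL \<longrightarrow> a \<in> DL \<and> b \<in> DL"
      using split by simp
    show "\<forall>a\<in>{x. U x = x}. \<forall>b\<in>{x. U x = - x}. cinner (J a) b = 0" using orth by simp
    show "\<forall>a\<in>{x. U x = x}. 0 \<le> Re (cinner (J a) a)"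
    proof
      fix a assume "a \<in> {x. U x = x}"
      then show "0 \<le> Re (cinner (J a) a)" using bp[of a] nonneg[of a] by simp
    qed
    show "\<forall>a\<in>{x. U x = - x}. Re (cinner (J a) a) \<le> 0"
    proof
      fix a assume "a \<in> {x. U x = - x}"
      then show "Re (cinner (J a) a) \<le> 0" using bm[of a] nonneg[of a] by simp
    qed
    show "\<exists>k>0. \<forall>a\<in>{x. U x = x}. k * (norm a)\<^sup>2 \<le> Re (cinner (J a) a)"
      using c_pos posp by blast
    show "\<exists>k>0. \<forall>a\<in>{x. U x = - x}. k * (norm a)\<^sup>2 \<le> - Re (cinner (J a) a)"
      using c_pos posm by blast
  qed (use decomp invp invm in blast)+
qed

end

section \<open>From a given decomposition back to a symmetry\<close>

text \<open>\<open>U\<close> is the difference of the two projections of the decomposition.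
  Invariance of the summands and the splitting of the domain make it commute with \<open>B\<close>;
  coercivity of the indefinite product on each summand supplies the rest.\<close>

lemma krein_setting_of_spectral_decomp:
  fixes J L :: "'a::chilbert \<Rightarrow> 'a"
  assumes J: "signature_op J" and L: "self_adjoint DL L" and pos: "positive_op DL L"
    and dec: "spectral_decomp J DL L Hp Hm"
  shows "\<exists>U c. krein_setting J L U DL c \<and> Hp = {x. U x = x} \<and> Hm = {x. U x = - x}"
proof -
  have sub: "csubspace Hp" "csubspace Hm"
    and decomp: "\<And>h. \<exists>!p. fst p \<in> Hp \<and> snd p \<in> Hm \<and> h = fst p + snd p"
    and inv: "\<And>f. f \<in> DL \<Longrightarrow> f \<in> Hp \<Longrightarrow> J (L f) \<in> Hp" "\<And>f. f \<in> DL \<Longrightarrow> f \<in> Hm \<Longrightarrow> J (L f) \<in> Hm"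
    and split: "\<And>a b. a \<in> Hp \<Longrightarrow> b \<in> Hm \<Longrightarrow> a + b \<in> DL \<Longrightarrow> a \<in> DL \<and> b \<in> DL"
    and orth: "\<And>a b. a \<in> Hp \<Longrightarrow> b \<in> Hm \<Longrightarrow> cinner (J a) b = 0"
    and c1: "\<exists>c>0. \<forall>a\<in>Hp. c * (norm a)\<^sup>2 \<le> Re (cinner (J a) a)"
    and c2: "\<exists>c>0. \<forall>b\<in>Hm. c * (norm b)\<^sup>2 \<le> - Re (cinner (J b) b)"
    using dec unfolding spectral_decomp_def by auto
  obtain c1 where c1: "c1 > 0" "\<And>a. a \<in> Hp \<Longrightarrow> c1 * (norm a)\<^sup>2 \<le> Re (cinner (J a) a)" using c1 by blast
  obtain c2 where c2: "c2 > 0" "\<And>a. a \<in> Hm \<Longrightarrow> c2 * (norm a)\<^sup>2 \<le> - Re (cinner (J a) a)" using c2 by blast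
  have J': "bounded_linear J" "\<And>x y. cinner (J x) y = cinner x (J y)" "\<And>z x. J (scaleC z x) = scaleC z (J x)"
    using J unfolding signature_op_def bounded_clinear_op_iff by auto
  interpret J: bounded_linear J by (rule J')
  have orth': "cinner (J b) a = 0" if "a \<in> Hp" "b \<in> Hm" for a b
    using orth[OF that] by (metis J'(2) cinner_commute complex_cnj_zero)
  define p where "p h = fst (THE p. fst p \<in> Hp \<and> snd p \<in> Hm \<and> h = fst p + snd p)" for h
  define q where "q h = snd (THE p. fst p \<in> Hp \<and> snd p \<in> Hm \<and> h = fst p + snd p)" for h
  have pq: "p h \<in> Hp" "q h \<in> Hm" "h = p h + q h" for h
    using theI'[OF decomp[of h]] unfolding p_def q_def by auto
  have pq_eq: "p (a + b) = a" "q (a + b) = b" if "a \<in> Hp" "b \<in> Hm" for a b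
    using the1_equality[OF decomp[of "a + b"], of "(a, b)"] that unfolding p_def q_def by auto
  have S1: "x + y \<in> Hp" "scaleC z x \<in> Hp" if "x \<in> Hp" "y \<in> Hp" for x y z using sub that unfolding csubspace_def by auto
  have S2: "x + y \<in> Hm" "scaleC z x \<in> Hm" if "x \<in> Hm" "y \<in> Hm" for x y z using sub that unfolding csubspace_def by auto
  have zero: "0 \<in> Hp" "0 \<in> Hm" using sub unfolding csubspace_def by auto
  have padd: "p (x + y) = p x + p y" "q (x + y) = q x + q y" for x y
  proof -
    have "x + y = (p x + q x) + (p y + q y)" using pq(3)[of x] pq(3)[of y] by (rule arg_cong2)
    also have "\<dots> = (p x + p y) + (q x + q y)" by simp
    finally show "p (x + y) = p x + p y" "q (x + y) = q x + q y"
      using pq_eq[OF S1(1)[OF pq(1) pq(1)] S2(1)[OF pq(2) pq(2)], of x y x y] by simp_all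
  qed
  have psc: "p (scaleC z x) = scaleC z (p x)" "q (scaleC z x) = scaleC z (q x)" for z x
  proof -
    have "scaleC z x = scaleC z (p x) + scaleC z (q x)"
      using arg_cong[OF pq(3)[of x], of "scaleC z"] by (simp only: scaleC_add_right)
    then show "p (scaleC z x) = scaleC z (p x)" "q (scaleC z x) = scaleC z (q x)"
      using pq_eq[OF S1(2)[OF pq(1) pq(1)] S2(2)[OF pq(2) pq(2)], of z x z x] by simp_all
  qed
  obtain KJ where KJ: "KJ > 0" "\<And>x. norm (J x) \<le> norm x * KJ" using J.pos_bounded by blast
  \<comment> \<open>Boundedness of the projections: by orthogonality the products of
    \<open>p h\<close> with \<open>h\<close> and with itself agree, so coercivity on one side and
    Cauchy-Schwarz on the other leave one factor \<open>norm a\<close> to cancel.\<close>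
  have bound: "norm a \<le> KJ / k * norm h"
    if k: "k > 0" and le: "k * (norm a)\<^sup>2 \<le> \<bar>Re (cinner (J a) h)\<bar>" for k a h
  proof (cases "a = 0")
    case True
    then show ?thesis using KJ k by simp
  next
    case False
    have "k * (norm a)\<^sup>2 \<le> norm (J a) * norm h" using le Re_cinner_le order_trans by blast
    also have "\<dots> \<le> (norm a * KJ) * norm h" using KJ by (intro mult_right_mono) auto
    finally have "k * norm a \<le> KJ * norm h" using False by (simp add: power2_eq_square)
    then show ?thesis using k by (simp add: field_simps)
  qed
  have pb: "norm (p h) \<le> KJ / c1 * norm h" for h
  proof (rule bound[OF c1(1)])
    have "cinner (J (p h)) h = cinner (J (p h)) (p h)"
      by (subst (2) pq(3)[of h]) (simp add: cinner_add_right orth pq)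
    then show "c1 * (norm (p h))\<^sup>2 \<le> \<bar>Re (cinner (J (p h)) h)\<bar>" using c1(2)[OF pq(1)[of h]] by simp
  qed
  have qb: "norm (q h) \<le> KJ / c2 * norm h" for h
  proof (rule bound[OF c2(1)])
    have "cinner (J (q h)) h = cinner (J (q h)) (q h)"
      by (subst (2) pq(3)[of h]) (simp add: cinner_add_right orth' pq)
    then show "c2 * (norm (q h))\<^sup>2 \<le> \<bar>Re (cinner (J (q h)) h)\<bar>" using c2(2)[OF pq(2)[of h]] by simp
  qed
  define U where "U h = p h - q h" for h
  have "bounded_linear U"
  proof (rule bounded_linear_intro)
    show "U (x + y) = U x + U y" for x y by (simp add: U_def padd)
    show "U (r *\<^sub>R x) = r *\<^sub>R U x" for r x by (simp add: U_def scaleR_scaleC psc scaleC_diff_right)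
    show "norm (U x) \<le> norm x * (KJ / c1 + KJ / c2)" for x
      using norm_triangle_ineq4[of "p x" "q x"] pb[of x] qb[of x] by (simp add: U_def algebra_simps)
  qed
  then have U_cl: "bounded_clinear_op U"
    unfolding bounded_clinear_op_iff by (simp add: U_def psc scaleC_diff_right)
  have neg: "- x \<in> Hm" if "x \<in> Hm" for x
    using S2(2)[OF that that, of "-1"] by (simp add: scaleC_one)
  have pqU: "p (U x) = p x" "q (U x) = - q x" for x
    using pq_eq[OF pq(1)[of x] neg[OF pq(2)[of x]]] by (simp_all add: U_def)
  \<comment> \<open>The factor 1/2 compensates the 2 in the estimate of the squared norm of a sum by
    the squared norms of its summands.\<close>
  define c where "c = min c1 c2 / 2"
  have "krein_setting J L U DL c"
  proof (unfold_locales)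
    show "U (U x) = x" for x using pq(3)[of x] by (simp add: U_def[of "U x"] pqU)
    show "cinner (J (U x)) y = cinner (J x) (U y)" for x y
    proof -
      have "cinner (J (U x)) y = cinner (J (p x)) (p y) - cinner (J (q x)) (q y)"
        by (subst pq(3)[of y]) (simp add: U_def J.diff cinner_diff cinner_add_right orth orth' pq)
      moreover have "cinner (J x) (U y) = cinner (J (p x)) (p y) - cinner (J (q x)) (q y)"
        by (subst pq(3)[of x]) (simp add: U_def J.add cinner_diff cinner_add_left orth orth' pq)
      ultimately show ?thesis by simp
    qed
    show "c > 0" using c1 c2 by (simp add: c_def)
    show "c * (norm x)\<^sup>2 \<le> Re (cinner (J (U x)) x)" for x
    proof -
      have "cinner (J (U x)) x = cinner (J (p x)) (p x) - cinner (J (q x)) (q x)"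
        by (subst (2) pq(3)[of x]) (simp add: U_def J.diff cinner_diff cinner_add_right orth orth' pq)
      then have "c1 * (norm (p x))\<^sup>2 + c2 * (norm (q x))\<^sup>2 \<le> Re (cinner (J (U x)) x)"
        using c1(2)[OF pq(1)[of x]] c2(2)[OF pq(2)[of x]] by simp
      moreover have "min c1 c2 * (norm (p x))\<^sup>2 \<le> c1 * (norm (p x))\<^sup>2" "min c1 c2 * (norm (q x))\<^sup>2 \<le> c2 * (norm (q x))\<^sup>2"
        by (intro mult_right_mono; simp)+
      moreover have "(norm x)\<^sup>2 \<le> 2 * ((norm (p x))\<^sup>2 + (norm (q x))\<^sup>2)"
      proof -
        have "(norm x)\<^sup>2 \<le> (norm (p x) + norm (q x))\<^sup>2"
          using norm_triangle_ineq[of "p x" "q x"] pq(3)[of x] by (intro power_mono) auto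
        also have "\<dots> \<le> 2 * ((norm (p x))\<^sup>2 + (norm (q x))\<^sup>2)"
          using sum_squares_bound[of "norm (p x)" "norm (q x)"] by (simp add: power2_sum)
        finally show ?thesis .
      qed
      then have "c * (norm x)\<^sup>2 \<le> c * (2 * ((norm (p x))\<^sup>2 + (norm (q x))\<^sup>2))"
        using c1 c2 by (intro mult_left_mono) (auto simp: c_def)
      ultimately show ?thesis by (simp add: c_def algebra_simps)
    qed
    have DL: "csubspace DL" and Ladd: "\<And>x y. x \<in> DL \<Longrightarrow> y \<in> DL \<Longrightarrow> L (x + y) = L x + L y"
      using L unfolding self_adjoint_def clinear_on_def by auto
    fix x assume x: "x \<in> DL"
    have D: "p x \<in> DL" "q x \<in> DL" using split[OF pq(1) pq(2), of x x] pq(3)[of x] x by auto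
    show "U x \<in> DL" unfolding U_def by (rule csubspace_diff[OF DL D])
    have "L (p x) = L (U x) + L (q x)" using Ladd[OF \<open>U x \<in> DL\<close> D(2)] by (simp add: U_def)
    then have "J (L (U x)) = J (L (p x)) - J (L (q x))" by (simp add: J.add)
    also have "\<dots> = U (J (L (p x)) + J (L (q x)))"
      using pq_eq[OF inv(1)[OF D(1) pq(1)] inv(2)[OF D(2) pq(2)]] by (simp add: U_def)
    also have "J (L (p x)) + J (L (q x)) = J (L x)"
      using Ladd[OF D] pq(3)[of x] by (simp add: J.add[symmetric])
    finally show "J (L (U x)) = U (J (L x))" .
  qed (use J L pos U_cl in auto)
  moreover have "Hp = {x. U x = x}"
  proof (intro equalityI subsetI CollectI)
    show "U x = x" if "x \<in> Hp" for x using pq_eq[OF that zero(2)] by (simp add: U_def)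
    show "x \<in> Hp" if "x \<in> {x. U x = x}" for x
    proof -
      have "q x = - q x" using pqU(2)[of x] that by simp
      then have "2 *\<^sub>R q x = 0" unfolding scaleR_2 by (simp only: eq_neg_iff_add_eq_0)
      then have "q x = 0" by simp
      then show ?thesis using pq[of x] by simp
    qed
  qed
  moreover have "Hm = {x. U x = - x}"
  proof (intro equalityI subsetI CollectI)
    show "U x = - x" if "x \<in> Hm" for x using pq_eq[OF zero(1) that] by (simp add: U_def)
    show "x \<in> Hm" if "x \<in> {x. U x = - x}" for x
    proof -
      have "p (- x) = - p x" using psc(1)[of "-1" x] by (simp add: scaleC_one)
      then have "p x = - p x" using pqU(1)[of x] that by simp
      then have "2 *\<^sub>R p x = 0" unfolding scaleR_2 by (simp only: eq_neg_iff_add_eq_0)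
      then have "p x = 0" by simp
      then show ?thesis using pq[of x] by simp
    qed
  qed
  ultimately show ?thesis by blast
qed

section \<open>The boundary value problem\<close>

lemma orth_proj_eq:
  assumes S: "csubspace S" and y: "y \<in> S" "\<And>z. z \<in> S \<Longrightarrow> cinner (x - y) z = 0"
  shows "orth_proj S x = (y :: 'a::chilbert)"
  unfolding orth_proj_def
proof (rule the_equality)
  fix w assume w: "w \<in> S \<and> (\<forall>z\<in>S. cinner (x - w) z = 0)"
  have d: "w - y \<in> S" using csubspace_diff[OF S] w y by blast
  have "cinner (x - w) (w - y) = 0" using w d by blast
  then have "cinner ((x - y) - (x - w)) (w - y) = 0" using y(2)[OF d] by (simp only: cinner_diff(1)) simp
  then have "cinner (w - y) (w - y) = 0" by simp
  then show "w = y" by (simp add: cinner_self)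
qed (use y in blast)

context krein_setting begin

definition Pp :: "'a \<Rightarrow> 'a" where "Pp x = (1/2) *\<^sub>R (x + J x)"
definition Pm :: "'a \<Rightarrow> 'a" where "Pm x = (1/2) *\<^sub>R (x - J x)"

lemma P_linear: "Pp (x + y) = Pp x + Pp y" "Pm (x + y) = Pm x + Pm y"
    "Pp (x - y) = Pp x - Pp y" "Pm (x - y) = Pm x - Pm y"
  by (simp_all add: Pp_def Pm_def J.add J.diff flip: scaleR_right_distrib scaleR_diff_right)

lemma P_range: "Pp x \<in> Hplus J" "Pm x \<in> Hminus J"
proof -
  show "Pp x \<in> Hplus J" by (simp add: Hplus_def Pp_def J.add J.scaleR add.commute)
  show "Pm x \<in> Hminus J" by (simp add: Hminus_def Pm_def J.diff J.scaleR flip: scaleR_minus_right)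
qed

lemma P_fixed: "x \<in> Hplus J \<Longrightarrow> Pp x = x" "x \<in> Hminus J \<Longrightarrow> Pm x = x"
    "x \<in> Hminus J \<Longrightarrow> Pp x = 0" "x \<in> Hplus J \<Longrightarrow> Pm x = 0"
  by (auto simp: Hplus_def Hminus_def Pp_def Pm_def simp flip: scaleR_2)

lemma orth_proj_Hplus: "orth_proj (Hplus J) x = Pp x"
proof (rule orth_proj_eq)
  show "csubspace (Hplus J)" by (auto simp: csubspace_def Hplus_def J.zero J.add J_scaleC)
  fix z assume "z \<in> Hplus J"
  then have z: "J z = z" by (simp add: Hplus_def)
  have "cinner (x - Pp x) z = (1/2) * (cinner x z - cinner (J x) z)"
    by (simp add: Pp_def cinner_diff cinner_add_left cinner_scaleR field_simps)
  then show "cinner (x - Pp x) z = 0" using J_sym[of x z] z by simp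
qed (rule P_range)

lemma orth_proj_Hminus: "orth_proj (Hminus J) x = Pm x"
proof (rule orth_proj_eq)
  show "csubspace (Hminus J)" by (auto simp: csubspace_def Hminus_def J.zero J.add J_scaleC)
  fix z assume "z \<in> Hminus J"
  then have z: "J z = - z" by (simp add: Hminus_def)
  have "cinner (x - Pm x) z = (1/2) * (cinner x z + cinner (J x) z)"
    by (simp add: Pm_def cinner_diff cinner_add_left cinner_scaleR field_simps)
  then show "cinner (x - Pm x) z = 0" using J_sym[of x z] z by simp
qed (rule P_range)

text \<open>The contractions of interest are \<open>W = 0\<close>, which yields \<open>R\<^sub>\<plusminus>\<close>, and \<open>W = S \<tau>\<close>, which yields
  the boundary value problem itself. In terms of \<open>h = h1 + h2\<close> the two boundary conditions read
  \<open>(h + W h) + G (h - W h) = 2 (\<phi>\<^sub>+ + \<phi>\<^sub>-)\<close>.\<close>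
definition boundary_conditions :: "('a \<Rightarrow> 'a) \<Rightarrow> 'a \<Rightarrow> 'a \<Rightarrow> 'a \<Rightarrow> 'a \<Rightarrow> bool" where
  "boundary_conditions W h1 h2 f1 f2 \<longleftrightarrow> U h1 = h1 \<and> U h2 = - h2 \<and> Pp (h1 + W h2) = f1 \<and> Pm (W h1 + h2) = f2"

definition admissible :: "('a \<Rightarrow> 'a) \<Rightarrow> bool" where
  "admissible W \<longleftrightarrow> bounded_linear W \<and> (\<forall>z x. W (scaleC z x) = scaleC z (W x)) \<and> (\<forall>x. b (W x) (W x) \<le> b x x)
     \<and> (\<forall>x y. b (W x) y = b x (W y)) \<and> (\<forall>x. U (W x) = W (U x))"

lemma admissible_zero: "admissible (\<lambda>x. 0)"
  unfolding admissible_def by (simp add: b.zero_left b.zero_right nonneg U.zero)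

lemma U_S: "0 \<le> t \<Longrightarrow> U (S t x) = S t (U x)"
  by (rule S_commute[OF U_bounded_linear U_DL T_U])

lemma admissible_S: "0 \<le> t \<Longrightarrow> admissible (S t)"
  unfolding admissible_def
  by (intro conjI allI S_bounded_linear S_scaleC S_contraction S_sym U_S)

text \<open>With \<open>l = h + W h\<close> and \<open>k = h - W h\<close>, symmetry and
  contractivity of \<open>W\<close> make \<open>b l k\<close> nonnegative. This says that
  \<open>l\<close> and \<open>G k\<close> enclose a nonobtuse angle, so the norm of their sum
  dominates both norms, hence that of \<open>h = (l + k) / 2\<close>. No strict contraction is
  needed.\<close>

lemma boundary_operator_bijective:
  assumes W: "admissible W"
  shows "\<exists>!h. (h + W h) + G (h - W h) = y"
proof -
  have Wlin: "bounded_linear W" and WC: "\<And>z x. W (scaleC z x) = scaleC z (W x)"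
    and Wb: "\<And>x. b (W x) (W x) \<le> b x x" and Ws: "\<And>x y. b (W x) y = b x (W y)"
    using W unfolding admissible_def by auto
  interpret W: bounded_linear W by (rule Wlin)
  define Z where "Z h = (h + W h) + G (h - W h)" for h
  have Zlin: "bounded_linear Z"
    unfolding Z_def
    by (intro bounded_linear_add bounded_linear_sub bounded_linear_ident Wlin
        bounded_linear_compose[OF G_bounded_linear])
  interpret Z: bounded_linear Z by (rule Zlin)
  have ZC: "Z (scaleC z h) = scaleC z (Z h)" for z h
    unfolding Z_def WC scaleC_diff_right[symmetric] G_scaleC scaleC_add_right[symmetric] ..
  obtain M where M: "M > 0" "\<And>x. norm (U (J x)) \<le> norm x * M"
    using bounded_linear.pos_bounded[OF bounded_linear_compose[OF U_bounded_linear J_bounded_linear]] by auto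
  have below: "norm h \<le> (1 + M) * norm (Z h)" for h
  proof -
    let ?l = "h + W h" and ?k = "h - W h"
    have "b ?l ?k = b h h - b (W h) (W h)"
      by (simp add: b.add_left b.diff_right sym[of "W h" h])
    then have "0 \<le> Re (cinner ?l (G ?k))" using Wb[of h] unfolding G_sym[symmetric] by (simp add: b_def)
    then have "(norm (Z h))\<^sup>2 \<ge> (norm ?l)\<^sup>2 + (norm (G ?k))\<^sup>2" by (simp add: Z_def norm_add_sq)
    then have "(norm ?l)\<^sup>2 \<le> (norm (Z h))\<^sup>2" "(norm (G ?k))\<^sup>2 \<le> (norm (Z h))\<^sup>2"
      by (smt (verit) zero_le_power2)+
    then have l: "norm ?l \<le> norm (Z h)" and Gk: "norm (G ?k) \<le> norm (Z h)"
      by (auto intro: power2_le_imp_le)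
    have "norm ?k \<le> norm (G ?k) * M" using M(2)[of "G ?k"] by simp
    also have "\<dots> \<le> norm (Z h) * M" using Gk M(1) by (intro mult_right_mono) auto
    finally have "norm (?l + ?k) \<le> norm (Z h) + norm (Z h) * M" using l norm_triangle_ineq[of ?l ?k] by linarith
    moreover have "?l + ?k = 2 *\<^sub>R h" by (simp add: scaleR_2)
    ultimately have "2 * norm h \<le> (1 + M) * norm (Z h)" by (simp add: algebra_simps)
    then show ?thesis using norm_ge_zero[of h] by linarith
  qed
  have inj: "h = h'" if "Z h = Z h'" for h h'
    using below[of "h - h'"] that by (simp add: Z.diff)
  have "range Z = UNIV"
  proof (rule closed_csubspace_eq_UNIV)
    show "csubspace (range Z)"
      unfolding csubspace_def by (auto simp flip: Z.add ZC intro: range_eqI[of 0 Z 0] simp: Z.zero)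
    have "complete (Z ` UNIV)"
    proof (rule complete_isometric_image[OF _ subspace_UNIV Zlin])
      show "0 < 1 / (1 + M)" using M(1) by simp
      show "\<forall>x\<in>UNIV. 1 / (1 + M) * norm x \<le> norm (Z x)" using below M(1) by (auto simp: field_simps)
    qed (rule complete_UNIV)
    then show "closed (range Z)" by (rule complete_imp_closed)
    fix v assume v: "\<And>z. z \<in> range Z \<Longrightarrow> cinner z v = 0"
    define w where "w = U (J v)"
    have Gw: "G w = v" by (simp add: w_def)
    have "b h ((w + W w) + (v - W v)) = 0" for h
    proof -
      have "0 = Re (cinner (Z h) v)" using v by simp
      also have "\<dots> = Re (cinner (h + W h) (G w)) + Re (cinner (G (h - W h)) v)"
        by (simp add: Z_def cinner_add_left Gw)
      also have "\<dots> = b (h + W h) w + b (h - W h) v" by (simp add: b_def G_sym[of "h + W h" w])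
      also have "\<dots> = b h ((w + W w) + (v - W v))"
        by (simp add: b.add_left b.add_right b.diff_left b.diff_right Ws)
      finally show ?thesis by simp
    qed
    \<comment> \<open>Rearranged, \<open>w + v\<close> is the image of \<open>v - w\<close> under
      the contraction \<open>W\<close>. Comparing the two energies gives
      \<open>b w v \<le> 0\<close>, and \<open>b w v\<close> is the squared norm of \<open>v\<close>
      because \<open>G w = v\<close>.\<close>
    then have "(w + W w) + (v - W v) = 0" using zero_if_nonpos by (metis order_refl)
    then have "w + v = W (v - w)" by (simp add: W.diff algebra_simps)
    then have "b (w + v) (w + v) \<le> b (v - w) (v - w)" using Wb[of "v - w"] by simp
    then have "b w v \<le> 0" by (simp add: b_add_sq b_diff_sq sym[of v w])
    then have "(norm v)\<^sup>2 \<le> 0" by (simp add: b_def Gw Re_cinner_self)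
    then show "v = 0" by simp
  qed
  then have "\<exists>h. Z h = y" by (metis UNIV_I image_iff)
  then show ?thesis using inj unfolding Z_def by metis
qed

text \<open>For \<open>u = h1 + W h2\<close> and \<open>v = W h1 + h2\<close>, \<open>U\<close> maps
  \<open>h - W h\<close> to \<open>u - v\<close>, while \<open>u + v = h + W h\<close>. Twice the
  sum of \<open>Pp u\<close> and \<open>Pm v\<close> is \<open>(u + v) + J (u - v)\<close>, and the
  ranges of \<open>Pp\<close> and \<open>Pm\<close> meet only in 0, so one equation carries both
  conditions.\<close>

lemma boundary_conditions_iff:
  assumes W: "admissible W" and f: "f1 \<in> Hplus J" "f2 \<in> Hminus J" and h: "U h1 = h1" "U h2 = - h2"
  shows "boundary_conditions W h1 h2 f1 f2 \<longleftrightarrow>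
    ((h1 + h2) + W (h1 + h2)) + G ((h1 + h2) - W (h1 + h2)) = 2 *\<^sub>R (f1 + f2)"
proof -
  have Wlin: "bounded_linear W" and UW: "\<And>x. U (W x) = W (U x)" using W unfolding admissible_def by auto
  interpret W: bounded_linear W by (rule Wlin)
  let ?u = "h1 + W h2" and ?v = "W h1 + h2"
  have "U ((h1 + h2) - W (h1 + h2)) = ?u - ?v"
    using h by (simp add: U.diff U.add UW W.add W.diff W.neg algebra_simps)
  then have "((h1 + h2) + W (h1 + h2)) + G ((h1 + h2) - W (h1 + h2)) = 2 *\<^sub>R (Pp ?u + Pm ?v)"
  proof -
    assume u: "U ((h1 + h2) - W (h1 + h2)) = ?u - ?v"
    have "2 *\<^sub>R (Pp ?u + Pm ?v) = (?u + ?v) + J (?u - ?v)"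
      unfolding Pp_def Pm_def scaleR_right_distrib[symmetric] J.diff by simp
    moreover have "(h1 + h2) + W (h1 + h2) = ?u + ?v" by (simp add: W.add)
    ultimately show ?thesis unfolding G_def u by simp
  qed
  moreover have "Pp ?u + Pm ?v = f1 + f2 \<longleftrightarrow> Pp ?u = f1 \<and> Pm ?v = f2"
  proof
    assume e: "Pp ?u + Pm ?v = f1 + f2"
    have "Pp (Pp ?u + Pm ?v) = Pp ?u" "Pp (f1 + f2) = f1" "Pm (Pp ?u + Pm ?v) = Pm ?v" "Pm (f1 + f2) = f2"
      using P_range f by (simp_all add: P_linear P_fixed)
    then show "Pp ?u = f1 \<and> Pm ?v = f2" using e by simp
  qed simp
  ultimately show ?thesis unfolding boundary_conditions_def using h by simp
qed

lemma boundary_conditions_exists: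
  assumes W: "admissible W" and f: "f1 \<in> Hplus J" "f2 \<in> Hminus J"
  shows "\<exists>h1 h2. boundary_conditions W h1 h2 f1 f2"
proof -
  obtain h where h: "(h + W h) + G (h - W h) = 2 *\<^sub>R (f1 + f2)"
    using boundary_operator_bijective[OF W] by blast
  have s: "U (part 1 h) = part 1 h" "U (part (- 1) h) = - part (- 1) h"
    using U_part[of 1 h] U_part[of "- 1" h] by auto
  have "boundary_conditions W (part 1 h) (part (- 1) h) f1 f2"
    unfolding boundary_conditions_iff[OF W f s] part_sum by (rule h)
  then show ?thesis by blast
qed

lemma boundary_conditions_unique:
  assumes W: "admissible W" and f: "f1 \<in> Hplus J" "f2 \<in> Hminus J"
    and h: "boundary_conditions W h1 h2 f1 f2" and k: "boundary_conditions W k1 k2 f1 f2"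
  shows "h1 = k1 \<and> h2 = k2"
proof -
  have s: "U h1 = h1" "U h2 = - h2" "U k1 = k1" "U k2 = - k2"
    using h k unfolding boundary_conditions_def by auto
  have "h1 + h2 = k1 + k2"
    using boundary_operator_bijective[OF W] boundary_conditions_iff[OF W f s(1,2)]
      boundary_conditions_iff[OF W f s(3,4)] h k by blast
  moreover have "part 1 (h1 + h2) = h1" "part 1 (k1 + k2) = k1"
    using s by (simp_all add: part_def U.add scaleR_2[symmetric])
  ultimately show ?thesis by (metis add_left_cancel)
qed

section \<open>Strong solutions as pairs of semigroup orbits\<close>

text \<open>The second orbit runs backwards from \<open>tau\<close> and lies where
  \<open>B = - T\<close>; the two signs cancel, so both orbits solve the same equation. Smoothing
  provides the domain and the derivative in the open interval for arbitrary \<open>h1\<close> and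
  \<open>h2\<close>.\<close>

lemma strong_solution_of_boundary_conditions:
  assumes tau: "0 < tau" and h: "boundary_conditions (S tau) h1 h2 f1 f2"
  shows "strong_solution J DL L tau f1 f2 (\<lambda>x. S x h1 + S (tau - x) h2)"
proof -
  let ?psi = "\<lambda>x. S x h1 + S (tau - x) h2"
  have Uh: "U h1 = h1" "U h2 = - h2" using h unfolding boundary_conditions_def by auto
  have JLT: "- J (L (?psi x)) = - T (S x h1) + T (S (tau - x) h2)" and D: "?psi x \<in> DL"
    if x: "x \<in> {0<..<tau}" for x
  proof -
    have m: "S x h1 \<in> DL" "S (tau - x) h2 \<in> DL" using x S_smoothing by auto
    have u1: "U (S x h1) = 1 *\<^sub>R S x h1" using U_S[of x h1] x Uh by simp
    have u2: "U (S (tau - x) h2) = (- 1) *\<^sub>R S (tau - x) h2"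
      using U_S[of "tau - x" h2] x Uh linear_neg[OF bounded_linear.linear[OF S_bounded_linear], of "tau - x" h2] by simp
    have "J (L (S x h1)) = T (S x h1)" "J (L (S (tau - x) h2)) = - T (S (tau - x) h2)"
      using JL_on_part[OF m(1) u1] JL_on_part[OF m(2) u2] by simp_all
    then show "- J (L (?psi x)) = - T (S x h1) + T (S (tau - x) h2)" using m by (simp add: L_add J.add)
    show "?psi x \<in> DL" using m by (rule DL_add)
  qed
  have deriv: "(?psi has_vector_derivative - T (S x h1) + T (S (tau - x) h2)) (at x)" if x: "x \<in> {0<..<tau}" for x
  proof -
    have "((\<lambda>x. S (- 1 * x + tau) h2) has_vector_derivative (- 1) *\<^sub>R (- T (S (- 1 * x + tau) h2))) (at x)"
      by (rule has_vector_derivative_affine[OF S_derivative]) (use x in simp)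
    then have "((\<lambda>x. S (tau - x) h2) has_vector_derivative T (S (tau - x) h2)) (at x)" by simp
    then show ?thesis using x by (intro has_vector_derivative_add S_derivative) auto
  qed
  have "continuous_on {0..tau} ?psi"
    by (intro continuous_on_add continuous_on_compose2[OF S_continuous] continuous_intros) auto
  moreover have "continuous_on {0<..<tau} (\<lambda>x. - T (S x h1) + T (S (tau - x) h2))"
    by (intro continuous_on_add continuous_on_minus continuous_on_compose2[OF T_S_continuous] continuous_intros) auto
  moreover have "orth_proj (Hplus J) (?psi 0) = f1" "orth_proj (Hminus J) (?psi tau) = f2"
    using h unfolding boundary_conditions_def orth_proj_Hplus orth_proj_Hminus by simp_all
  ultimately show ?thesis
    unfolding strong_solution_def using deriv D JLT
    by (intro conjI exI[of _ "\<lambda>x. - T (S x h1) + T (S (tau - x) h2)"] ballI) simp_all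
qed

text \<open>The spectral projections decouple the equation. The negative component is read in
  reversed time, after which both components solve the forward equation for \<open>T\<close> and are
  determined by their initial values.\<close>

lemma strong_solution_representation:
  assumes tau: "0 < tau" and psi: "strong_solution J DL L tau f1 f2 psi"
  shows "\<exists>h1 h2. boundary_conditions (S tau) h1 h2 f1 f2 \<and> (\<forall>x\<in>{0..tau}. psi x = S x h1 + S (tau - x) h2)"
proof -
  obtain psi' where cont: "continuous_on {0..tau} psi"
    and d: "\<And>x. x \<in> {0<..<tau} \<Longrightarrow> (psi has_vector_derivative psi' x) (at x)"
    and D: "\<And>x. x \<in> {0<..<tau} \<Longrightarrow> psi x \<in> DL" and p: "\<And>x. x \<in> {0<..<tau} \<Longrightarrow> psi' x = - J (L (psi x))"
    and bc: "Pp (psi 0) = f1" "Pm (psi tau) = f2"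
    using psi unfolding strong_solution_def orth_proj_Hplus orth_proj_Hminus by blast
  have s: "(1::real) * 1 = 1" "(-1::real) * (-1) = 1" by auto
  note red = part_reducing[OF s(1)] part_reducing[OF s(2)]
  interpret P: bounded_linear "part 1" by (rule reducingD[OF red(1)])
  interpret M: bounded_linear "part (- 1)" by (rule reducingD[OF red(2)])
  have partJL: "part s (J (L w)) = s *\<^sub>R T (part s w)" if "w \<in> DL" "s * s = 1" for s w
    using part_U[OF that(2)] reducingD(6)[OF part_reducing[OF that(2)] that(1)] by (simp add: JL[OF that(1)])
  have 1: "part 1 (psi x) = S x (part 1 (psi 0))" if x: "x \<in> {0..tau}" for x
  proof (rule ode_unique[OF _ _ _ x])
    show "continuous_on {0..tau} (\<lambda>x. part 1 (psi x))" by (rule P.continuous_on[OF cont])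
    fix t assume t: "0 < t" "t < tau"
    have "((\<lambda>x. part 1 (psi x)) has_vector_derivative - T (part 1 (psi t))) (at t)"
      using P.has_vector_derivative[OF d[of t]] p[of t] D[of t] t partJL[of "psi t" 1] by (simp add: P.neg)
    then show "part 1 (psi t) \<in> DL \<and> ((\<lambda>x. part 1 (psi x)) has_vector_derivative - T (part 1 (psi t))) (at t)"
      using reducingD(5)[OF red(1) D] t by simp
  qed (use tau in simp)
  have 2: "part (- 1) (psi (tau - y)) = S y (part (- 1) (psi (tau - 0)))" if y: "y \<in> {0..tau}" for y
  proof (rule ode_unique[OF _ _ _ y])
    show "continuous_on {0..tau} (\<lambda>y. part (- 1) (psi (tau - y)))"
      by (intro M.continuous_on continuous_on_compose2[OF cont] continuous_intros) auto
    fix t assume t: "0 < t" "t < tau"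
    then have t': "tau - t \<in> {0<..<tau}" by simp
    have "((\<lambda>y. psi (- 1 * y + tau)) has_vector_derivative (- 1) *\<^sub>R psi' (tau - t)) (at t)"
      by (rule has_vector_derivative_affine) (use d[OF t'] in simp)
    then have "((\<lambda>y. psi (tau - y)) has_vector_derivative J (L (psi (tau - t)))) (at t)"
      using p[OF t'] by simp
    from M.has_vector_derivative[OF this]
    show "part (- 1) (psi (tau - t)) \<in> DL
        \<and> ((\<lambda>y. part (- 1) (psi (tau - y))) has_vector_derivative - T (part (- 1) (psi (tau - t)))) (at t)"
      using partJL[OF D[OF t'], of "- 1"] reducingD(5)[OF red(2) D[OF t']] by simp
  qed (use tau in simp)
  define h1 where "h1 = part 1 (psi 0)"
  define h2 where "h2 = part (- 1) (psi tau)"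
  have rep: "psi x = S x h1 + S (tau - x) h2" if x: "x \<in> {0..tau}" for x
    using 1[OF x] 2[of "tau - x"] x part_sum[of "psi x"] by (simp add: h1_def h2_def)
  have "boundary_conditions (S tau) h1 h2 f1 f2"
    unfolding boundary_conditions_def
  proof (intro conjI)
    show "U h1 = h1" "U h2 = - h2" using U_part[of 1] U_part[of "- 1"] by (simp_all add: h1_def h2_def)
    show "Pp (h1 + S tau h2) = f1" using bc(1) rep[of 0] tau by simp
    show "Pm (S tau h1 + h2) = f2" using bc(2) rep[of tau] tau by simp
  qed
  then show ?thesis using rep by blast
qed

section \<open>The operators of the solution formula\<close>

text \<open>The boundary problem for the zero contraction with second datum 0 decouples, and its
  first component is the vector sought; uniqueness comes from pairs of the form
  \<open>(h, 0)\<close>.\<close>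

lemma Rop_Hplus:
  assumes "f \<in> Hplus J" shows "U (Rop {x. U x = x} (Hplus J) f) = Rop {x. U x = x} (Hplus J) f"
    "Pp (Rop {x. U x = x} (Hplus J) f) = f"
    and "U h = h \<Longrightarrow> Pp h = f \<Longrightarrow> Rop {x. U x = x} (Hplus J) f = h"
proof -
  have f2: "0 \<in> Hminus J" by (simp add: Hminus_def J.zero)
  have iff: "boundary_conditions (\<lambda>x. 0) h 0 f 0 \<longleftrightarrow> U h = h \<and> Pp h = f" for h
    by (simp add: boundary_conditions_def U.zero Pm_def J.zero)
  obtain h1 h2 where h: "boundary_conditions (\<lambda>x. 0) h1 h2 f 0"
    using boundary_conditions_exists[OF admissible_zero assms f2] by blast
  have un: "h = h'" if "U h = h \<and> Pp h = f" "U h' = h' \<and> Pp h' = f" for h h'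
    using boundary_conditions_unique[OF admissible_zero assms f2, of h 0 h' 0] iff that by blast
  have "\<exists>!h. h \<in> {x. U x = x} \<and> orth_proj (Hplus J) h = f"
    unfolding orth_proj_Hplus mem_Collect_eq
  proof (rule ex1I[of _ h1])
    show *: "U h1 = h1 \<and> Pp h1 = f" using h by (simp add: boundary_conditions_def)
    show "k = h1" if "U k = k \<and> Pp k = f" for k by (rule un[OF that *])
  qed
  from theI'[OF this]
  have R: "U (Rop {x. U x = x} (Hplus J) f) = Rop {x. U x = x} (Hplus J) f \<and> Pp (Rop {x. U x = x} (Hplus J) f) = f"
    by (simp add: Rop_def orth_proj_Hplus)
  then show "U (Rop {x. U x = x} (Hplus J) f) = Rop {x. U x = x} (Hplus J) f"
    "Pp (Rop {x. U x = x} (Hplus J) f) = f" by auto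
  show "Rop {x. U x = x} (Hplus J) f = h" if "U h = h" "Pp h = f" using un[OF R] that by blast
qed

lemma Rop_Hminus:
  assumes "f \<in> Hminus J" shows "U (Rop {x. U x = - x} (Hminus J) f) = - Rop {x. U x = - x} (Hminus J) f"
    "Pm (Rop {x. U x = - x} (Hminus J) f) = f"
    and "U h = - h \<Longrightarrow> Pm h = f \<Longrightarrow> Rop {x. U x = - x} (Hminus J) f = h"
proof -
  have f1: "0 \<in> Hplus J" by (simp add: Hplus_def J.zero)
  have iff: "boundary_conditions (\<lambda>x. 0) 0 h 0 f \<longleftrightarrow> U h = - h \<and> Pm h = f" for h
    by (simp add: boundary_conditions_def U.zero Pp_def J.zero)
  obtain h1 h2 where h: "boundary_conditions (\<lambda>x. 0) h1 h2 0 f"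
    using boundary_conditions_exists[OF admissible_zero f1 assms] by blast
  have un: "h = h'" if "U h = - h \<and> Pm h = f" "U h' = - h' \<and> Pm h' = f" for h h'
    using boundary_conditions_unique[OF admissible_zero f1 assms, of 0 h 0 h'] iff that by blast
  have "\<exists>!h. h \<in> {x. U x = - x} \<and> orth_proj (Hminus J) h = f"
    unfolding orth_proj_Hminus mem_Collect_eq
  proof (rule ex1I[of _ h2])
    show *: "U h2 = - h2 \<and> Pm h2 = f" using h by (simp add: boundary_conditions_def)
    show "k = h2" if "U k = - k \<and> Pm k = f" for k by (rule un[OF that *])
  qed
  from theI'[OF this]
  have R: "U (Rop {x. U x = - x} (Hminus J) f) = - Rop {x. U x = - x} (Hminus J) f \<and> Pm (Rop {x. U x = - x} (Hminus J) f) = f"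
    by (simp add: Rop_def orth_proj_Hminus)
  then show "U (Rop {x. U x = - x} (Hminus J) f) = - Rop {x. U x = - x} (Hminus J) f"
    "Pm (Rop {x. U x = - x} (Hminus J) f) = f" by auto
  show "Rop {x. U x = - x} (Hminus J) f = h" if "U h = - h" "Pm h = f" using un[OF R] that by blast
qed

lemma exp_Bplus_eq:
  assumes t: "0 \<le> t" and f: "U f = f"
  shows "exp_Bplus J DL L {x. U x = x} t f = S t f"
  unfolding exp_Bplus_def
proof (rule op_exp_eq[OF part_reducing[of 1]])
  show "- J (L f) = - T f" if "f \<in> DL" "part 1 f = f" for f
    using JL_on_part[of f 1] part_fixed[of 1 f] that by simp
  show "{x. U x = x} = {x. part 1 x = x}" by (simp add: part_fixed)
qed (use t f in simp_all)

lemma exp_Bminus_eq: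
  assumes t: "0 \<le> t" and f: "U f = - f"
  shows "exp_Bminus J DL L {x. U x = - x} t f = S t f"
  unfolding exp_Bminus_def
proof (rule op_exp_eq[OF part_reducing[of "- 1"]])
  show "J (L f) = - T f" if "f \<in> DL" "part (- 1) f = f" for f
    using JL_on_part[of f "- 1"] part_fixed[of "- 1" f] that by simp
  show "{x. U x = - x} = {x. part (- 1) x = x}" by (simp add: part_fixed)
qed (use t f in simp_all)

lemma solution_formula_eq:
  assumes tau: "0 < tau" and f: "f1 \<in> Hplus J" "f2 \<in> Hminus J"
    and h: "boundary_conditions (S tau) h1 h2 f1 f2" and x: "x \<in> {0..tau}"
  shows "solution_formula J DL L {x. U x = x} {x. U x = - x} tau f1 f2 x = S x h1 + S (tau - x) h2"
proof -
  let ?Hp = "{x. U x = x}" and ?Hm = "{x. U x = - x}"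
  define Gp where "Gp = Gplus J DL L ?Hp ?Hm tau"
  define Gm where "Gm = Gminus J DL L ?Hp ?Hm tau"
  define r where "r = Rop ?Hp (Hplus J) f1"
  define q where "q = Rop ?Hm (Hminus J) f2"
  have Ugd: "U h1 = h1" "U h2 = - h2" "Pp (h1 + S tau h2) = f1" "Pm (S tau h1 + h2) = f2"
    using h unfolding boundary_conditions_def by auto
  have r: "U r = r" "Pp r = f1" "\<And>h. U h = h \<Longrightarrow> Pp h = f1 \<Longrightarrow> r = h"
    unfolding r_def using Rop_Hplus[OF f(1)] by blast+
  have q: "U q = - q" "Pm q = f2" "\<And>h. U h = - h \<Longrightarrow> Pm h = f2 \<Longrightarrow> q = h"
    unfolding q_def using Rop_Hminus[OF f(2)] by blast+
  have Gp_eq: "Gp k = Rop ?Hm (Hminus J) (Pm (S tau k))" if "U k = k" for k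
    using exp_Bplus_eq[of tau k] that tau by (simp add: Gp_def Gplus_def orth_proj_Hminus)
  have Gm_eq: "Gm k = Rop ?Hp (Hplus J) (Pp (S tau k))" if "U k = - k" for k
    using exp_Bminus_eq[of tau k] that tau by (simp add: Gm_def Gminus_def orth_proj_Hplus)
  have Gp: "U (Gp k) = - Gp k" "Pm (Gp k) = Pm (S tau k)" if "U k = k" for k
    using Rop_Hminus(1,2)[OF P_range(2)] Gp_eq[OF that] by auto
  have Gm: "U (Gm k) = Gm k" "Pp (Gm k) = Pp (S tau k)" if "U k = - k" for k
    using Rop_Hplus(1,2)[OF P_range(1)] Gm_eq[OF that] by auto
  interpret St: bounded_linear "S tau" using tau by (intro S_bounded_linear) simp
  have Gp_diff: "Gp (k - l) = Gp k - Gp l" if "U k = k" "U l = l" for k l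
  proof -
    have kl: "U (k - l) = k - l" using that by (simp add: U.diff)
    show ?thesis unfolding Gp_eq[OF kl]
      by (rule Rop_Hminus(3)[OF P_range(2)]) (use Gp that in \<open>simp_all add: U.diff P_linear St.diff\<close>)
  qed
  have Gm_diff: "Gm (k - l) = Gm k - Gm l" if "U k = - k" "U l = - l" for k l
  proof -
    have kl: "U (k - l) = - (k - l)" using that by (simp add: U.diff)
    show ?thesis unfolding Gm_eq[OF kl]
      by (rule Rop_Hplus(3)[OF P_range(1)]) (use Gm that in \<open>simp_all add: U.diff P_linear St.diff\<close>)
  qed
  \<comment> \<open>Injectivity of the projection \<open>Pp\<close> on \<open>Hp\<close>, in the
    form of the uniqueness statement for \<open>r\<close>, turns the first boundary condition into
    an identity in \<open>Hp\<close>; the second is treated in the same way in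
    \<open>Hm\<close>.\<close>
  have system: "boundary_conditions (S tau) k l f1 f2 \<longleftrightarrow> k + Gm l = r \<and> Gp k + l = q" if kl: "U k = k" "U l = - l" for k l
  proof -
    have "k + Gm l = r \<longleftrightarrow> Pp (k + S tau l) = f1"
      using r(2) r(3)[of "k + Gm l"] Gm[OF kl(2)] kl by (auto simp: P_linear U.add)
    moreover have "Gp k + l = q \<longleftrightarrow> Pm (S tau k + l) = f2"
      using q(2) q(3)[of "Gp k + l"] Gp[OF kl(1)] kl by (auto simp: P_linear U.add)
    ultimately show ?thesis unfolding boundary_conditions_def using kl by simp
  qed
  have h_sys: "h1 + Gm h2 = r" "Gp h1 + h2 = q" using system[OF Ugd(1,2)] h by auto
  have uniq: "k = h1 \<and> l = h2" if "U k = k" "U l = - l" "k + Gm l = r" "Gp k + l = q" for k l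
    using boundary_conditions_unique[OF admissible_S f _ h, of k l] system[OF that(1,2)] that tau by simp
  have "inv_I_minus ?Hp (\<lambda>k. Gm (Gp k)) (r - Gm q) = h1"
    unfolding inv_I_minus_def
  proof (rule the_equality)
    have "Gp h1 = q - h2" using h_sys(2) by (metis add_diff_cancel_right')
    then have "Gm (Gp h1) = Gm q - Gm h2" using Gm_diff q(1) Ugd by simp
    then show "h1 \<in> ?Hp \<and> h1 - Gm (Gp h1) = r - Gm q" using h_sys(1) Ugd by (auto simp: algebra_simps)
    fix k assume k: "k \<in> ?Hp \<and> k - Gm (Gp k) = r - Gm q"
    \<comment> \<open>A competitor \<open>k\<close> is completed by the second component
      \<open>q - Gp k\<close> to a solution of the whole system, where uniqueness is known.\<close>
    have "Gm (q - Gp k) = Gm q - Gm (Gp k)" using Gm_diff q(1) Gp k by simp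
    then have "k + Gm (q - Gp k) = (k - Gm (Gp k)) + Gm q" by simp
    also have "\<dots> = r" using k by simp
    finally have "k + Gm (q - Gp k) = r" .
    then show "k = h1" using uniq[of k "q - Gp k"] k q(1) Gp[of k] by (simp add: U.diff)
  qed
  moreover have "inv_I_minus ?Hm (\<lambda>k. Gp (Gm k)) (q - Gp r) = h2"
    unfolding inv_I_minus_def
  proof (rule the_equality)
    have "Gm h2 = r - h1" using h_sys(1) by (metis add_diff_cancel_left')
    then have "Gp (Gm h2) = Gp r - Gp h1" using Gp_diff r(1) Ugd by simp
    then show "h2 \<in> ?Hm \<and> h2 - Gp (Gm h2) = q - Gp r" using h_sys(2) Ugd by (auto simp: algebra_simps)
    fix l assume l: "l \<in> ?Hm \<and> l - Gp (Gm l) = q - Gp r"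
    have "Gp (r - Gm l) = Gp r - Gp (Gm l)" using Gp_diff r(1) Gm l by simp
    then have "Gp (r - Gm l) + l = (l - Gp (Gm l)) + Gp r" by simp
    also have "\<dots> = q" using l by simp
    finally have "Gp (r - Gm l) + l = q" .
    then show "l = h2" using uniq[of "r - Gm l" l] l r(1) Gm[of l] by (simp add: U.diff)
  qed
  ultimately show ?thesis
    unfolding solution_formula_def Let_def Gp_def[symmetric] Gm_def[symmetric] r_def[symmetric] q_def[symmetric]
    using exp_Bplus_eq[of x h1] exp_Bminus_eq[of "tau - x" h2] Ugd x by simp
qed

end

theorem theorem1:
  fixes J L :: "'a::chilbert \<Rightarrow> 'a" and DL :: "'a set"
    and tau :: real and phip phim :: 'a
  assumes "signature_op J"
    and "self_adjoint DL L"
    and "positive_op DL L"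
    and "similar_to_selfadjoint DL (\<lambda>f. J (L f))"
    and "0 < tau"
    and "phip \<in> Hplus J" and "phim \<in> Hminus J"
  shows "(\<exists>psi. strong_solution J DL L tau phip phim psi)
    \<and> (\<forall>psi1 psi2. strong_solution J DL L tau phip phim psi1
          \<and> strong_solution J DL L tau phip phim psi2
          \<longrightarrow> (\<forall>x\<in>{0..tau}. psi1 x = psi2 x))
    \<and> (\<exists>Hp Hm. spectral_decomp J DL L Hp Hm)
    \<and> (\<forall>Hp Hm psi. spectral_decomp J DL L Hp Hm
          \<and> strong_solution J DL L tau phip phim psi
          \<longrightarrow> (\<forall>x\<in>{0..tau}. psi x = solution_formula J DL L Hp Hm tau phip phim x))"
proof -
  obtain U c where U: "bounded_clinear_op U \<and> (\<forall>x. U (U x) = x) \<and> c > 0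
     \<and> (\<forall>x. c * (norm x)\<^sup>2 \<le> Re (cinner (J (U x)) x))
     \<and> (\<forall>x y. cinner (J (U x)) y = cinner (J x) (U y))
     \<and> (\<forall>x\<in>DL. U x \<in> DL \<and> J (L (U x)) = U (J (L x)))"
    using fundamental_symmetry_exists[OF assms(1,2,4)] by (elim exE)
  then have "krein_setting J L U DL c"
    using assms(1-3) by (intro krein_setting.intro) blast+
  then interpret krein_setting J L U DL c .
  show ?thesis
  proof (intro conjI allI impI ballI)
    obtain h1 h2 where "boundary_conditions (S tau) h1 h2 phip phim"
      using boundary_conditions_exists[OF admissible_S assms(6,7)] assms(5) by fastforce
    then show "\<exists>psi. strong_solution J DL L tau phip phim psi"
      using strong_solution_of_boundary_conditions[OF assms(5)] by blast
    show "\<exists>Hp Hm. spectral_decomp J DL L Hp Hm" using spectral_decomp_eigenspaces by blast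
  next
    fix psi1 psi2 x
    assume sol: "strong_solution J DL L tau phip phim psi1 \<and> strong_solution J DL L tau phip phim psi2"
      and x: "x \<in> {0..tau}"
    obtain h1 h2 where h: "boundary_conditions (S tau) h1 h2 phip phim" "psi1 x = S x h1 + S (tau - x) h2"
      using strong_solution_representation[OF assms(5)] sol x by blast
    obtain k1 k2 where k: "boundary_conditions (S tau) k1 k2 phip phim" "psi2 x = S x k1 + S (tau - x) k2"
      using strong_solution_representation[OF assms(5)] sol x by blast
    show "psi1 x = psi2 x"
      using boundary_conditions_unique[OF admissible_S assms(6,7) h(1) k(1)] h(2) k(2) assms(5) by simp
  next
    fix Hp Hm psi x
    assume *: "spectral_decomp J DL L Hp Hm \<and> strong_solution J DL L tau phip phim psi" and x: "x \<in> {0..tau}"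
    \<comment> \<open>The symmetry of the given decomposition is not compared with \<open>U\<close>.
      The representation of the solution is derived anew with the semigroup belonging to
      \<open>U'\<close>, which is the one occurring in the formula.\<close>
    obtain U' c' where K: "krein_setting J L U' DL c'" and H: "Hp = {x. U' x = x}" "Hm = {x. U' x = - x}"
      using krein_setting_of_spectral_decomp[OF assms(1-3)] * by blast
    interpret K: krein_setting J L U' DL c' by (rule K)
    obtain h1 h2 where h: "K.boundary_conditions (K.S tau) h1 h2 phip phim" "psi x = K.S x h1 + K.S (tau - x) h2"
      using K.strong_solution_representation[OF assms(5)] * x by blast
    show "psi x = solution_formula J DL L Hp Hm tau phip phim x"
      unfolding H using K.solution_formula_eq[OF assms(5-7) h(1) x] h(2) by simp
  qed
qed

end
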